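(* Let $(\mathcal{A}_i,\varphi_i)_{i\in I}$ be a family of noncommutative probability spaces. For any $n\in\mathbb{N}$, any reduced Motzkin word $w=j_1\cdots j_n\in\mathcal{M}_n$, and any $a_k\in\mathcal{A}_{i_k}$, $k=1,\dots,n$, where $i_1,\dots,i_n\in I$ are arbitrary, $$\varphi(w)(a_1,\dots,a_n)=\sum_{\pi\in\mathcal{M}(w,\ell)}\beta_\pi[a_1,\dots,a_n],$$ where $\ell=(i_1,\dots,i_n)$ is the label of $(a_1,\dots,a_n)$ and $\varphi(w)(a_1,\dots,a_n)=\Phi(a_1(j_1)\cdots a_n(j_n))$ is the multilinear Motzkin functional.
   Context: **Probability spaces and notation.** $\mathbb{N}=\{1,2,\dots\}$. A noncommutative probability space $(\mathcal{A},\varphi)$ is a unital complex algebra with a linear functional $\varphi$ such that $\varphi(1)=1$. The unit of $\mathcal{A}_i$ is $1_i$. **Orthogonal replicas.** For each $i\in I$ let $p_i$ be an abstract idempotent ($p_i^2=p_i$) and let $\widetilde{\mathcal{A}}_i=\mathcal{A}_i\star\mathbb{C}[p_i]$ (free product with identified units, where $\mathbb{C}[p_i]$ is the unital algebra generated by $p_i$), with the linear functional $\widetilde\varphi_i$ determined by $\widetilde\varphi_i(p_i)=1$ and $\widetilde\varphi_i(p_i^{\gamma}a_1p_ia_2p_i\cdots p_ia_mp_i^{\delta})=\varphi_i(a_1)\cdots\varphi_i(a_m)$ for $\gamma,\delta\in\{0,1\}$, $a_1,\dots,a_m\in\mathcal{A}_i$. Let $\mathcal{A}_\otimes=\bigotimes_{i\in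 I}\widetilde{\mathcal{A}}_i^{\otimes\infty}$ be the infinite tensor product spanned by simple tensors $\bigotimes_{i\in I}\bigotimes_{k=1}^\infty x_{i,k}$ with $x_{i,k}\in\widetilde{\mathcal{A}}_i$ and $x_{i,k}\notin\{1_i,p_i\}$ for only finitely many sites $(i,k)$ (multilinear in the entries, multiplied sitewise), and let $\Phi_\otimes$ be the linear functional with $\Phi_\otimes(\bigotimes x_{i,k})=\prod_{i,k}\widetilde\varphi_i(x_{i,k})$. For $i\in I$ and $j\in\mathbb{N}$ let $P_i(j)$ be the simple tensor with $1_i$ at all sites $(i,m)$ and, for each $k\neq i$, with $1_k$ at sites $(k,m)$, $m\le j-1$, and $p_k$ at sites $(k,m)$, $m\geq j$; put $P_i(0)=0$ and $p_i(j)=P_i(j)-P_i(j-1)$. For $a\in\mathcal{A}_i$ let $\iota_j(a)$ be the simple tensor with $a$ at site $(i,j)$ and units elsewhere. The orthogonal replica of $a\in\mathcal{A}_i$ of label $i$ and color $j$ is $a(j)=\iota_j(a)\,p_i(j)$. $\mathcal{A}_{\rm rep}$ is the unital subalgebra of $\mathcal{A}_\otimes$ generated by all replicas, and $\Phi$ is the restriction of $\Phi_\otimes$ to $\mathcal{A}_{\rm rep}$. **Motzkin words.** $\mathcal{M}_n$ is the set of reduced Motzkin words of length $n$, i.e. words $w=j_1\cdots j_n$ in letters from $\mathbb{N}$ with $j_1=j_n=1$ and $|j_k-j_{k-1}|\in\{0,1\}$ for $1<k\le n$. **Noncrossing partitions.** Let $\pi_0$ be a noncrossing partition of $[n]=\{1,\dots,n\}$.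 A block $V_j$ is an outer block of a block $V_i\ne V_j$ if there are $p,q\in V_j$ with $p<k<q$ for all $k\in V_i$. A block with no outer blocks is a covering block. If $V_i$ is not covering, its nearest outer block $o(V_i)$ is the unique outer block $V_j$ of $V_i$ such that no block $V_k$ is both an outer block of $V_i$ and has $V_j$ as an outer block. The depth $d(V)$ is $1$ for covering blocks, and $d(V)=d(o(V))+1$ otherwise. For $w=j_1\cdots j_n\in\mathcal{M}_n$, $\mathcal{M}(w)$ is the set of noncrossing partitions monotonically adapted to $w$: a noncrossing partition $\pi_0=\{V_1,\dots,V_k\}$ of $[n]$, with each block $V_j$ paired with the corresponding subword $v_j$ of $w$, such that $v_j=d^{|V_j|}$ with $d=d(V_j)$ (i.e. for each $r\in[n]$, the letter $j_r$ equals the depth of the block containing $r$). **Labels.** A monotone chain of blocks in $\pi\in\mathcal{M}(w)$ is a sequence of blocks $(V_{j_1},\dots,V_{j_p})$ with $V_{j_1}=o(V_{j_2}),\dots,V_{j_{p-1}}=o(V_{j_p})$ whose associated constant words have strictly increasing colors (letters). $\mathcal{M}(w,\ell)$, for $\ell=(i_1,\dots,i_n)$, is the set of $\pi\in\mathcal{M}(w)$ such that (i) $i_k=i_l$ whenever $k,l$ belong to the same block (this common value is the label of the block), and (ii) the labels of blocks alternate in monotone chains of blocks of $\pi$ (consecutive blocks in a chain have different labels). **Boolean cumulants.** The boolean cumulants $\beta_n$ of a normalized linear functional $\varphi$ on a unital algebra are the multilinear functionals defined recursively by $\varphi(z_1\cdots z_n)=\sum_{\pi_0\in{\rm Int}(n)}\prod_{V\in\pi_0}\beta_{|V|}(z_{V})$,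 where ${\rm Int}(n)$ is the set of interval partitions of $[n]$ and $z_V=(z_{k_1},\dots,z_{k_r})$ for $V=\{k_1<\cdots<k_r\}$. For $\pi\in\mathcal{M}(w,\ell)$, $\beta_\pi[a_1,\dots,a_n]=\prod_{V\in\pi}\beta_{|V|}(a_V)$, where, for a block $V$ with label $i$, $\beta_{|V|}$ is the boolean cumulant of $(\mathcal{A}_i,\varphi_i)$. *)

theory Defs
  imports Complex_Main "HOL-Algebra.QuotRing" "HOL-Algebra.Subrings" "HOL-Library.FuncSet" "HOL-Library.Disjoint_Sets"
begin

section \<open>Complex algebras and noncommutative probability spaces\<close>

definition complex_field :: "complex ring" where
  "complex_field = \<lparr>carrier = UNIV, monoid.mult = (*), one = 1, zero = 0, add = (+)\<rparr>"

text \<open>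
  The locale \<^locale>\<open>algebra\<close> of the library is commutative; the following is its
  noncommutative unital version over the complex numbers.
\<close>

locale complex_algebra = ring A + module complex_field A
  for A :: "(complex, 'a) module" (structure) +
  assumes smult_mult_left:
      "\<lbrakk>x \<in> carrier A; y \<in> carrier A\<rbrakk> \<Longrightarrow> (c \<odot> x) \<otimes> y = c \<odot> (x \<otimes> y)"
    and smult_mult_right:
      "\<lbrakk>x \<in> carrier A; y \<in> carrier A\<rbrakk> \<Longrightarrow> x \<otimes> (c \<odot> y) = c \<odot> (x \<otimes> y)"

definition linear_functional :: "(complex, 'a) module \<Rightarrow> ('a \<Rightarrow> complex) \<Rightarrow> bool" where
  "linear_functional A f \<longleftrightarrow>
     (\<forall>x\<in>carrier A. \<forall>y\<in>carrier A. f (x \<oplus>\<^bsub>A\<^esub> y) = f x + f y) \<and>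
     (\<forall>c. \<forall>x\<in>carrier A. f (c \<odot>\<^bsub>A\<^esub> x) = c * f x)"

definition nc_prob_space :: "(complex, 'a) module \<Rightarrow> ('a \<Rightarrow> complex) \<Rightarrow> bool" where
  "nc_prob_space A \<phi> \<longleftrightarrow> complex_algebra A \<and> linear_functional A \<phi> \<and> \<phi> \<one>\<^bsub>A\<^esub> = 1"

definition unital_subalgebra :: "'a set \<Rightarrow> (complex, 'a) module \<Rightarrow> bool" where
  "unital_subalgebra B A \<longleftrightarrow> subring B A \<and> (\<forall>c. \<forall>x\<in>B. c \<odot>\<^bsub>A\<^esub> x \<in> B)"

definition ordered_prod :: "('a, 'b) monoid_scheme \<Rightarrow> 'a list \<Rightarrow> 'a" where
  "ordered_prod G xs = foldr (\<otimes>\<^bsub>G\<^esub>) xs \<one>\<^bsub>G\<^esub>"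

section \<open>Algebras given by generators and relations\<close>

text \<open>
  The monoid algebra \<open>\<complex>[M]\<close>: finitely supported functions with convolution.
\<close>

definition monoid_algebra :: "('x, 'e) monoid_scheme \<Rightarrow> (complex, 'x \<Rightarrow> complex) module" where
  "monoid_algebra M =
     \<lparr>carrier = {f. finite {x. f x \<noteq> 0} \<and> {x. f x \<noteq> 0} \<subseteq> carrier M},
      monoid.mult = (\<lambda>f g z. \<Sum>(x, y) \<in> {(x, y). f x \<noteq> 0 \<and> g y \<noteq> 0 \<and> x \<otimes>\<^bsub>M\<^esub> y = z}. f x * g y),
      one = (\<lambda>x. if x = \<one>\<^bsub>M\<^esub> then 1 else 0),
      zero = (\<lambda>x. 0),
      add = (\<lambda>f g x. f x + g x),
      smult = (\<lambda>c f x. c * f x)\<rparr>"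

definition single :: "'x \<Rightarrow> 'x \<Rightarrow> complex" where
  "single x = (\<lambda>y. if y = x then 1 else 0)"

text \<open>
  The quotient ring of the library does not carry a scalar multiplication, so it is added here.
  A two-sided ideal of a unital algebra is automatically closed under scalar multiplication.
\<close>

definition quotient_algebra :: "(complex, 'a) module \<Rightarrow> 'a set \<Rightarrow> (complex, 'a set) module" where
  "quotient_algebra A J =
     \<lparr>carrier = carrier (A Quot J),
      monoid.mult = monoid.mult (A Quot J),
      one = one (A Quot J),
      zero = zero (A Quot J),
      add = add (A Quot J),
      smult = (\<lambda>c X. \<Union>x\<in>X. J +>\<^bsub>A\<^esub> (c \<odot>\<^bsub>A\<^esub> x))\<rparr>"

definition presented_algebra ::
    "('x, 'e) monoid_scheme \<Rightarrow> ('x \<Rightarrow> complex) set \<Rightarrow> (complex, ('x \<Rightarrow> complex) set) module" where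
  "presented_algebra M R = quotient_algebra (monoid_algebra M) (Idl\<^bsub>monoid_algebra M\<^esub> R)"

definition presented_gen ::
    "('x, 'e) monoid_scheme \<Rightarrow> ('x \<Rightarrow> complex) set \<Rightarrow> 'x \<Rightarrow> ('x \<Rightarrow> complex) set" where
  "presented_gen M R x = (Idl\<^bsub>monoid_algebra M\<^esub> R) +>\<^bsub>monoid_algebra M\<^esub> single x"

section \<open>The free product of an algebra with the algebra of an idempotent\<close>

datatype 'a letter = Elt 'a | Proj

definition letter_words :: "(complex, 'a) module \<Rightarrow> 'a letter list monoid" where
  "letter_words A =
     \<lparr>carrier = lists (insert Proj (Elt ` carrier A)), monoid.mult = (@), one = []\<rparr>"

text \<open>
  The relations make \<open>Elt\<close> a unital algebra homomorphism on \<open>A\<close> (so that the unit of \<open>A\<close> is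
  identified with the unit of the free product) and \<open>Proj\<close> an idempotent; nothing else is
  imposed. This is the coproduct, in unital algebras, of \<open>A\<close> and \<open>\<complex>[p]\<close> with \<open>p\<^sup>2 = p\<close>.
\<close>

definition tilde_relations :: "(complex, 'a) module \<Rightarrow> ('a letter list \<Rightarrow> complex) set" where
  "tilde_relations A =
     (let F = monoid_algebra (letter_words A) in
      {single [Elt (c \<odot>\<^bsub>A\<^esub> a \<oplus>\<^bsub>A\<^esub> d \<odot>\<^bsub>A\<^esub> b)]
         \<ominus>\<^bsub>F\<^esub> (c \<odot>\<^bsub>F\<^esub> single [Elt a] \<oplus>\<^bsub>F\<^esub> d \<odot>\<^bsub>F\<^esub> single [Elt b])
         | c d a b. a \<in> carrier A \<and> b \<in> carrier A} \<union>
      {single [Elt (a \<otimes>\<^bsub>A\<^esub> b)] \<ominus>\<^bsub>F\<^esub> single [Elt a, Elt b]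
         | a b. a \<in> carrier A \<and> b \<in> carrier A} \<union>
      {single [Elt \<one>\<^bsub>A\<^esub>] \<ominus>\<^bsub>F\<^esub> single [], single [Proj, Proj] \<ominus>\<^bsub>F\<^esub> single [Proj]})"

definition tilde :: "(complex, 'a) module \<Rightarrow> (complex, ('a letter list \<Rightarrow> complex) set) module" where
  "tilde A = presented_algebra (letter_words A) (tilde_relations A)"

definition tilde_emb :: "(complex, 'a) module \<Rightarrow> 'a \<Rightarrow> ('a letter list \<Rightarrow> complex) set" where
  "tilde_emb A a = presented_gen (letter_words A) (tilde_relations A) [Elt a]"

definition tilde_proj :: "(complex, 'a) module \<Rightarrow> ('a letter list \<Rightarrow> complex) set" where
  "tilde_proj A = presented_gen (letter_words A) (tilde_relations A) [Proj]"

text \<open>The product \<open>a\<^sub>1 p a\<^sub>2 p \<cdots> p a\<^sub>m\<close>; it is only used for nonempty lists.\<close>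

fun alternating_prod ::
    "(complex, 'a) module \<Rightarrow> 'a list \<Rightarrow> ('a letter list \<Rightarrow> complex) set" where
  "alternating_prod A [] = \<one>\<^bsub>tilde A\<^esub>"
| "alternating_prod A [a] = tilde_emb A a"
| "alternating_prod A (a # b # as) =
     tilde_emb A a \<otimes>\<^bsub>tilde A\<^esub> (tilde_proj A \<otimes>\<^bsub>tilde A\<^esub> alternating_prod A (b # as))"

text \<open>
  Functionals on a carrier set are made unique as HOL functions by requiring the value
  \<^const>\<open>undefined\<close> outside of it (\<^const>\<open>extensional\<close>).
\<close>

definition tilde_functional ::
    "(complex, 'a) module \<Rightarrow> ('a \<Rightarrow> complex) \<Rightarrow> ('a letter list \<Rightarrow> complex) set \<Rightarrow> complex" where
  "tilde_functional A \<phi> =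
     (THE \<psi>. \<psi> \<in> extensional (carrier (tilde A)) \<and> linear_functional (tilde A) \<psi> \<and>
        \<psi> (tilde_proj A) = 1 \<and>
        (\<forall>\<gamma>\<in>{0, 1 :: nat}. \<forall>\<delta>\<in>{0, 1 :: nat}. \<forall>as. as \<noteq> [] \<and> set as \<subseteq> carrier A \<longrightarrow>
           \<psi> ((tilde_proj A [^]\<^bsub>tilde A\<^esub> \<gamma>) \<otimes>\<^bsub>tilde A\<^esub> alternating_prod A as
                 \<otimes>\<^bsub>tilde A\<^esub> (tilde_proj A [^]\<^bsub>tilde A\<^esub> \<delta>))
             = prod_list (map \<phi> as)))"

section \<open>The infinite tensor product\<close>

text \<open>
  The index set of the family is the whole type \<open>'i\<close>. The algebras are carried by subsets of one
  type \<open>'a\<close>, which is no restriction, since any family of sets embeds into its disjoint union.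
\<close>

type_synonym 'a tilde_elt = "('a letter list \<Rightarrow> complex) set"
type_synonym ('i, 'a) entries = "'i \<times> nat \<Rightarrow> 'a tilde_elt"
type_synonym ('i, 'a) tensor_elt = "(('i, 'a) entries \<Rightarrow> complex) set"

definition sites :: "('i \<times> nat) set" where
  "sites = UNIV \<times> {1..}"

definition tilde_at :: "('i \<Rightarrow> (complex, 'a) module) \<Rightarrow> 'i \<times> nat \<Rightarrow> (complex, 'a tilde_elt) module" where
  "tilde_at A s = tilde (A (fst s))"

definition tensor_entries :: "('i \<Rightarrow> (complex, 'a) module) \<Rightarrow> ('i, 'a) entries set" where
  "tensor_entries A =
     {x \<in> (\<Pi>\<^sub>E s\<in>sites. carrier (tilde_at A s)).
        finite {s \<in> sites. x s \<notin> {\<one>\<^bsub>tilde_at A s\<^esub>, tilde_proj (A (fst s))}}}"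

text \<open>
  Simple tensors multiply sitewise, so the admissible families of entries form a monoid. The
  tensor product is its monoid algebra modulo multilinearity in each entry.
\<close>

definition entries_monoid :: "('i \<Rightarrow> (complex, 'a) module) \<Rightarrow> ('i, 'a) entries monoid" where
  "entries_monoid A =
     \<lparr>carrier = tensor_entries A,
      monoid.mult = (\<lambda>x y. \<lambda>s\<in>sites. x s \<otimes>\<^bsub>tilde_at A s\<^esub> y s),
      one = (\<lambda>s\<in>sites. \<one>\<^bsub>tilde_at A s\<^esub>)\<rparr>"

definition multilinear_relations ::
    "('i \<Rightarrow> (complex, 'a) module) \<Rightarrow> (('i, 'a) entries \<Rightarrow> complex) set" where
  "multilinear_relations A =
     (let F = monoid_algebra (entries_monoid A) in
      {single (x(s := c \<odot>\<^bsub>tilde_at A s\<^esub> u \<oplus>\<^bsub>tilde_at A s\<^esub> d \<odot>\<^bsub>tilde_at A s\<^esub> v))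
         \<ominus>\<^bsub>F\<^esub> (c \<odot>\<^bsub>F\<^esub> single (x(s := u)) \<oplus>\<^bsub>F\<^esub> d \<odot>\<^bsub>F\<^esub> single (x(s := v)))
         | x s c d u v. x \<in> tensor_entries A \<and> s \<in> sites \<and>
             u \<in> carrier (tilde_at A s) \<and> v \<in> carrier (tilde_at A s)})"

definition tensor_algebra ::
    "('i \<Rightarrow> (complex, 'a) module) \<Rightarrow> (complex, ('i, 'a) tensor_elt) module" where
  "tensor_algebra A = presented_algebra (entries_monoid A) (multilinear_relations A)"

definition simple_tensor ::
    "('i \<Rightarrow> (complex, 'a) module) \<Rightarrow> ('i, 'a) entries \<Rightarrow> ('i, 'a) tensor_elt" where
  "simple_tensor A x = presented_gen (entries_monoid A) (multilinear_relations A) x"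

text \<open>
  All but finitely many factors of the infinite product are equal to 1, because the lifted
  functionals take the value 1 at the unit and at the idempotent; the product below is over the
  remaining sites.
\<close>

definition tensor_functional ::
    "('i \<Rightarrow> (complex, 'a) module) \<Rightarrow> ('i \<Rightarrow> 'a \<Rightarrow> complex) \<Rightarrow> ('i, 'a) tensor_elt \<Rightarrow> complex" where
  "tensor_functional A \<phi> =
     (THE \<Psi>. \<Psi> \<in> extensional (carrier (tensor_algebra A)) \<and>
        linear_functional (tensor_algebra A) \<Psi> \<and>
        (\<forall>x\<in>tensor_entries A. \<Psi> (simple_tensor A x) =
           (\<Prod>s \<in> {s \<in> sites. tilde_functional (A (fst s)) (\<phi> (fst s)) (x s) \<noteq> 1}.
              tilde_functional (A (fst s)) (\<phi> (fst s)) (x s))))"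

section \<open>Orthogonal replicas\<close>

definition rep_P :: "('i \<Rightarrow> (complex, 'a) module) \<Rightarrow> 'i \<Rightarrow> nat \<Rightarrow> ('i, 'a) tensor_elt" where
  "rep_P A i j =
     (if j = 0 then \<zero>\<^bsub>tensor_algebra A\<^esub>
      else simple_tensor A
        (\<lambda>s\<in>sites. if fst s \<noteq> i \<and> j \<le> snd s then tilde_proj (A (fst s)) else \<one>\<^bsub>tilde_at A s\<^esub>))"

text \<open>The colors \<open>j\<close> below are at least 1.\<close>

definition rep_p :: "('i \<Rightarrow> (complex, 'a) module) \<Rightarrow> 'i \<Rightarrow> nat \<Rightarrow> ('i, 'a) tensor_elt" where
  "rep_p A i j = rep_P A i j \<ominus>\<^bsub>tensor_algebra A\<^esub> rep_P A i (j - 1)"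

definition rep_iota :: "('i \<Rightarrow> (complex, 'a) module) \<Rightarrow> 'i \<Rightarrow> nat \<Rightarrow> 'a \<Rightarrow> ('i, 'a) tensor_elt" where
  "rep_iota A i j a =
     simple_tensor A (\<lambda>s\<in>sites. if s = (i, j) then tilde_emb (A i) a else \<one>\<^bsub>tilde_at A s\<^esub>)"

definition replica :: "('i \<Rightarrow> (complex, 'a) module) \<Rightarrow> 'i \<Rightarrow> nat \<Rightarrow> 'a \<Rightarrow> ('i, 'a) tensor_elt" where
  "replica A i j a = rep_iota A i j a \<otimes>\<^bsub>tensor_algebra A\<^esub> rep_p A i j"

definition rep_algebra :: "('i \<Rightarrow> (complex, 'a) module) \<Rightarrow> ('i, 'a) tensor_elt set" where
  "rep_algebra A =
     \<Inter>{B. unital_subalgebra B (tensor_algebra A) \<and>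
          {replica A i j a | i j a. 1 \<le> j \<and> a \<in> carrier (A i)} \<subseteq> B}"

definition rep_functional ::
    "('i \<Rightarrow> (complex, 'a) module) \<Rightarrow> ('i \<Rightarrow> 'a \<Rightarrow> complex) \<Rightarrow> ('i, 'a) tensor_elt \<Rightarrow> complex" where
  "rep_functional A \<phi> = restrict (tensor_functional A \<phi>) (rep_algebra A)"

section \<open>Motzkin words and adapted noncrossing partitions\<close>

text \<open>
  Words, labels and tuples are lists; accordingly, positions are numbered from 0 and \<open>[n]\<close> is
  rendered as \<^term>\<open>{..<n::nat}\<close>. Letters, colors and depths start from 1.
\<close>

definition motzkin_words :: "nat \<Rightarrow> nat list set" where
  "motzkin_words n =
     {w. length w = n \<and> w \<noteq> [] \<and> set w \<subseteq> {1..} \<and> hd w = 1 \<and> last w = 1 \<and>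
         (\<forall>k. Suc k < n \<longrightarrow> \<bar>int (w ! Suc k) - int (w ! k)\<bar> \<in> {0, 1})}"

definition motzkin_functional ::
    "('i \<Rightarrow> (complex, 'a) module) \<Rightarrow> ('i \<Rightarrow> 'a \<Rightarrow> complex) \<Rightarrow>
     nat list \<Rightarrow> 'i list \<Rightarrow> 'a list \<Rightarrow> complex" where
  "motzkin_functional A \<phi> w ls as =
     rep_functional A \<phi>
       (ordered_prod (tensor_algebra A)
         (map (\<lambda>k. replica A (ls ! k) (w ! k) (as ! k)) [0..<length w]))"

definition noncrossing_partition :: "nat \<Rightarrow> nat set set \<Rightarrow> bool" where
  "noncrossing_partition n P \<longleftrightarrow>
     partition_on {..<n} P \<and>
     (\<forall>V\<in>P. \<forall>W\<in>P. V \<noteq> W \<longrightarrow>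
        \<not> (\<exists>a\<in>V. \<exists>b\<in>W. \<exists>c\<in>V. \<exists>d\<in>W. a < b \<and> b < c \<and> c < d))"

text \<open>\<open>outer V W\<close> means that \<open>V\<close> is an outer block of \<open>W\<close>.\<close>

definition outer :: "nat set \<Rightarrow> nat set \<Rightarrow> bool" where
  "outer V W \<longleftrightarrow> V \<noteq> W \<and> (\<exists>p\<in>V. \<exists>q\<in>V. \<forall>k\<in>W. p < k \<and> k < q)"

definition covering :: "nat set set \<Rightarrow> nat set \<Rightarrow> bool" where
  "covering P V \<longleftrightarrow> \<not> (\<exists>U\<in>P. outer U V)"

definition nearest_outer :: "nat set set \<Rightarrow> nat set \<Rightarrow> nat set" where
  "nearest_outer P W =
     (THE V. V \<in> P \<and> outer V W \<and> \<not> (\<exists>U\<in>P. outer U W \<and> outer V U))"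

inductive has_depth :: "nat set set \<Rightarrow> nat set \<Rightarrow> nat \<Rightarrow> bool" for P where
  covering: "V \<in> P \<Longrightarrow> covering P V \<Longrightarrow> has_depth P V 1"
| nested: "V \<in> P \<Longrightarrow> \<not> covering P V \<Longrightarrow> has_depth P (nearest_outer P V) d
             \<Longrightarrow> has_depth P V (d + 1)"

definition depth :: "nat set set \<Rightarrow> nat set \<Rightarrow> nat" where
  "depth P V = (THE d. has_depth P V d)"

definition adapted_partitions :: "nat list \<Rightarrow> nat set set set" where
  "adapted_partitions w =
     {P. noncrossing_partition (length w) P \<and> (\<forall>V\<in>P. \<forall>r\<in>V. w ! r = depth P V)}"

definition block_label :: "'i list \<Rightarrow> nat set \<Rightarrow> 'i" where
  "block_label ls V = the_elem ((!) ls ` V)"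

text \<open>
  Covering blocks have no nearest outer block, whence the guard in the next definition.
\<close>

definition monotone_chain :: "nat list \<Rightarrow> nat set set \<Rightarrow> nat set list \<Rightarrow> bool" where
  "monotone_chain w P Vs \<longleftrightarrow>
     Vs \<noteq> [] \<and> set Vs \<subseteq> P \<and>
     (\<forall>k. Suc k < length Vs \<longrightarrow>
        \<not> covering P (Vs ! Suc k) \<and> Vs ! k = nearest_outer P (Vs ! Suc k) \<and>
        (\<forall>r\<in>Vs ! k. \<forall>s\<in>Vs ! Suc k. w ! r < w ! s))"

definition labeled_partitions :: "nat list \<Rightarrow> 'i list \<Rightarrow> nat set set set" where
  "labeled_partitions w ls =
     {P \<in> adapted_partitions w.
        (\<forall>V\<in>P. \<forall>k\<in>V. \<forall>l\<in>V. ls ! k = ls ! l) \<and>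
        (\<forall>Vs. monotone_chain w P Vs \<longrightarrow>
           (\<forall>k. Suc k < length Vs \<longrightarrow>
              block_label ls (Vs ! k) \<noteq> block_label ls (Vs ! Suc k)))}"

section \<open>Boolean cumulants\<close>

definition interval_partitions :: "nat \<Rightarrow> nat set set set" where
  "interval_partitions n =
     {P. partition_on {..<n} P \<and> (\<forall>V\<in>P. \<forall>x\<in>V. \<forall>y\<in>V. {x..y} \<subseteq> V)}"

lemma finite_interval_partitions [simp]: "finite (interval_partitions n)"
proof (rule finite_subset)
  show "interval_partitions n \<subseteq> Pow (Pow {..<n})"
    by (auto simp: interval_partitions_def partition_on_def)
qed auto

lemma length_nths_proper_block:
  assumes "P \<in> interval_partitions (length zs) - {{{..<length zs}}}" "V \<in> P"
  shows "length (nths zs V) < length zs"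
proof -
  have part: "partition_on {..<length zs} P" and ne: "P \<noteq> {{..<length zs}}"
    using assms(1) by (auto simp: interval_partitions_def)
  have sub: "V \<subseteq> {..<length zs}"
    using part assms(2) by (auto simp: partition_on_def)
  have "V \<noteq> {..<length zs}"
  proof
    assume V: "V = {..<length zs}"
    have "W = V" if "W \<in> P" for W
    proof (rule ccontr)
      assume "W \<noteq> V"
      then have "W \<inter> V = {}"
        using part that assms(2) by (auto simp: partition_on_def disjoint_def)
      moreover have "W \<subseteq> V" "W \<noteq> {}"
        using part that V by (auto simp: partition_on_def)
      ultimately show False by blast
    qed
    then have "P = {V}" using assms(2) by blast
    with ne V show False by simp
  qed
  then have "V \<subset> {..<length zs}" using sub by blast
  then have "card V < length zs"
    using psubset_card_mono[of "{..<length zs}" V] by simp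
  moreover have "{i. i < length zs \<and> i \<in> V} = V" using sub by auto
  ultimately show ?thesis by (simp add: length_nths)
qed

text \<open>
  The moment formula, solved for the term of the one-block partition; its original form is
  \<open>boolean_cumulant_moment\<close> below. Here \<^term>\<open>nths zs V\<close> is the subtuple \<open>z\<^sub>V\<close>.
\<close>

function boolean_cumulant ::
    "(complex, 'a) module \<Rightarrow> ('a \<Rightarrow> complex) \<Rightarrow> 'a list \<Rightarrow> complex" where
  "boolean_cumulant A \<phi> zs =
     \<phi> (ordered_prod A zs) -
     (\<Sum>P \<in> interval_partitions (length zs) - {{{..<length zs}}}.
        \<Prod>V\<in>P. boolean_cumulant A \<phi> (nths zs V))"
  by pat_completeness auto
termination
  by (relation "measure (\<lambda>(A, \<phi>, zs). length zs)") (use length_nths_proper_block in auto)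

declare boolean_cumulant.simps [simp del]

lemma boolean_cumulant_moment:
  assumes "zs \<noteq> []"
  shows "\<phi> (ordered_prod A zs) =
     (\<Sum>P \<in> interval_partitions (length zs). \<Prod>V\<in>P. boolean_cumulant A \<phi> (nths zs V))"
proof -
  let ?f = "\<lambda>P. \<Prod>V\<in>P. boolean_cumulant A \<phi> (nths zs V)"
  have "{{..<length zs}} \<in> interval_partitions (length zs)"
    using assms by (auto simp: interval_partitions_def partition_on_def disjoint_def)
  then have "(\<Sum>P \<in> interval_partitions (length zs). ?f P) =
      ?f {{..<length zs}} + (\<Sum>P \<in> interval_partitions (length zs) - {{{..<length zs}}}. ?f P)"
    by (intro sum.remove) auto
  moreover have "nths zs {..<length zs} = zs"
    by simp
  ultimately show ?thesis
    using boolean_cumulant.simps[of A \<phi> zs] by simp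
qed

definition partition_cumulant ::
    "('i \<Rightarrow> (complex, 'a) module) \<Rightarrow> ('i \<Rightarrow> 'a \<Rightarrow> complex) \<Rightarrow>
     'i list \<Rightarrow> nat set set \<Rightarrow> 'a list \<Rightarrow> complex" where
  "partition_cumulant A \<phi> ls P as =
     (\<Prod>V\<in>P. boolean_cumulant (A (block_label ls V)) (\<phi> (block_label ls V)) (nths as V))"

end

theory Submission
  imports Defs
begin

text \<open>
  The functional \<open>\<Phi>\<close> turns a product of replicas into a signed sum over simple tensors, and the
  lifted functional satisfies \<open>\<phi>(x p y) = \<phi>(x) \<phi>(y)\<close> at every site. Write \<open>q = 1 - p\<close>. Reading the word
  from left to right, one can therefore replace the tensor at any moment, up to a scalar and without
  changing the value of the functional on products with further replicas, by one that is nontrivial only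
  at one site per level \<open>1, \<dots>, h\<close>, where \<open>h\<close> is the current letter: the site at level \<open>m < h\<close> carries
  \<open>a\<^sub>1 q a\<^sub>2 q \<cdots> q a\<^sub>r q\<close> and the top one \<open>a\<^sub>1 q a\<^sub>2 q \<cdots> q a\<^sub>r\<close>. A step up appends \<open>q\<close> to the top entry
  (and vanishes if the label is repeated), since \<open>P\<^sub>i(j) - P\<^sub>i(j - 1)\<close> acts there as \<open>1 - p\<close>. At a level step
  with the same label, \<open>1 = q + p\<close> either prolongs the open block or closes it. A step down closes the top
  block and is killed by \<open>q p = 0\<close> unless it has the label of the block below. The open blocks form a stack,
  its histories are exactly the labeled partitions, and a closed block contributes
  \<open>\<phi>(a\<^sub>1 q a\<^sub>2 q \<cdots> q a\<^sub>r)\<close>. The same computation on the constant word with a single label is the moment formula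
  for these numbers, so they are the boolean cumulants.
\<close>

section \<open>Monoid algebras\<close>

text \<open>Tensors that replace each other in the evaluation need not be equal in the algebra; only
  their values on products with arbitrary right factors agree. Equivalence is therefore tested by
  right multiplication with all families of entries, and a test of this kind survives every further
  replica. It also explains why projections at sites not yet touched may be forgotten: the lifted
  functional has the same value at p v and at v. On the combinatorial side the obstacle is depth. It
  is traded for conditions on the word alone, and the return of the word to 1 later supplies the
  closing ends of the enclosing blocks. Both functionals are definite descriptions, so nothing can
  be computed before existence and uniqueness are settled. Existence comes from functions on words
  or entries that annihilate all two-sided translates of the relations, uniqueness from spanning
  sets.\<close>

definition lin_ext :: "('x \<Rightarrow> complex) \<Rightarrow> ('x \<Rightarrow> complex) \<Rightarrow> complex" where
  "lin_ext f h = (\<Sum>x | f x \<noteq> 0. f x * h x)"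

lemma lin_ext_superset:
  assumes "finite B" "{x. f x \<noteq> 0} \<subseteq> B"
  shows "lin_ext f h = (\<Sum>x\<in>B. f x * h x)"
  unfolding lin_ext_def using assms by (intro sum.mono_neutral_left) auto

lemma lin_ext_cong:
  assumes "\<And>x. f x \<noteq> 0 \<Longrightarrow> h x = k x"
  shows "lin_ext f h = lin_ext f k"
  unfolding lin_ext_def using assms by (intro sum.cong) auto

lemma lin_ext_single [simp]: "lin_ext (single x) h = h x"
proof -
  have "{y. single x y \<noteq> 0} = {x}" by (auto simp: single_def)
  then show ?thesis by (simp add: lin_ext_def) (simp add: single_def)
qed

lemma lin_ext_zero [simp]: "lin_ext (\<lambda>x. 0) h = 0"
  by (simp add: lin_ext_def)

lemma lin_ext_add:
  assumes "finite {x. f x \<noteq> 0}" "finite {x. g x \<noteq> 0}"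
  shows "lin_ext (\<lambda>x. f x + g x) h = lin_ext f h + lin_ext g h"
proof -
  let ?B = "{x. f x \<noteq> 0} \<union> {x. g x \<noteq> 0}"
  have "lin_ext (\<lambda>x. f x + g x) h = (\<Sum>x\<in>?B. (f x + g x) * h x)"
    using assms by (intro lin_ext_superset) auto
  also have "\<dots> = (\<Sum>x\<in>?B. f x * h x) + (\<Sum>x\<in>?B. g x * h x)"
    by (simp add: sum.distrib algebra_simps)
  also have "\<dots> = lin_ext f h + lin_ext g h"
    using assms by (intro arg_cong2[of _ _ _ _ "(+)"] lin_ext_superset[symmetric]) auto
  finally show ?thesis .
qed

lemma lin_ext_scale: "lin_ext (\<lambda>x. c * f x) h = c * lin_ext f h"
  by (cases "c = 0") (simp_all add: lin_ext_def sum_distrib_left mult.assoc)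

lemma lin_ext_scale_right: "lin_ext f (\<lambda>x. c * h x) = c * lin_ext f h"
  by (simp add: lin_ext_def sum_distrib_left mult.left_commute)

lemma lin_ext_scale_right': "lin_ext f (\<lambda>x. h x * c) = lin_ext f h * c"
  by (simp add: lin_ext_def sum_distrib_right mult.assoc)

lemma lin_ext_add_right: "lin_ext f (\<lambda>x. h x + k x) = lin_ext f h + lin_ext f k"
  by (simp add: lin_ext_def sum.distrib algebra_simps)

lemma lin_ext_eval:
  assumes "finite {x. f x \<noteq> 0}"
  shows "lin_ext f (single z) = f z"
proof -
  have "lin_ext f (single z) = (\<Sum>x\<in>insert z {x. f x \<noteq> 0}. f x * single z x)"
    using assms by (intro lin_ext_superset) auto
  also have "\<dots> = (\<Sum>x\<in>insert z {x. f x \<noteq> 0}. if z = x then f x else 0)"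
    by (intro sum.cong) (auto simp: single_def)
  also have "\<dots> = f z" using assms by (simp add: sum.delta)
  finally show ?thesis .
qed

text \<open>Testing against \<open>single z\<close> reads off the coefficient at \<open>z\<close>.
  The ring axioms for convolution thereby reduce to the monoid laws under nested pairings.\<close>

lemma eq_by_lin_ext:
  assumes "finite {x. f x \<noteq> 0}" "finite {x. g x \<noteq> 0}" "\<And>h. lin_ext f h = lin_ext g h"
  shows "f = g"
  using assms by (metis ext lin_ext_eval)

lemma monoid_algebra_simps:
  "carrier (monoid_algebra M) = {f. finite {x. f x \<noteq> 0} \<and> {x. f x \<noteq> 0} \<subseteq> carrier M}"
  "\<zero>\<^bsub>monoid_algebra M\<^esub> = (\<lambda>x. 0)"
  "f \<oplus>\<^bsub>monoid_algebra M\<^esub> g = (\<lambda>x. f x + g x)"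
  "c \<odot>\<^bsub>monoid_algebra M\<^esub> f = (\<lambda>x. c * f x)"
  by (simp_all add: monoid_algebra_def)

lemma one_monoid_algebra: "\<one>\<^bsub>monoid_algebra M\<^esub> = single \<one>\<^bsub>M\<^esub>"
  by (simp add: monoid_algebra_def single_def)

lemma monoid_algebra_finite: "f \<in> carrier (monoid_algebra M) \<Longrightarrow> finite {x. f x \<noteq> 0}"
  by (simp add: monoid_algebra_simps)

lemma monoid_algebra_supp: "f \<in> carrier (monoid_algebra M) \<Longrightarrow> f x \<noteq> 0 \<Longrightarrow> x \<in> carrier M"
  by (auto simp: monoid_algebra_simps)

lemma single_closed: "x \<in> carrier M \<Longrightarrow> single x \<in> carrier (monoid_algebra M)"
  by (auto simp: monoid_algebra_simps single_def)

lemma lin_ext_linear: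
  "f \<in> carrier (monoid_algebra M) \<Longrightarrow> g \<in> carrier (monoid_algebra M) \<Longrightarrow>
    lin_ext (f \<oplus>\<^bsub>monoid_algebra M\<^esub> g) h = lin_ext f h + lin_ext g h"
  "lin_ext (c \<odot>\<^bsub>monoid_algebra M\<^esub> f) h = c * lin_ext f h"
  by (simp_all add: monoid_algebra_simps lin_ext_add lin_ext_scale)

context monoid
begin

text \<open>Both claims come from one regrouping: a value of the convolution is a sum over a fibre
  of the product map \<open>m\<close> on pairs of support points, and summing over the finite image
  of \<open>m\<close> restores the sum over all pairs.\<close>

lemma
  assumes f: "f \<in> carrier (monoid_algebra G)" and g: "g \<in> carrier (monoid_algebra G)"
  shows monoid_algebra_mult_closed: "f \<otimes>\<^bsub>monoid_algebra G\<^esub> g \<in> carrier (monoid_algebra G)"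
    and lin_ext_mult: "lin_ext (f \<otimes>\<^bsub>monoid_algebra G\<^esub> g) h
      = lin_ext f (\<lambda>x. lin_ext g (\<lambda>y. h (x \<otimes> y)))"
proof -
  define A B where "A = {x. f x \<noteq> 0}" and "B = {x. g x \<noteq> 0}"
  define m where "m = (\<lambda>(x, y). x \<otimes> y)"
  have fin: "finite A" "finite B" and sub: "A \<subseteq> carrier G" "B \<subseteq> carrier G"
    using f g by (auto simp: A_def B_def monoid_algebra_simps)
  have val: "(f \<otimes>\<^bsub>monoid_algebra G\<^esub> g) z = (\<Sum>p | p \<in> A \<times> B \<and> m p = z. f (fst p) * g (snd p))" for z
    unfolding monoid_algebra_def A_def B_def m_def
    by (simp, intro sum.cong) auto
  have supp: "{z. (f \<otimes>\<^bsub>monoid_algebra G\<^esub> g) z \<noteq> 0} \<subseteq> m ` (A \<times> B)"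
  proof
    fix z assume "z \<in> {z. (f \<otimes>\<^bsub>monoid_algebra G\<^esub> g) z \<noteq> 0}"
    then have "{p. p \<in> A \<times> B \<and> m p = z} \<noteq> {}"
      unfolding val by (metis (mono_tags, lifting) mem_Collect_eq sum.empty)
    then show "z \<in> m ` (A \<times> B)" by blast
  qed
  have "m ` (A \<times> B) \<subseteq> carrier G" using sub by (auto simp: m_def)
  with supp fin show "f \<otimes>\<^bsub>monoid_algebra G\<^esub> g \<in> carrier (monoid_algebra G)"
    unfolding monoid_algebra_simps by (auto intro: finite_subset)
  have "lin_ext (f \<otimes>\<^bsub>monoid_algebra G\<^esub> g) h
      = (\<Sum>z\<in>m ` (A \<times> B). (f \<otimes>\<^bsub>monoid_algebra G\<^esub> g) z * h z)"
    using supp fin by (intro lin_ext_superset) auto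
  also have "\<dots> = (\<Sum>z\<in>m ` (A \<times> B). \<Sum>p | p \<in> A \<times> B \<and> m p = z. f (fst p) * g (snd p) * h (m p))"
    unfolding val sum_distrib_right by (intro sum.cong) auto
  also have "\<dots> = (\<Sum>p\<in>A \<times> B. f (fst p) * g (snd p) * h (m p))"
    using fin by (intro sum.image_gen[symmetric]) auto
  also have "\<dots> = (\<Sum>x\<in>A. \<Sum>y\<in>B. f x * g y * h (x \<otimes> y))"
    by (simp add: sum.cartesian_product m_def case_prod_beta)
  also have "\<dots> = lin_ext f (\<lambda>x. lin_ext g (\<lambda>y. h (x \<otimes> y)))"
    by (simp add: lin_ext_def A_def B_def sum_distrib_left mult.assoc)
  finally show "lin_ext (f \<otimes>\<^bsub>monoid_algebra G\<^esub> g) h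
      = lin_ext f (\<lambda>x. lin_ext g (\<lambda>y. h (x \<otimes> y)))" .
qed

lemma single_mult:
  assumes "x \<in> carrier G" "y \<in> carrier G"
  shows "single x \<otimes>\<^bsub>monoid_algebra G\<^esub> single y = single (x \<otimes> y)"
  using assms
  by (intro eq_by_lin_ext monoid_algebra_finite[of _ G])
    (auto simp: lin_ext_mult monoid_algebra_mult_closed single_closed)

end

lemma complex_field_cring: "cring complex_field"
  unfolding complex_field_def
  by unfold_locales
    (auto simp: algebra_simps Units_def intro: exI[of _ "- x" for x] add.left_inverse add.right_inverse)

lemma (in monoid) monoid_algebra_complex_algebra: "complex_algebra (monoid_algebra G)"
proof -
  let ?F = "monoid_algebra G"
  have add_closed: "f \<oplus>\<^bsub>?F\<^esub> g \<in> carrier ?F" if "f \<in> carrier ?F" "g \<in> carrier ?F" for f g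
  proof -
    have "{x. f x + g x \<noteq> 0} \<subseteq> {x. f x \<noteq> 0} \<union> {x. g x \<noteq> 0}" by auto
    moreover have "finite ({x. f x \<noteq> 0} \<union> {x. g x \<noteq> 0})" using that by (simp add: monoid_algebra_simps)
    ultimately show ?thesis using that finite_subset unfolding monoid_algebra_simps by blast
  qed
  have smult_closed: "c \<odot>\<^bsub>?F\<^esub> f \<in> carrier ?F" if "f \<in> carrier ?F" for c f
    using that by (auto simp: monoid_algebra_simps elim: rev_finite_subset)
  note closed = add_closed smult_closed monoid_algebra_mult_closed
  note fin = monoid_algebra_finite[of _ G]
  have ag: "abelian_group ?F"
  proof (rule abelian_groupI)
    show "\<exists>y\<in>carrier ?F. y \<oplus>\<^bsub>?F\<^esub> x = \<zero>\<^bsub>?F\<^esub>" if "x \<in> carrier ?F" for x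
      using smult_closed[OF that, of "-1"] by (intro bexI[of _ "(-1) \<odot>\<^bsub>?F\<^esub> x"]) (auto simp: monoid_algebra_simps)
  qed (auto simp: add_closed, auto simp: monoid_algebra_simps algebra_simps)
  have mon: "Group.monoid ?F"
  proof (rule monoidI)
    show "\<one>\<^bsub>?F\<^esub> \<in> carrier ?F" by (simp add: one_monoid_algebra single_closed)
  next
    fix x y z assume xyz: "x \<in> carrier ?F" "y \<in> carrier ?F" "z \<in> carrier ?F"
    show "x \<otimes>\<^bsub>?F\<^esub> y \<otimes>\<^bsub>?F\<^esub> z = x \<otimes>\<^bsub>?F\<^esub> (y \<otimes>\<^bsub>?F\<^esub> z)"
      using xyz by (intro eq_by_lin_ext fin)
        (auto simp: lin_ext_mult monoid_algebra_mult_closed m_assoc monoid_algebra_supp intro!: lin_ext_cong)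
  next
    fix x assume x: "x \<in> carrier ?F"
    show "\<one>\<^bsub>?F\<^esub> \<otimes>\<^bsub>?F\<^esub> x = x" "x \<otimes>\<^bsub>?F\<^esub> \<one>\<^bsub>?F\<^esub> = x"
      using x unfolding one_monoid_algebra
      by (intro eq_by_lin_ext fin;
          auto simp: lin_ext_mult monoid_algebra_mult_closed monoid_algebra_supp single_closed intro!: lin_ext_cong)+
  qed (auto simp: monoid_algebra_mult_closed)
  have ring: "ring ?F"
  proof (rule ringI[OF ag mon])
    fix x y z assume xyz: "x \<in> carrier ?F" "y \<in> carrier ?F" "z \<in> carrier ?F"
    show "(x \<oplus>\<^bsub>?F\<^esub> y) \<otimes>\<^bsub>?F\<^esub> z = x \<otimes>\<^bsub>?F\<^esub> z \<oplus>\<^bsub>?F\<^esub> y \<otimes>\<^bsub>?F\<^esub> z"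
      "z \<otimes>\<^bsub>?F\<^esub> (x \<oplus>\<^bsub>?F\<^esub> y) = z \<otimes>\<^bsub>?F\<^esub> x \<oplus>\<^bsub>?F\<^esub> z \<otimes>\<^bsub>?F\<^esub> y"
      using xyz by (intro eq_by_lin_ext fin; simp add: lin_ext_mult lin_ext_linear closed lin_ext_add_right)+
  qed
  have module: "module complex_field ?F"
    by (rule moduleI[OF complex_field_cring ag])
      (auto simp: smult_closed, auto simp: monoid_algebra_simps complex_field_def algebra_simps)
  show ?thesis
  proof (intro complex_algebra.intro ring module complex_algebra_axioms.intro)
    fix x y c assume xy: "x \<in> carrier ?F" "y \<in> carrier ?F"
    show "(c \<odot>\<^bsub>?F\<^esub> x) \<otimes>\<^bsub>?F\<^esub> y = c \<odot>\<^bsub>?F\<^esub> (x \<otimes>\<^bsub>?F\<^esub> y)" 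
      "x \<otimes>\<^bsub>?F\<^esub> (c \<odot>\<^bsub>?F\<^esub> y) = c \<odot>\<^bsub>?F\<^esub> (x \<otimes>\<^bsub>?F\<^esub> y)"
      using xy by (intro eq_by_lin_ext fin; simp add: lin_ext_mult lin_ext_linear closed lin_ext_scale_right)+
  qed
qed

section \<open>Presented algebras and their linear functionals\<close>

locale presentation = monoid G for G (structure) +
  fixes R :: "('a \<Rightarrow> complex) set"
  assumes relations: "R \<subseteq> carrier (monoid_algebra G)"
begin

abbreviation "F \<equiv> monoid_algebra G"
abbreviation "J \<equiv> Idl\<^bsub>F\<^esub> R"
abbreviation "Q \<equiv> presented_algebra G R"
abbreviation "cls f \<equiv> J +>\<^bsub>F\<^esub> f"
abbreviation "gen \<equiv> presented_gen G R"

sublocale F: ring F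
  using monoid_algebra_complex_algebra by (rule complex_algebra.axioms)

sublocale FA: complex_algebra F
  by (rule monoid_algebra_complex_algebra)

sublocale J: ideal J F
  by (rule F.genideal_ideal[OF relations])

section \<open>The quotient as a complex algebra\<close>

lemma cls_eq_iff:
  "f \<in> carrier F \<Longrightarrow> g \<in> carrier F \<Longrightarrow> cls f = cls g \<longleftrightarrow> f \<ominus>\<^bsub>F\<^esub> g \<in> J"
  using F.quotient_eq_iff_same_a_r_cos[OF J.ideal_axioms] by blast

lemma carrier_Q: "carrier Q = cls ` carrier F"
  by (auto simp: presented_algebra_def quotient_algebra_def FactRing_def A_RCOSETS_def' image_def)

lemma cls_closed [simp]: "f \<in> carrier F \<Longrightarrow> cls f \<in> carrier Q"
  by (simp add: carrier_Q)

lemma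
  assumes "f \<in> carrier F" "g \<in> carrier F"
  shows cls_add: "cls f \<oplus>\<^bsub>Q\<^esub> cls g = cls (f \<oplus>\<^bsub>F\<^esub> g)"
    and cls_mult: "cls f \<otimes>\<^bsub>Q\<^esub> cls g = cls (f \<otimes>\<^bsub>F\<^esub> g)"
  using assms
  by (simp_all add: presented_algebra_def quotient_algebra_def FactRing_def J.a_rcos_sum J.rcoset_mult_add)

lemma one_Q: "\<one>\<^bsub>Q\<^esub> = cls \<one>\<^bsub>F\<^esub>"
  by (simp add: presented_algebra_def quotient_algebra_def FactRing_def)

lemma zero_Q: "\<zero>\<^bsub>Q\<^esub> = cls \<zero>\<^bsub>F\<^esub>"
  by (simp add: presented_algebra_def quotient_algebra_def FactRing_def J.a_subset)

text \<open>Turns a scalar into a ring element, so that closure of \<open>J\<close> under scalars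
  follows from its closure under multiplication.\<close>

lemma smult_one_mult:
  "f \<in> carrier F \<Longrightarrow> c \<odot>\<^bsub>F\<^esub> f = (c \<odot>\<^bsub>F\<^esub> \<one>\<^bsub>F\<^esub>) \<otimes>\<^bsub>F\<^esub> f"
  by (simp add: FA.smult_mult_left)

lemma smult_closed [simp]: "f \<in> carrier F \<Longrightarrow> c \<odot>\<^bsub>F\<^esub> f \<in> carrier F"
  by (rule FA.smult_closed) (simp add: complex_field_def)

lemma smult_in_J: "f \<in> J \<Longrightarrow> c \<odot>\<^bsub>F\<^esub> f \<in> J"
  by (subst smult_one_mult) (auto intro!: J.I_l_closed intro: J.Icarr)

lemma smult_diff:
  assumes "f \<in> carrier F" "g \<in> carrier F"
  shows "c \<odot>\<^bsub>F\<^esub> f \<ominus>\<^bsub>F\<^esub> c \<odot>\<^bsub>F\<^esub> g = c \<odot>\<^bsub>F\<^esub> (f \<ominus>\<^bsub>F\<^esub> g)"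
proof -
  have "(c \<odot>\<^bsub>F\<^esub> \<one>\<^bsub>F\<^esub>) \<otimes>\<^bsub>F\<^esub> f \<ominus>\<^bsub>F\<^esub> (c \<odot>\<^bsub>F\<^esub> \<one>\<^bsub>F\<^esub>) \<otimes>\<^bsub>F\<^esub> g = (c \<odot>\<^bsub>F\<^esub> \<one>\<^bsub>F\<^esub>) \<otimes>\<^bsub>F\<^esub> (f \<ominus>\<^bsub>F\<^esub> g)"
    using assms by (simp add: F.r_distr F.minus_eq F.r_minus)
  then show ?thesis using assms by (simp add: smult_one_mult[symmetric])
qed

lemma cls_smult:
  assumes f: "f \<in> carrier F"
  shows "c \<odot>\<^bsub>Q\<^esub> cls f = cls (c \<odot>\<^bsub>F\<^esub> f)"
proof -
  \<comment> \<open>The scalar action is a union over all representatives; each contributes the same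
    coset, so the union collapses to it.\<close>
  have "cls (c \<odot>\<^bsub>F\<^esub> x) = cls (c \<odot>\<^bsub>F\<^esub> f)" if "x \<in> cls f" for x
  proof -
    have x: "x \<in> carrier F" using that f J.a_elemrcos_carrier by blast
    have "cls x = cls f" using that f J.a_repr_independence' by metis
    then have "x \<ominus>\<^bsub>F\<^esub> f \<in> J" using x f cls_eq_iff by blast
    then show ?thesis using x f by (subst cls_eq_iff) (auto simp: smult_diff smult_in_J)
  qed
  moreover have "f \<in> cls f" using f by (rule J.a_rcos_self)
  ultimately have "(\<Union>x\<in>cls f. cls (c \<odot>\<^bsub>F\<^esub> x)) = cls (c \<odot>\<^bsub>F\<^esub> f)"
    by blast
  then show ?thesis
    by (simp add: presented_algebra_def quotient_algebra_def)
qed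

lemmas cls_simps = cls_add cls_mult cls_smult one_Q zero_Q

lemma complex_algebra_Q: "complex_algebra Q"
proof -
  have ag: "abelian_group Q"
  proof (rule abelian_groupI)
    fix x assume "x \<in> carrier Q"
    then obtain f where f: "f \<in> carrier F" "x = cls f" by (auto simp: carrier_Q)
    then have "cls (\<ominus>\<^bsub>F\<^esub> f) \<oplus>\<^bsub>Q\<^esub> x = \<zero>\<^bsub>Q\<^esub>" by (simp add: cls_simps F.l_neg)
    with f show "\<exists>y\<in>carrier Q. y \<oplus>\<^bsub>Q\<^esub> x = \<zero>\<^bsub>Q\<^esub>" by (intro bexI[of _ "cls (\<ominus>\<^bsub>F\<^esub> f)"]) simp_all
  qed (auto simp: carrier_Q cls_simps F.a_ac)
  have ring: "ring Q"
    by (rule ringI[OF ag monoidI]) (auto simp: carrier_Q cls_simps F.m_assoc F.l_distr F.r_distr)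
  have module: "module complex_field Q"
    by (rule moduleI[OF complex_field_cring ag])
      (auto simp: carrier_Q cls_simps FA.smult_l_distr FA.smult_r_distr FA.smult_assoc1 FA.smult_one)
  show ?thesis
    by (intro complex_algebra.intro ring module complex_algebra_axioms.intro)
      (auto simp: carrier_Q cls_simps FA.smult_mult_left FA.smult_mult_right)
qed

lemma gen_eq: "gen x = cls (single x)"
  by (simp add: presented_gen_def)

lemma gen_closed [simp]: "x \<in> carrier G \<Longrightarrow> gen x \<in> carrier Q"
  by (simp add: gen_eq single_closed)

lemma gen_mult: "x \<in> carrier G \<Longrightarrow> y \<in> carrier G \<Longrightarrow> gen x \<otimes>\<^bsub>Q\<^esub> gen y = gen (x \<otimes> y)"
  by (simp add: gen_eq cls_simps single_closed single_mult)

lemma gen_one: "gen \<one> = \<one>\<^bsub>Q\<^esub>"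
  by (simp add: gen_eq one_Q one_monoid_algebra)

lemma minus_eval: "f \<in> carrier F \<Longrightarrow> g \<in> carrier F \<Longrightarrow> f \<ominus>\<^bsub>F\<^esub> g = (\<lambda>x. f x - g x)"
proof -
  assume fg: "f \<in> carrier F" "g \<in> carrier F"
  have "(-1) \<odot>\<^bsub>F\<^esub> g \<oplus>\<^bsub>F\<^esub> g = \<zero>\<^bsub>F\<^esub>" by (simp add: monoid_algebra_simps)
  then have "\<ominus>\<^bsub>F\<^esub> g = (-1) \<odot>\<^bsub>F\<^esub> g" using fg by (intro F.minus_equality) auto
  then show ?thesis by (simp add: F.minus_eq monoid_algebra_simps)
qed

lemma lin_ext_minus: 
  assumes "f \<in> carrier F" "g \<in> carrier F"
  shows "lin_ext (f \<ominus>\<^bsub>F\<^esub> g) h = lin_ext f h - lin_ext g h"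
proof -
  have "f \<ominus>\<^bsub>F\<^esub> g = f \<oplus>\<^bsub>F\<^esub> (-1) \<odot>\<^bsub>F\<^esub> g" using assms by (simp add: minus_eval) (simp add: monoid_algebra_simps)
  then show ?thesis using assms by (simp add: lin_ext_linear)
qed

text \<open>The generators span the quotient: the induction runs over a finite superset of the
  support of a representative and splits off one point at a time. The zero element arises as
  \<open>0\<close> times a generator, so no zero case is asked for.\<close>

lemma gen_induct [consumes 1, case_names gen add smult]:
  assumes X: "X \<in> carrier Q"
    and gen: "\<And>x. x \<in> carrier G \<Longrightarrow> P (gen x)"
    and add: "\<And>Y Z. Y \<in> carrier Q \<Longrightarrow> Z \<in> carrier Q \<Longrightarrow> P Y \<Longrightarrow> P Z \<Longrightarrow> P (Y \<oplus>\<^bsub>Q\<^esub> Z)"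
    and smult: "\<And>c Y. Y \<in> carrier Q \<Longrightarrow> P Y \<Longrightarrow> P (c \<odot>\<^bsub>Q\<^esub> Y)"
  shows "P X"
proof -
  have *: "P (cls f)" if "finite S" "{x. f x \<noteq> 0} \<subseteq> S" "S \<subseteq> carrier G" for S and f
    using that
  proof (induction S arbitrary: f rule: finite_induct)
    case empty
    then have "f = 0 \<odot>\<^bsub>F\<^esub> single \<one>" by (auto simp: monoid_algebra_simps)
    then have "cls f = 0 \<odot>\<^bsub>Q\<^esub> gen \<one>" by (simp add: gen_eq cls_smult single_closed)
    then show ?case by (simp add: smult gen)
  next
    case (insert y S)
    define g where "g = f(y := 0)"
    have g: "P (cls g)" by (rule insert.IH) (use insert.prems in \<open>auto simp: g_def\<close>)
    have gF: "g \<in> carrier F" unfolding monoid_algebra_simps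
      using insert.prems insert.hyps by (auto simp: g_def intro: finite_subset[of _ S])
    have y: "y \<in> carrier G" using insert by auto
    have "f = g \<oplus>\<^bsub>F\<^esub> f y \<odot>\<^bsub>F\<^esub> single y" by (auto simp: monoid_algebra_simps g_def single_def)
    then have "cls f = cls g \<oplus>\<^bsub>Q\<^esub> f y \<odot>\<^bsub>Q\<^esub> gen y"
      using gF y by (simp add: cls_simps gen_eq single_closed)
    also have "P \<dots>"
      using g gF y complex_algebra_Q
      by (intro add smult gen) (auto simp: gen_eq cls_smult single_closed)
    finally show ?case .
  qed
  obtain f where "f \<in> carrier F" "X = cls f" using X by (auto simp: carrier_Q)
  then show ?thesis by (auto simp: monoid_algebra_simps intro!: *[of "{x. f x \<noteq> 0}"])
qed

section \<open>Linear functionals on the quotient\<close>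

lemma linear_functional_eqI:
  assumes "linear_functional Q \<psi>" "linear_functional Q \<chi>"
    and "\<And>x. x \<in> carrier G \<Longrightarrow> \<psi> (gen x) = \<chi> (gen x)" and "X \<in> carrier Q"
  shows "\<psi> X = \<chi> X"
  using \<open>X \<in> carrier Q\<close>
  by (induction rule: gen_induct) (use assms(1-3) in \<open>simp_all add: linear_functional_def\<close>)

text \<open>The choice of representative is immaterial once \<open>h\<close> satisfies
  \<open>kills\<close> below. The restriction to the carrier produces the extensional functions
  demanded by the definite descriptions.\<close>

definition lift :: "('a \<Rightarrow> complex) \<Rightarrow> ('a \<Rightarrow> complex) set \<Rightarrow> complex" where
  "lift h = (\<lambda>X\<in>carrier Q. lin_ext (SOME f. f \<in> carrier F \<and> X = cls f) h)"

context
  fixes h :: "'a \<Rightarrow> complex"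
  assumes kills: "\<And>r u v. r \<in> R \<Longrightarrow> u \<in> carrier G \<Longrightarrow> v \<in> carrier G \<Longrightarrow> lin_ext r (\<lambda>x. h (u \<otimes> x \<otimes> v)) = 0"
begin

text \<open>The kernel of \<open>h\<close> need not be an ideal, but the elements killed by every
  two-sided translate of \<open>h\<close> form one, called \<open>K\<close>. It contains
  \<open>R\<close>, hence \<open>J\<close>, and the translate by units is \<open>h\<close>
  itself.\<close>

lemma lin_ext_ideal:
  assumes "f \<in> J"
  shows "lin_ext f h = 0"
proof -
  define K where "K = {f \<in> carrier F. \<forall>u\<in>carrier G. \<forall>v\<in>carrier G. lin_ext f (\<lambda>x. h (u \<otimes> x \<otimes> v)) = 0}"
  have "ideal K F"
  proof (rule idealI[OF F.ring_axioms])
    show "subgroup K (add_monoid F)"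
    proof (rule F.add.subgroupI)
      show "K \<subseteq> carrier F" by (auto simp: K_def)
      have "\<zero>\<^bsub>F\<^esub> \<in> K" by (simp add: K_def monoid_algebra_simps(2) flip: monoid_algebra_simps(2)) (simp add: monoid_algebra_simps)
      then show "K \<noteq> {}" by auto
    next
      fix a assume a: "a \<in> K"
      have eq: "\<ominus>\<^bsub>F\<^esub> a = \<zero>\<^bsub>F\<^esub> \<ominus>\<^bsub>F\<^esub> a" using a by (simp add: K_def F.minus_eq)
      show "\<ominus>\<^bsub>F\<^esub> a \<in> K" unfolding eq
        using a by (simp add: K_def lin_ext_minus) (simp add: monoid_algebra_simps)
    next
      fix a b assume "a \<in> K" "b \<in> K"
      then show "a \<oplus>\<^bsub>F\<^esub> b \<in> K" by (auto simp: K_def lin_ext_linear)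
    qed
  next
    fix a x assume ax: "a \<in> K" "x \<in> carrier F"
    show "x \<otimes>\<^bsub>F\<^esub> a \<in> K"
    proof -
      have "lin_ext (x \<otimes>\<^bsub>F\<^esub> a) (\<lambda>z. h (u \<otimes> z \<otimes> v)) = 0"
        if "u \<in> carrier G" "v \<in> carrier G" for u v
      proof -
        have "lin_ext (x \<otimes>\<^bsub>F\<^esub> a) (\<lambda>z. h (u \<otimes> z \<otimes> v))
          = lin_ext x (\<lambda>y. lin_ext a (\<lambda>z. h (u \<otimes> (y \<otimes> z) \<otimes> v)))"
          using ax by (simp add: lin_ext_mult K_def)
        also have "\<dots> = lin_ext x (\<lambda>y. lin_ext a (\<lambda>z. h ((u \<otimes> y) \<otimes> z \<otimes> v)))"
          using ax that
          by (intro lin_ext_cong) (simp add: m_assoc monoid_algebra_supp[of x] monoid_algebra_supp[of a] K_def)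
        also have "\<dots> = lin_ext x (\<lambda>y. 0)"
          using ax that by (intro lin_ext_cong) (simp add: monoid_algebra_supp K_def)
        finally show ?thesis by (simp add: lin_ext_def)
      qed
      then show ?thesis using ax by (auto simp: K_def)
    qed
    show "a \<otimes>\<^bsub>F\<^esub> x \<in> K"
    proof -
      have "lin_ext (a \<otimes>\<^bsub>F\<^esub> x) (\<lambda>z. h (u \<otimes> z \<otimes> v)) = 0"
        if uv: "u \<in> carrier G" "v \<in> carrier G" for u v
      proof -
        have a: "a \<in> carrier F" using ax by (simp add: K_def)
        let ?S = "{y. x y \<noteq> 0}"
        have "lin_ext (a \<otimes>\<^bsub>F\<^esub> x) (\<lambda>z. h (u \<otimes> z \<otimes> v))
          = lin_ext a (\<lambda>y. lin_ext x (\<lambda>z. h (u \<otimes> (y \<otimes> z) \<otimes> v)))"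
          using ax a by (simp add: lin_ext_mult)
        \<comment> \<open>A right factor ends up in the inner pairing; the finite sums are exchanged
          so that the hypothesis on \<open>a\<close> applies.\<close>
        also have "\<dots> = (\<Sum>z | x z \<noteq> 0. x z * lin_ext a (\<lambda>y. h (u \<otimes> (y \<otimes> z) \<otimes> v)))"
          unfolding lin_ext_def sum_distrib_left
          by (subst sum.swap) (simp add: algebra_simps)
        also have "\<dots> = (\<Sum>z | x z \<noteq> 0. x z * 0)"
        proof (intro sum.cong refl arg_cong2[of _ _ _ _ "(*)"])
          fix z assume "z \<in> {z. x z \<noteq> 0}"
          then have z: "z \<in> carrier G" using ax monoid_algebra_supp by fastforce
          have "lin_ext a (\<lambda>y. h (u \<otimes> (y \<otimes> z) \<otimes> v)) = lin_ext a (\<lambda>y. h (u \<otimes> y \<otimes> (z \<otimes> v)))"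
            using a uv z by (intro lin_ext_cong) (simp add: m_assoc monoid_algebra_supp)
          then show "lin_ext a (\<lambda>y. h (u \<otimes> (y \<otimes> z) \<otimes> v)) = 0"
            using ax uv z by (simp add: K_def)
        qed
        finally show ?thesis by simp
      qed
      then show ?thesis using ax by (auto simp: K_def)
    qed
  qed
  moreover have "R \<subseteq> K" using kills relations by (auto simp: K_def)
  ultimately have "f \<in> K" using F.genideal_minimal assms by blast
  then have "lin_ext f (\<lambda>x. h (\<one> \<otimes> x \<otimes> \<one>)) = 0" by (simp add: K_def)
  moreover have "lin_ext f (\<lambda>x. h (\<one> \<otimes> x \<otimes> \<one>)) = lin_ext f h"
    using \<open>f \<in> K\<close> by (intro lin_ext_cong) (simp add: K_def monoid_algebra_supp[of f])
  ultimately show ?thesis by simp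
qed

lemma lift_cls:
  assumes f: "f \<in> carrier F"
  shows "lift h (cls f) = lin_ext f h"
proof -
  define g where "g = (SOME g. g \<in> carrier F \<and> cls f = cls g)"
  have g: "g \<in> carrier F \<and> cls f = cls g"
    unfolding g_def by (rule someI[of _ f]) (use f in simp)
  then have "f \<ominus>\<^bsub>F\<^esub> g \<in> J" using f cls_eq_iff by blast
  then have "lin_ext f h - lin_ext g h = 0" using f g lin_ext_ideal lin_ext_minus by metis
  then show ?thesis using f by (simp add: lift_def g_def)
qed

lemma lift_gen: "x \<in> carrier G \<Longrightarrow> lift h (gen x) = h x"
  by (simp add: gen_eq lift_cls single_closed)

lemma lift_linear: "linear_functional Q (lift h)"
  unfolding linear_functional_def
proof (intro conjI ballI allI)
  fix X Y assume "X \<in> carrier Q" "Y \<in> carrier Q"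
  then obtain f g where "f \<in> carrier F" "g \<in> carrier F" "X = cls f" "Y = cls g"
    unfolding carrier_Q by blast
  then show "lift h (X \<oplus>\<^bsub>Q\<^esub> Y) = lift h X + lift h Y"
    by (simp add: cls_add lift_cls lin_ext_linear)
next
  fix c X assume "X \<in> carrier Q"
  then obtain f where "f \<in> carrier F" "X = cls f"
    unfolding carrier_Q by blast
  then show "lift h (c \<odot>\<^bsub>Q\<^esub> X) = c * lift h X"
    by (simp add: cls_smult lift_cls lin_ext_linear(2))
qed

lemma lift_unique:
  assumes "\<psi> \<in> extensional (carrier Q)" "linear_functional Q \<psi>"
    "\<And>x. x \<in> carrier G \<Longrightarrow> \<psi> (gen x) = h x"
  shows "\<psi> = lift h"
proof
  fix X show "\<psi> X = lift h X"
  proof (cases "X \<in> carrier Q")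
    case True
    then show ?thesis
      by (rule linear_functional_eqI[OF assms(2) lift_linear, rotated]) (auto simp: assms(3) lift_gen)
  next
    case False
    then show ?thesis using assms(1) by (auto simp: extensional_def lift_def)
  qed
qed

end

lemma lift_extensional: "lift h \<in> extensional (carrier Q)"
  by (simp add: lift_def)

end

section \<open>The lifted functional on the free product\<close>

text \<open>The argument \<open>c\<close> accumulates the product of the letters read since the last
  \<open>Proj\<close>; a \<open>Proj\<close> cashes it in through \<phi> and resets it to the unit.
  Started at the unit, this gives the lifted functional on words, and \<phi>(1) = 1 makes a repeated
  \<open>Proj\<close> harmless.\<close>

fun word_val :: "(complex, 'a) module \<Rightarrow> ('a \<Rightarrow> complex) \<Rightarrow> 'a \<Rightarrow> 'a letter list \<Rightarrow> complex" where
  "word_val A \<phi> c [] = \<phi> c"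
| "word_val A \<phi> c (Elt a # u) = word_val A \<phi> (c \<otimes>\<^bsub>A\<^esub> a) u"
| "word_val A \<phi> c (Proj # u) = \<phi> c * word_val A \<phi> \<one>\<^bsub>A\<^esub> u"

lemma letter_words_simps [simp]:
  "carrier (letter_words A) = lists (insert Proj (Elt ` carrier A))"
  "u \<otimes>\<^bsub>letter_words A\<^esub> v = u @ v"
  "\<one>\<^bsub>letter_words A\<^esub> = []"
  by (simp_all add: letter_words_def)

lemma letter_words_monoid: "Group.monoid (letter_words A)"
  by unfold_locales auto

locale ncps =
  fixes A :: "(complex, 'a) module" and \<phi> :: "'a \<Rightarrow> complex"
  assumes nc_prob_space: "nc_prob_space A \<phi>"
begin

sublocale A: ring A
  using nc_prob_space by (simp add: nc_prob_space_def complex_algebra_def)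

sublocale AA: complex_algebra A
  using nc_prob_space by (simp add: nc_prob_space_def)

lemma A_smult_closed [simp]: "a \<in> carrier A \<Longrightarrow> c \<odot>\<^bsub>A\<^esub> a \<in> carrier A"
  by (rule AA.smult_closed) (simp add: complex_field_def)

lemma phi_one [simp]: "\<phi> \<one>\<^bsub>A\<^esub> = 1"
  using nc_prob_space by (simp add: nc_prob_space_def)

lemma phi_lin [simp]:
  "a \<in> carrier A \<Longrightarrow> b \<in> carrier A \<Longrightarrow> \<phi> (a \<oplus>\<^bsub>A\<^esub> b) = \<phi> a + \<phi> b"
  "a \<in> carrier A \<Longrightarrow> \<phi> (c \<odot>\<^bsub>A\<^esub> a) = c * \<phi> a"
  using nc_prob_space by (simp_all add: nc_prob_space_def linear_functional_def)

abbreviation "W \<equiv> letter_words A"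

lemma tilde_relations_closed: "tilde_relations A \<subseteq> carrier (monoid_algebra W)"
proof -
  interpret M: Group.monoid W by (rule letter_words_monoid)
  interpret F: ring "monoid_algebra W"
    using M.monoid_algebra_complex_algebra by (rule complex_algebra.axioms)
  interpret FA: complex_algebra "monoid_algebra W"
    by (rule M.monoid_algebra_complex_algebra)
  have smult: "c \<odot>\<^bsub>monoid_algebra W\<^esub> f \<in> carrier (monoid_algebra W)" if "f \<in> carrier (monoid_algebra W)" for c f
    using that by (intro FA.smult_closed) (simp add: complex_field_def)
  then show ?thesis
    by (auto simp: tilde_relations_def Let_def intro!: F.minus_closed single_closed F.add.m_closed smult)
qed

sublocale T: presentation W "tilde_relations A"
  by (intro presentation.intro letter_words_monoid presentation_axioms.intro tilde_relations_closed)

abbreviation "T \<equiv> tilde A"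
abbreviation "emb \<equiv> tilde_emb A"
abbreviation "p \<equiv> tilde_proj A"

lemma T_eq: "T = T.Q"
  by (simp add: tilde_def)

sublocale TR: ring T
  using T.complex_algebra_Q by (simp add: T_eq complex_algebra_def)

sublocale TA: complex_algebra T
  using T.complex_algebra_Q by (simp add: T_eq)

lemma T_smult_closed [simp]: "a \<in> carrier T \<Longrightarrow> c \<odot>\<^bsub>T\<^esub> a \<in> carrier T"
  by (rule TA.smult_closed) (simp add: complex_field_def)

lemma emb_closed [simp]: "a \<in> carrier A \<Longrightarrow> emb a \<in> carrier T"
  by (simp add: tilde_emb_def T_eq flip: presented_gen_def)

lemma p_closed [simp]: "p \<in> carrier T"
  by (simp add: tilde_proj_def T_eq)

lemma relation_cls_eq:
  assumes "f \<ominus>\<^bsub>T.F\<^esub> g \<in> tilde_relations A" "f \<in> carrier T.F" "g \<in> carrier T.F"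
  shows "T.cls f = T.cls g"
  using assms T.F.genideal_self[OF tilde_relations_closed] by (subst T.cls_eq_iff) auto

lemma emb_mult:
  assumes "a \<in> carrier A" "b \<in> carrier A"
  shows "emb a \<otimes>\<^bsub>T\<^esub> emb b = emb (a \<otimes>\<^bsub>A\<^esub> b)"
proof -
  have "T.cls (single [Elt (a \<otimes>\<^bsub>A\<^esub> b)]) = T.cls (single [Elt a, Elt b])"
    by (rule relation_cls_eq) (use assms in \<open>auto simp: tilde_relations_def Let_def intro!: single_closed\<close>)
  then show ?thesis
    using assms by (simp add: tilde_emb_def T_eq T.gen_mult) (simp add: T.gen_eq)
qed

lemma emb_one: "emb \<one>\<^bsub>A\<^esub> = \<one>\<^bsub>T\<^esub>"
proof -
  have "T.cls (single [Elt \<one>\<^bsub>A\<^esub>]) = T.cls (single [])"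
    by (rule relation_cls_eq) (auto simp: tilde_relations_def Let_def intro!: single_closed)
  then show ?thesis
    using T.gen_one by (simp add: tilde_emb_def T_eq T.gen_eq)
qed

lemma p_idem: "p \<otimes>\<^bsub>T\<^esub> p = p"
proof -
  have "T.cls (single [Proj, Proj]) = T.cls (single [Proj])"
    by (rule relation_cls_eq) (auto simp: tilde_relations_def Let_def intro!: single_closed)
  then show ?thesis
    by (simp add: tilde_proj_def T_eq T.gen_mult) (simp add: T.gen_eq)
qed

lemma p_idem_left: "x \<in> carrier T \<Longrightarrow> p \<otimes>\<^bsub>T\<^esub> (p \<otimes>\<^bsub>T\<^esub> x) = p \<otimes>\<^bsub>T\<^esub> x"
  by (simp add: p_idem flip: TR.m_assoc)

abbreviation "wv \<equiv> word_val A \<phi>"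

lemma wv_linear:
  assumes "u \<in> carrier W" "c \<in> carrier A" "d \<in> carrier A"
  shows "wv (x \<odot>\<^bsub>A\<^esub> c \<oplus>\<^bsub>A\<^esub> y \<odot>\<^bsub>A\<^esub> d) u = x * wv c u + y * wv d u"
  using assms
proof (induction u arbitrary: c d)
  case (Cons l u)
  then show ?case
    by (cases l) (auto simp: A.l_distr AA.smult_mult_left algebra_simps)
qed simp

lemma wv_append_proj: "wv c (u @ Proj # v) = wv c u * wv \<one>\<^bsub>A\<^esub> v"
  by (induction A \<phi> c u rule: word_val.induct) auto

text \<open>A prefix acts on the rest only through a scalar already cashed in and the current
  accumulator. This removes the left factor when the relations are tested, and linearity in the
  accumulator does the rest.\<close>

lemma wv_append:
  assumes "u \<in> carrier W" "c \<in> carrier A"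
  shows "\<exists>k. \<exists>d\<in>carrier A. \<forall>v. wv c (u @ v) = k * wv d v"
  using assms
proof (induction u arbitrary: c)
  case Nil
  then show ?case by (intro exI[of _ 1] bexI[of _ c]) auto
next
  case (Cons l u)
  show ?case
  proof (cases l)
    case (Elt a)
    then show ?thesis using Cons.IH[of "c \<otimes>\<^bsub>A\<^esub> a"] Cons.prems by auto
  next
    case Proj
    obtain k d where "d \<in> carrier A" "\<forall>v. wv \<one>\<^bsub>A\<^esub> (u @ v) = k * wv d v"
      using Cons.IH[of "\<one>\<^bsub>A\<^esub>"] Cons.prems by auto
    then show ?thesis using Proj by (intro exI[of _ "\<phi> c * k"] bexI[of _ d]) auto
  qed
qed

lemma wv_kills:
  assumes r: "r \<in> tilde_relations A" and u: "u \<in> carrier W" and v: "v \<in> carrier W"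
  shows "lin_ext r (\<lambda>x. wv \<one>\<^bsub>A\<^esub> (u \<otimes>\<^bsub>W\<^esub> x \<otimes>\<^bsub>W\<^esub> v)) = 0"
proof -
  obtain k d where d: "d \<in> carrier A" and k: "\<And>v. wv \<one>\<^bsub>A\<^esub> (u @ v) = k * wv d v"
    using wv_append[OF u A.one_closed] by blast
  have "lin_ext r (\<lambda>x. wv d (x @ v)) = 0"
    using r d unfolding tilde_relations_def Let_def
    by (auto simp: T.lin_ext_minus lin_ext_linear single_closed wv_linear[OF v] A.m_assoc A.r_distr AA.smult_mult_right)
  then show ?thesis by (simp add: k lin_ext_scale_right)
qed

section \<open>The value functional on the free product and its factorization at
  \<open>p\<close>\<close>

definition state :: "('a letter list \<Rightarrow> complex) set \<Rightarrow> complex" where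
  "state = T.lift (wv \<one>\<^bsub>A\<^esub>)"

lemma state_linear [simp]:
  "X \<in> carrier T \<Longrightarrow> Y \<in> carrier T \<Longrightarrow> state (X \<oplus>\<^bsub>T\<^esub> Y) = state X + state Y"
  "X \<in> carrier T \<Longrightarrow> state (c \<odot>\<^bsub>T\<^esub> X) = c * state X"
  using T.lift_linear[OF wv_kills] by (auto simp: state_def T_eq linear_functional_def)

lemma state_gen: "u \<in> carrier W \<Longrightarrow> state (T.gen u) = wv \<one>\<^bsub>A\<^esub> u"
  unfolding state_def by (rule T.lift_gen[OF wv_kills])

lemma state_emb [simp]: "a \<in> carrier A \<Longrightarrow> state (emb a) = \<phi> a"
  by (simp add: tilde_emb_def state_gen)

lemma state_one [simp]: "state \<one>\<^bsub>T\<^esub> = 1"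
  by (simp flip: emb_one)

lemma state_p [simp]: "state p = 1"
  by (simp add: tilde_proj_def state_gen)

text \<open>The reset of the accumulator at \<open>Proj\<close> separates a word into two
  independent factors; the prescribed values at alternating products are iterations of this.\<close>

lemma state_mult_p:
  assumes "X \<in> carrier T" "Y \<in> carrier T"
  shows "state (X \<otimes>\<^bsub>T\<^esub> (p \<otimes>\<^bsub>T\<^esub> Y)) = state X * state Y"
proof -
  obtain f g where f: "f \<in> carrier T.F" "X = T.cls f" and g: "g \<in> carrier T.F" "Y = T.cls g"
    using assms by (auto simp: T_eq T.carrier_Q)
  have lift: "T.lift (wv \<one>\<^bsub>A\<^esub>) (T.cls f) = lin_ext f (wv \<one>\<^bsub>A\<^esub>)" if "f \<in> carrier T.F" for f
    by (rule T.lift_cls[OF wv_kills that])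
  have p: "single [Proj] \<in> carrier T.F" by (simp add: single_closed)
  have "state (X \<otimes>\<^bsub>T\<^esub> (p \<otimes>\<^bsub>T\<^esub> Y)) = T.lift (wv \<one>\<^bsub>A\<^esub>) (T.cls (f \<otimes>\<^bsub>T.F\<^esub> (single [Proj] \<otimes>\<^bsub>T.F\<^esub> g)))"
    using f g p by (simp add: state_def T_eq tilde_proj_def T.gen_eq T.cls_mult)
  also have "\<dots> = lin_ext f (\<lambda>x. lin_ext g (\<lambda>y. wv \<one>\<^bsub>A\<^esub> (x @ Proj # y)))"
    using f g p by (simp add: lift T.lin_ext_mult)
  also have "\<dots> = lin_ext f (wv \<one>\<^bsub>A\<^esub>) * lin_ext g (wv \<one>\<^bsub>A\<^esub>)"
    by (simp add: wv_append_proj lin_ext_scale_right lin_ext_scale_right')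
  also have "\<dots> = state X * state Y"
    using f g by (simp add: state_def lift)
  finally show ?thesis .
qed

lemma state_p_mult: "X \<in> carrier T \<Longrightarrow> state (p \<otimes>\<^bsub>T\<^esub> X) = state X"
  using state_mult_p[of "\<one>\<^bsub>T\<^esub>" X] by simp

lemma state_mult_p_right: "X \<in> carrier T \<Longrightarrow> state (X \<otimes>\<^bsub>T\<^esub> p) = state X"
  using state_mult_p[of X "\<one>\<^bsub>T\<^esub>"] by simp

section \<open>Alternating products exhaust the words\<close>

lemma alternating_prod_closed [simp]:
  "set as \<subseteq> carrier A \<Longrightarrow> alternating_prod A as \<in> carrier T"
  by (induction as rule: induct_list012) auto

lemma state_alternating_prod:
  "as \<noteq> [] \<Longrightarrow> set as \<subseteq> carrier A \<Longrightarrow> state (alternating_prod A as) = prod_list (map \<phi> as)"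
  by (induction as rule: induct_list012) (auto simp: state_mult_p)

lemma emb_alternating_prod:
  assumes "a \<in> carrier A" "b \<in> carrier A" "set bs \<subseteq> carrier A"
  shows "emb a \<otimes>\<^bsub>T\<^esub> alternating_prod A (b # bs) = alternating_prod A ((a \<otimes>\<^bsub>A\<^esub> b) # bs)"
  using assms by (cases bs) (auto simp: emb_mult simp flip: TR.m_assoc)

text \<open>The elements whose values are prescribed by the defining conditions of the lifted
  functional; uniqueness amounts to every word representing one of them.\<close>

definition normal :: "('a letter list \<Rightarrow> complex) set set" where
  "normal = insert p {(p [^]\<^bsub>T\<^esub> \<gamma>) \<otimes>\<^bsub>T\<^esub> alternating_prod A as \<otimes>\<^bsub>T\<^esub> (p [^]\<^bsub>T\<^esub> \<delta>)
     | \<gamma> \<delta> as. \<gamma> \<in> {0, 1 :: nat} \<and> \<delta> \<in> {0, 1 :: nat} \<and> as \<noteq> [] \<and> set as \<subseteq> carrier A}"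

lemma normalI:
  assumes "\<gamma> \<in> {0, 1 :: nat}" "\<delta> \<in> {0, 1 :: nat}" "as \<noteq> []" "set as \<subseteq> carrier A"
    and "X = (p [^]\<^bsub>T\<^esub> \<gamma>) \<otimes>\<^bsub>T\<^esub> alternating_prod A as \<otimes>\<^bsub>T\<^esub> (p [^]\<^bsub>T\<^esub> \<delta>)"
  shows "X \<in> normal"
  unfolding normal_def using assms by blast

lemma gen_normal: "u \<in> carrier W \<Longrightarrow> T.gen u \<in> normal"
proof (induction u)
  case Nil
  have "T.gen [] = \<one>\<^bsub>T\<^esub>" using T.gen_one by (simp add: T_eq)
  also have "\<dots> \<in> normal"
    by (rule normalI[of 0 0 "[\<one>\<^bsub>A\<^esub>]"]) (auto simp: emb_one)
  finally show ?case .
next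
  case (Cons l u)
  then have IH: "T.gen u \<in> normal" and u: "u \<in> carrier W" by auto
  show ?case
  proof (cases l)
    case (Elt a)
    then have a: "a \<in> carrier A" using Cons.prems by auto
    have eq: "T.gen (l # u) = emb a \<otimes>\<^bsub>T\<^esub> T.gen u"
      using a u by (simp add: Elt tilde_emb_def T_eq T.gen_mult)
    consider "T.gen u = p"
      | \<gamma> \<delta> as where "T.gen u = (p [^]\<^bsub>T\<^esub> \<gamma>) \<otimes>\<^bsub>T\<^esub> alternating_prod A as \<otimes>\<^bsub>T\<^esub> (p [^]\<^bsub>T\<^esub> \<delta>)"
          "\<gamma> \<in> {0, 1 :: nat}" "\<delta> \<in> {0, 1 :: nat}" "as \<noteq> []" "set as \<subseteq> carrier A"
      using IH unfolding normal_def by blast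
    then show ?thesis
    proof cases
      case 1
      then show ?thesis unfolding eq
        using a by (intro normalI[of 0 1 "[a]"]) auto
    next
      case 2
      obtain b bs where as: "as = b # bs" using 2 by (cases as) auto
      have pd: "p [^]\<^bsub>T\<^esub> \<delta> \<in> carrier T" by simp
      show ?thesis
      \<comment> \<open>Without a leading \<open>p\<close> the new letter merges with the first one;
        behind it stands a \<open>p\<close> otherwise, and the letter becomes a factor of its
        own.\<close>
      proof (cases "\<gamma> = 0")
        case True
        then show ?thesis unfolding eq using 2 a pd
          by (intro normalI[of 0 \<delta> "(a \<otimes>\<^bsub>A\<^esub> b) # bs"])
            (auto simp: as emb_alternating_prod[symmetric] TR.m_assoc)
      next
        case False
        then show ?thesis unfolding eq using 2 a pd
          by (intro normalI[of 0 \<delta> "a # b # bs"])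
            (auto simp: as TR.m_assoc)
      qed
    qed
  next
    case Proj
    have eq: "T.gen (l # u) = p \<otimes>\<^bsub>T\<^esub> T.gen u"
      using u by (simp add: Proj tilde_proj_def T_eq T.gen_mult)
    consider "T.gen u = p"
      | \<gamma> \<delta> as where "T.gen u = (p [^]\<^bsub>T\<^esub> \<gamma>) \<otimes>\<^bsub>T\<^esub> alternating_prod A as \<otimes>\<^bsub>T\<^esub> (p [^]\<^bsub>T\<^esub> \<delta>)"
          "\<gamma> \<in> {0, 1 :: nat}" "\<delta> \<in> {0, 1 :: nat}" "as \<noteq> []" "set as \<subseteq> carrier A"
      using IH unfolding normal_def by blast
    then show ?thesis
    proof cases
      case 1
      then show ?thesis by (simp add: eq p_idem) (simp add: normal_def)
    next
      case 2
      have pd: "p [^]\<^bsub>T\<^esub> \<delta> \<in> carrier T" by simp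
      show ?thesis unfolding eq using 2 pd
        by (intro normalI[of 1 \<delta> as]) (auto simp: TR.m_assoc p_idem_left)
    qed
  qed
qed

lemma tilde_functional_eq: "tilde_functional A \<phi> = state"
  unfolding tilde_functional_def
proof (rule the_equality, goal_cases)
  case 1
  have "state \<in> extensional (carrier T)"
    using T.lift_extensional by (simp add: state_def T_eq)
  moreover have "linear_functional T state"
    by (simp add: linear_functional_def)
  moreover have "state (p [^]\<^bsub>T\<^esub> \<gamma> \<otimes>\<^bsub>T\<^esub> alternating_prod A as \<otimes>\<^bsub>T\<^esub> (p [^]\<^bsub>T\<^esub> \<delta>)) = prod_list (map \<phi> as)"
    if "\<gamma> \<in> {0, 1 :: nat}" "\<delta> \<in> {0, 1 :: nat}" "as \<noteq> []" "set as \<subseteq> carrier A" for \<gamma> \<delta> as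
    using that by (auto simp: state_p_mult state_mult_p_right state_alternating_prod)
  ultimately show ?case by auto
next
  case (2 \<psi>)
  have "\<psi> X = state X" if "X \<in> normal" for X
    using that 2 unfolding normal_def
    by (auto simp: state_p_mult state_mult_p_right state_alternating_prod)
  then have "\<psi> (T.gen u) = wv \<one>\<^bsub>A\<^esub> u" if "u \<in> carrier W" for u
    using that gen_normal state_gen by simp
  with 2 show ?case
    unfolding state_def T_eq by (intro T.lift_unique wv_kills) auto
qed

end

section \<open>The functional on the tensor product\<close>

lemma ordered_prod_simps [simp]:
  "ordered_prod G [] = \<one>\<^bsub>G\<^esub>" "ordered_prod G (x # xs) = x \<otimes>\<^bsub>G\<^esub> ordered_prod G xs"
  by (simp_all add: ordered_prod_def)

locale ncps_family =
  fixes A :: "'i \<Rightarrow> (complex, 'a) module" and \<phi> :: "'i \<Rightarrow> 'a \<Rightarrow> complex"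
  assumes spaces: "\<And>i. nc_prob_space (A i) (\<phi> i)"
begin

sublocale N: ncps "A i" "\<phi> i" for i
  by unfold_locales (rule spaces)

abbreviation "T i \<equiv> tilde (A i)"
abbreviation "M \<equiv> entries_monoid A"

lemma entries_monoid_simps:
  "carrier M = tensor_entries A"
  "x \<otimes>\<^bsub>M\<^esub> y = (\<lambda>s\<in>sites. x s \<otimes>\<^bsub>T (fst s)\<^esub> y s)"
  "\<one>\<^bsub>M\<^esub> = (\<lambda>s\<in>sites. \<one>\<^bsub>T (fst s)\<^esub>)"
  by (simp_all add: entries_monoid_def tilde_at_def)

lemma entries_iff:
  "x \<in> tensor_entries A \<longleftrightarrow> x \<in> extensional sites \<and> (\<forall>s\<in>sites. x s \<in> carrier (T (fst s))) \<and>
     finite {s \<in> sites. x s \<notin> {\<one>\<^bsub>T (fst s)\<^esub>, tilde_proj (A (fst s))}}"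
  by (auto simp: tensor_entries_def tilde_at_def PiE_def Pi_def)

lemma entry_closed [simp]: "x \<in> tensor_entries A \<Longrightarrow> s \<in> sites \<Longrightarrow> x s \<in> carrier (T (fst s))"
  by (simp add: entries_iff)

text \<open>Finiteness survives because the set of the unit and \<open>p\<close> is closed under
  products, by idempotence.\<close>

lemma entries_mult_closed:
  assumes x: "x \<in> tensor_entries A" and y: "y \<in> tensor_entries A"
  shows "x \<otimes>\<^bsub>M\<^esub> y \<in> tensor_entries A"
proof -
  let ?B = "\<lambda>x. {s \<in> sites. x s \<notin> {\<one>\<^bsub>T (fst s)\<^esub>, tilde_proj (A (fst s))}}"
  have "?B (x \<otimes>\<^bsub>M\<^esub> y) \<subseteq> ?B x \<union> ?B y"
  proof
    fix s assume s: "s \<in> ?B (x \<otimes>\<^bsub>M\<^esub> y)"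
    show "s \<in> ?B x \<union> ?B y"
    proof (rule ccontr)
      assume "s \<notin> ?B x \<union> ?B y"
      then have "x s \<in> {\<one>\<^bsub>T (fst s)\<^esub>, tilde_proj (A (fst s))}"
        "y s \<in> {\<one>\<^bsub>T (fst s)\<^esub>, tilde_proj (A (fst s))}" using s by auto
      then have "x s \<otimes>\<^bsub>T (fst s)\<^esub> y s \<in> {\<one>\<^bsub>T (fst s)\<^esub>, tilde_proj (A (fst s))}"
        by (auto simp: N.p_idem)
      moreover have "(x \<otimes>\<^bsub>M\<^esub> y) s = x s \<otimes>\<^bsub>T (fst s)\<^esub> y s"
        using s by (simp add: entries_monoid_simps)
      ultimately show False using s by simp
    qed
  qed
  moreover have "finite (?B x \<union> ?B y)" using x y by (simp add: entries_iff)
  ultimately have "finite (?B (x \<otimes>\<^bsub>M\<^esub> y))" by (rule finite_subset)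
  then show ?thesis
    using x y by (subst entries_iff) (simp add: entries_monoid_simps)
qed

lemma entries_one: "\<one>\<^bsub>M\<^esub> \<in> tensor_entries A"
  by (subst entries_iff) (simp add: entries_monoid_simps)

lemma entries_monoid_monoid: "Group.monoid M"
proof (rule monoidI)
  fix x y z assume "x \<in> carrier M" "y \<in> carrier M" "z \<in> carrier M"
  then show "x \<otimes>\<^bsub>M\<^esub> y \<otimes>\<^bsub>M\<^esub> z = x \<otimes>\<^bsub>M\<^esub> (y \<otimes>\<^bsub>M\<^esub> z)"
    unfolding entries_monoid_simps by (intro restrict_ext) (simp add: N.TR.m_assoc)
next
  fix x assume "x \<in> carrier M"
  then show "\<one>\<^bsub>M\<^esub> \<otimes>\<^bsub>M\<^esub> x = x" "x \<otimes>\<^bsub>M\<^esub> \<one>\<^bsub>M\<^esub> = x"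
    by (auto simp: entries_monoid_simps entries_iff extensional_def fun_eq_iff)
qed (simp_all add: entries_mult_closed entries_one entries_monoid_simps(1))

sublocale M: Group.monoid M
  by (rule entries_monoid_monoid)

lemma entries_upd:
  assumes x: "x \<in> tensor_entries A" and s: "s \<in> sites" "u \<in> carrier (T (fst s))"
  shows "x(s := u) \<in> tensor_entries A"
proof -
  let ?B = "\<lambda>x. {s \<in> sites. x s \<notin> {\<one>\<^bsub>T (fst s)\<^esub>, tilde_proj (A (fst s))}}"
  have "finite (?B (x(s := u)))"
    by (rule finite_subset[of _ "insert s (?B x)"]) (use x in \<open>auto simp: entries_iff\<close>)
  then show ?thesis using assms by (subst entries_iff) (auto simp: entries_iff extensional_def)
qed

lemma multilinear_relations_closed: "multilinear_relations A \<subseteq> carrier (monoid_algebra M)"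
proof -
  interpret F: ring "monoid_algebra M"
    using M.monoid_algebra_complex_algebra by (rule complex_algebra.axioms)
  interpret FA: complex_algebra "monoid_algebra M"
    by (rule M.monoid_algebra_complex_algebra)
  have smult: "c \<odot>\<^bsub>monoid_algebra M\<^esub> f \<in> carrier (monoid_algebra M)"
    if "f \<in> carrier (monoid_algebra M)" for c f
    using that by (intro FA.smult_closed) (simp add: complex_field_def)
  have "single (x(s := u)) \<in> carrier (monoid_algebra M)"
    if "x \<in> tensor_entries A" "s \<in> sites" "u \<in> carrier (T (fst s))" for x s u
    using that by (intro single_closed) (simp add: entries_monoid_simps(1) entries_upd)
  then show ?thesis
    by (auto simp: multilinear_relations_def Let_def tilde_at_def intro!: F.minus_closed F.add.m_closed smult)
qed

sublocale P: presentation M "multilinear_relations A"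
  by (intro presentation.intro presentation_axioms.intro entries_monoid_monoid multilinear_relations_closed)

abbreviation "X \<equiv> tensor_algebra A"

lemma X_eq: "X = P.Q"
  by (simp add: tensor_algebra_def)

sublocale XR: ring X
  using P.complex_algebra_Q by (simp add: X_eq complex_algebra_def)

lemma simple_closed [simp]: "x \<in> tensor_entries A \<Longrightarrow> simple_tensor A x \<in> carrier X"
  by (simp add: simple_tensor_def X_eq entries_monoid_simps(1))

lemma simple_mult:
  "x \<in> tensor_entries A \<Longrightarrow> y \<in> tensor_entries A \<Longrightarrow>
    simple_tensor A x \<otimes>\<^bsub>X\<^esub> simple_tensor A y = simple_tensor A (x \<otimes>\<^bsub>M\<^esub> y)"
  by (simp add: simple_tensor_def X_eq P.gen_mult entries_monoid_simps(1))

lemma simple_one: "simple_tensor A \<one>\<^bsub>M\<^esub> = \<one>\<^bsub>X\<^esub>"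
  by (simp add: simple_tensor_def X_eq P.gen_one)

abbreviation "site_state s \<equiv> N.state (fst s)"

section \<open>The product functional on simple tensors\<close>

definition tens :: "('i, 'a) entries \<Rightarrow> complex" where
  "tens x = (\<Prod>s \<in> {s \<in> sites. site_state s (x s) \<noteq> 1}. site_state s (x s))"

definition tens_off :: "'i \<times> nat \<Rightarrow> ('i, 'a) entries \<Rightarrow> complex" where
  "tens_off t x = (\<Prod>s \<in> {s \<in> sites - {t}. site_state s (x s) \<noteq> 1}. site_state s (x s))"

text \<open>The unit and \<open>p\<close> both have state \<open>1\<close>, so only finitely many
  sites contribute and a single factor can be split off.\<close>

lemma tens_split:
  assumes x: "x \<in> tensor_entries A" and t: "t \<in> sites"
  shows "tens x = site_state t (x t) * tens_off t x"
proof -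
  have "finite {s \<in> sites. site_state s (x s) \<noteq> 1}"
  proof (rule finite_subset)
    show "finite {s \<in> sites. x s \<notin> {\<one>\<^bsub>T (fst s)\<^esub>, tilde_proj (A (fst s))}}"
      using x by (simp add: entries_iff)
  qed (auto simp: N.state_one N.state_p)
  note fin = this
  have eq: "{s \<in> sites - {t}. site_state s (x s) \<noteq> 1} = {s \<in> sites. site_state s (x s) \<noteq> 1} - {t}"
    by auto
  show ?thesis
  proof (cases "site_state t (x t) = 1")
    case True
    then have "tens x = tens_off t x" unfolding tens_def tens_off_def by (intro prod.cong) auto
    then show ?thesis using True by simp
  next
    case False
    then show ?thesis unfolding tens_def tens_off_def eq using fin t by (subst prod.remove[of _ t]) auto
  qed
qed

lemma tens_off_cong:
  assumes "\<And>s. s \<in> sites \<Longrightarrow> s \<noteq> t \<Longrightarrow> site_state s (x s) = site_state s (y s)"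
  shows "tens_off t x = tens_off t y"
  unfolding tens_off_def using assms by (intro prod.cong) auto

text \<open>A relation changes one site only. The three simple tensors share the factor away from
  it, and what remains is linearity of the state at that site between the fixed factors
  \<open>u s\<close> and \<open>v s\<close>.\<close>

lemma tens_kills:
  assumes r: "r \<in> multilinear_relations A" and u: "u \<in> carrier M" and v: "v \<in> carrier M"
  shows "lin_ext r (\<lambda>x. tens (u \<otimes>\<^bsub>M\<^esub> x \<otimes>\<^bsub>M\<^esub> v)) = 0"
proof -
  obtain x s c d a b where x: "x \<in> tensor_entries A" and s: "s \<in> sites"
    and a: "a \<in> carrier (T (fst s))" and b: "b \<in> carrier (T (fst s))"
    and r: "r = single (x(s := c \<odot>\<^bsub>T (fst s)\<^esub> a \<oplus>\<^bsub>T (fst s)\<^esub> d \<odot>\<^bsub>T (fst s)\<^esub> b))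
         \<ominus>\<^bsub>P.F\<^esub> (c \<odot>\<^bsub>P.F\<^esub> single (x(s := a)) \<oplus>\<^bsub>P.F\<^esub> d \<odot>\<^bsub>P.F\<^esub> single (x(s := b)))"
    using r unfolding multilinear_relations_def Let_def tilde_at_def by blast
  let ?e = "c \<odot>\<^bsub>T (fst s)\<^esub> a \<oplus>\<^bsub>T (fst s)\<^esub> d \<odot>\<^bsub>T (fst s)\<^esub> b"
  have e: "?e \<in> carrier (T (fst s))" using a b by (simp add: N.T_smult_closed)
  have u: "u \<in> tensor_entries A" and v: "v \<in> tensor_entries A"
    using u v by (simp_all add: entries_monoid_simps(1))
  have us: "u s \<in> carrier (T (fst s))" "v s \<in> carrier (T (fst s))" using u v s by auto
  have val: "tens (u \<otimes>\<^bsub>M\<^esub> x(s := y) \<otimes>\<^bsub>M\<^esub> v)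
      = site_state s (u s \<otimes>\<^bsub>T (fst s)\<^esub> y \<otimes>\<^bsub>T (fst s)\<^esub> v s) * tens_off s (u \<otimes>\<^bsub>M\<^esub> x \<otimes>\<^bsub>M\<^esub> v)"
    if y: "y \<in> carrier (T (fst s))" for y
  proof -
    have "tens (u \<otimes>\<^bsub>M\<^esub> x(s := y) \<otimes>\<^bsub>M\<^esub> v)
      = site_state s ((u \<otimes>\<^bsub>M\<^esub> x(s := y) \<otimes>\<^bsub>M\<^esub> v) s) * tens_off s (u \<otimes>\<^bsub>M\<^esub> x(s := y) \<otimes>\<^bsub>M\<^esub> v)"
      using u v x y s by (intro tens_split entries_mult_closed entries_upd)
    also have "tens_off s (u \<otimes>\<^bsub>M\<^esub> x(s := y) \<otimes>\<^bsub>M\<^esub> v) = tens_off s (u \<otimes>\<^bsub>M\<^esub> x \<otimes>\<^bsub>M\<^esub> v)"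
      by (intro tens_off_cong) (simp add: entries_monoid_simps)
    also have "(u \<otimes>\<^bsub>M\<^esub> x(s := y) \<otimes>\<^bsub>M\<^esub> v) s = u s \<otimes>\<^bsub>T (fst s)\<^esub> y \<otimes>\<^bsub>T (fst s)\<^esub> v s"
      using s by (simp add: entries_monoid_simps)
    finally show ?thesis .
  qed
  have sc: "single (x(s := y)) \<in> carrier P.F" if "y \<in> carrier (T (fst s))" for y
    using that x s by (intro single_closed) (simp add: entries_monoid_simps(1) entries_upd)
  have lin: "site_state s (u s \<otimes>\<^bsub>T (fst s)\<^esub> ?e \<otimes>\<^bsub>T (fst s)\<^esub> v s)
     = c * site_state s (u s \<otimes>\<^bsub>T (fst s)\<^esub> a \<otimes>\<^bsub>T (fst s)\<^esub> v s) + d * site_state s (u s \<otimes>\<^bsub>T (fst s)\<^esub> b \<otimes>\<^bsub>T (fst s)\<^esub> v s)"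
    using us a b
    by (simp add: N.TR.r_distr N.TR.l_distr N.TA.smult_mult_left N.TA.smult_mult_right N.T_smult_closed
        N.state_linear)
  show ?thesis unfolding r using sc[OF e] sc[OF a] sc[OF b]
    by (simp add: P.lin_ext_minus lin_ext_linear val[OF e] val[OF a] val[OF b] lin algebra_simps)
qed

abbreviation "\<Phi> \<equiv> tensor_functional A \<phi>"

lemma tensor_functional_eq: "\<Phi> = P.lift tens"
proof -
  have "tensor_functional A \<phi> =
     (THE \<Psi>. \<Psi> \<in> extensional (carrier X) \<and> linear_functional X \<Psi> \<and>
        (\<forall>x\<in>tensor_entries A. \<Psi> (simple_tensor A x) = tens x))"
    unfolding tensor_functional_def tens_def N.tilde_functional_eq ..
  also have "\<dots> = P.lift tens"
  proof (rule the_equality, goal_cases)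
    case 1
    have "P.lift tens (simple_tensor A x) = tens x" if "x \<in> tensor_entries A" for x
      unfolding simple_tensor_def
      by (rule P.lift_gen[where h = tens, OF tens_kills]) (use that in \<open>simp_all add: entries_monoid_simps(1)\<close>)
    then show ?case
      using P.lift_extensional[of tens] P.lift_linear[where h = tens, OF tens_kills] unfolding X_eq by blast
  next
    case (2 \<Psi>)
    show ?case
      by (rule P.lift_unique[where h = tens, OF tens_kills]) (use 2 in \<open>simp_all add: X_eq simple_tensor_def entries_monoid_simps(1)\<close>)
  qed
  finally show ?thesis .
qed

lemma Phi_simple: "x \<in> tensor_entries A \<Longrightarrow> \<Phi> (simple_tensor A x) = tens x"
  unfolding simple_tensor_def tensor_functional_eq
  by (rule P.lift_gen[where h = tens, OF tens_kills]) (simp_all add: entries_monoid_simps(1))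

lemma Phi_minus:
  assumes "Y \<in> carrier X" "Z \<in> carrier X"
  shows "\<Phi> (Y \<ominus>\<^bsub>X\<^esub> Z) = \<Phi> Y - \<Phi> Z"
proof -
  have add: "\<Phi> (Y \<oplus>\<^bsub>X\<^esub> Z) = \<Phi> Y + \<Phi> Z" if "Y \<in> carrier X" "Z \<in> carrier X" for Y Z
    using P.lift_linear[where h = tens, OF tens_kills] that by (simp add: linear_functional_def X_eq tensor_functional_eq)
  have "(Y \<ominus>\<^bsub>X\<^esub> Z) \<oplus>\<^bsub>X\<^esub> Z = Y" using assms by (simp add: XR.minus_eq XR.a_assoc XR.l_neg)
  then show ?thesis using add[of "Y \<ominus>\<^bsub>X\<^esub> Z" Z] assms by simp
qed

lemma Phi_zero: "\<Phi> \<zero>\<^bsub>X\<^esub> = 0"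
  using Phi_minus[of "\<zero>\<^bsub>X\<^esub>" "\<zero>\<^bsub>X\<^esub>"] by (simp add: XR.minus_eq)

section \<open>Products of replicas as signed sums of simple tensors\<close>

text \<open>\<open>rep_entry i j q a\<close> is the family of entries of \<open>\<iota>\<^sub>j(a) P\<^sub>i(q)\<close>.\<close>

definition rep_entry :: "'i \<Rightarrow> nat \<Rightarrow> nat \<Rightarrow> 'a \<Rightarrow> ('i, 'a) entries" where
  "rep_entry i j q a = (\<lambda>s\<in>sites. if s = (i, j) then tilde_emb (A i) a
     else if fst s \<noteq> i \<and> q \<le> snd s then tilde_proj (A (fst s)) else \<one>\<^bsub>T (fst s)\<^esub>)"

lemma rep_entry_closed: "a \<in> carrier (A i) \<Longrightarrow> rep_entry i j q a \<in> tensor_entries A"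
  unfolding entries_iff
  by (auto simp: rep_entry_def N.p_closed N.emb_closed intro: finite_subset[of _ "{(i, j)}"])

text \<open>Multiplies out the difference of projections in every replica standing to the right of
  \<open>x\<close>. Color \<open>1\<close> leaves a single term because the projection of index
  \<open>0\<close> is zero.\<close>

fun expand :: "('i, 'a) entries \<Rightarrow> (nat \<times> 'i \<times> 'a) list \<Rightarrow> complex" where
  "expand x [] = tens x"
| "expand x ((j, i, a) # xs) = expand (x \<otimes>\<^bsub>M\<^esub> rep_entry i j j a) xs
     - (if j = 1 then 0 else expand (x \<otimes>\<^bsub>M\<^esub> rep_entry i j (j - 1) a) xs)"

definition valid_letters :: "(nat \<times> 'i \<times> 'a) list \<Rightarrow> bool" where
  "valid_letters xs \<longleftrightarrow> (\<forall>(j, i, a)\<in>set xs. 1 \<le> j \<and> a \<in> carrier (A i))"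

lemma valid_letters_simps [simp]:
  "valid_letters []"
  "valid_letters ((j, i, a) # xs) \<longleftrightarrow> 1 \<le> j \<and> a \<in> carrier (A i) \<and> valid_letters xs"
  by (auto simp: valid_letters_def)

lemma replica_eq:
  assumes j: "1 \<le> j" and a: "a \<in> carrier (A i)"
  shows "replica A i j a = simple_tensor A (rep_entry i j j a) \<ominus>\<^bsub>X\<^esub>
    (if j = 1 then \<zero>\<^bsub>X\<^esub> else simple_tensor A (rep_entry i j (j - 1) a))"
proof -
  define I where "I = (\<lambda>s\<in>sites. if s = (i, j) then tilde_emb (A i) a else \<one>\<^bsub>T (fst s)\<^esub>)"
  define Pe where "Pe q = (\<lambda>s\<in>sites. if fst s \<noteq> i \<and> q \<le> snd s then tilde_proj (A (fst s)) else \<one>\<^bsub>T (fst s)\<^esub>)" for q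
  have I: "I \<in> tensor_entries A" unfolding entries_iff
    using a by (auto simp: I_def N.emb_closed intro: finite_subset[of _ "{(i, j)}"])
  have Pe: "Pe q \<in> tensor_entries A" for q
    unfolding entries_iff by (auto simp: Pe_def N.p_closed intro!: finite_subset[of _ "{}"])
  have mult: "I \<otimes>\<^bsub>M\<^esub> Pe q = rep_entry i j q a" for q
    using a by (auto simp: entries_monoid_simps rep_entry_def I_def Pe_def N.emb_closed intro!: restrict_ext)
  have rp: "rep_P A i q = (if q = 0 then \<zero>\<^bsub>X\<^esub> else simple_tensor A (Pe q))" for q
    unfolding rep_P_def Pe_def tilde_at_def by simp
  have "replica A i j a = simple_tensor A I \<otimes>\<^bsub>X\<^esub> (simple_tensor A (Pe j) \<ominus>\<^bsub>X\<^esub> rep_P A i (j - 1))"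
    using j unfolding replica_def rep_iota_def rep_p_def I_def tilde_at_def by (simp add: rp)
  also have "\<dots> = simple_tensor A I \<otimes>\<^bsub>X\<^esub> simple_tensor A (Pe j) \<ominus>\<^bsub>X\<^esub> simple_tensor A I \<otimes>\<^bsub>X\<^esub> rep_P A i (j - 1)"
    using I Pe by (simp add: rp XR.minus_eq XR.r_distr XR.r_minus)
  also have "simple_tensor A I \<otimes>\<^bsub>X\<^esub> simple_tensor A (Pe j) = simple_tensor A (rep_entry i j j a)"
    using I Pe by (simp add: simple_mult mult)
  also have "simple_tensor A I \<otimes>\<^bsub>X\<^esub> rep_P A i (j - 1) =
      (if j = 1 then \<zero>\<^bsub>X\<^esub> else simple_tensor A (rep_entry i j (j - 1) a))"
    using I Pe j by (auto simp: rp simple_mult mult)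
  finally show ?thesis .
qed

lemma replica_closed [simp]: "1 \<le> j \<Longrightarrow> a \<in> carrier (A i) \<Longrightarrow> replica A i j a \<in> carrier X"
  by (simp add: replica_eq rep_entry_closed)

lemma replica_prod_closed:
  "valid_letters xs \<Longrightarrow> ordered_prod X (map (\<lambda>(j, i, a). replica A i j a) xs) \<in> carrier X"
  by (induction xs) auto

lemma Phi_expand:
  assumes "x \<in> tensor_entries A" "valid_letters xs"
  shows "\<Phi> (simple_tensor A x \<otimes>\<^bsub>X\<^esub> ordered_prod X (map (\<lambda>(j, i, a). replica A i j a) xs)) = expand x xs"
  using assms
proof (induction xs arbitrary: x)
  case Nil
  then show ?case by (simp add: Phi_simple)
next
  case (Cons y xs)
  obtain j i a where y: "y = (j, i, a)" by (cases y)
  have j: "1 \<le> j" and a: "a \<in> carrier (A i)" and xs: "valid_letters xs"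
    using Cons.prems by (auto simp: y)
  define Y where "Y = ordered_prod X (map (\<lambda>(j, i, a). replica A i j a) xs)"
  have Y: "Y \<in> carrier X" using xs by (simp add: Y_def replica_prod_closed)
  have e: "rep_entry i j q a \<in> tensor_entries A" for q using a by (rule rep_entry_closed)
  have x: "x \<in> tensor_entries A" using Cons.prems by simp
  have IH: "\<Phi> (simple_tensor A x \<otimes>\<^bsub>X\<^esub> (simple_tensor A (rep_entry i j q a) \<otimes>\<^bsub>X\<^esub> Y))
      = expand (x \<otimes>\<^bsub>M\<^esub> rep_entry i j q a) xs" for q
    using Cons.IH[OF _ xs, of "x \<otimes>\<^bsub>M\<^esub> rep_entry i j q a"] x e Y
    by (simp add: entries_mult_closed flip: Y_def) (simp add: XR.m_assoc flip: simple_mult)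
  have distr: "simple_tensor A x \<otimes>\<^bsub>X\<^esub> ((B \<ominus>\<^bsub>X\<^esub> C) \<otimes>\<^bsub>X\<^esub> Y)
    = simple_tensor A x \<otimes>\<^bsub>X\<^esub> (B \<otimes>\<^bsub>X\<^esub> Y) \<ominus>\<^bsub>X\<^esub> simple_tensor A x \<otimes>\<^bsub>X\<^esub> (C \<otimes>\<^bsub>X\<^esub> Y)"
    if "B \<in> carrier X" "C \<in> carrier X" for B C
    using that x Y by (simp add: XR.minus_eq XR.l_distr XR.r_distr XR.l_minus XR.r_minus)
  show ?case
    using x e Y j a
    by (simp add: y replica_eq distr Phi_minus Phi_zero IH flip: Y_def)
qed

lemma rep_functional_prod:
  assumes "valid_letters xs"
  shows "rep_functional A \<phi> (ordered_prod X (map (\<lambda>(j, i, a). replica A i j a) xs)) = expand \<one>\<^bsub>M\<^esub> xs"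
proof -
  let ?Y = "ordered_prod X (map (\<lambda>(j, i, a). replica A i j a) xs)"
  have "?Y \<in> B" if "unital_subalgebra B X"
    "{replica A i j a | i j a. 1 \<le> j \<and> a \<in> carrier (A i)} \<subseteq> B" for B
  proof -
    have B: "subring B X" using that(1) by (simp add: unital_subalgebra_def)
    show ?thesis using assms
    proof (induction xs)
      case Nil
      then show ?case using subringE(3)[OF B] by simp
    next
      case (Cons y xs)
      obtain j i a where y: "y = (j, i, a)" by (cases y)
      then have "replica A i j a \<in> B" using Cons.prems that(2) by auto
      then show ?case using Cons subringE(6)[OF B] by (simp add: y)
    qed
  qed
  \<comment> \<open>Outside the replica algebra the restricted functional is
    \<open>undefined\<close>, so membership has to be secured before it can be evaluated.\<close>
  then have "?Y \<in> rep_algebra A" by (auto simp: rep_algebra_def)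
  then have "rep_functional A \<phi> ?Y = \<Phi> ?Y" by (simp add: rep_functional_def)
  also have "\<dots> = \<Phi> (simple_tensor A \<one>\<^bsub>M\<^esub> \<otimes>\<^bsub>X\<^esub> ?Y)"
    using assms by (simp add: simple_one replica_prod_closed)
  also have "\<dots> = expand \<one>\<^bsub>M\<^esub> xs"
    by (rule Phi_expand) (use assms entries_one in auto)
  finally show ?thesis .
qed

end

section \<open>Evaluation with a stack of open blocks\<close>

text \<open>
  The stack holds the labels and the arguments of the open blocks, innermost first; a letter is a triple of
  color, label and argument.
\<close>

fun run :: "('i \<Rightarrow> 'a list \<Rightarrow> complex) \<Rightarrow> ('i \<times> 'a list) list \<Rightarrow> (nat \<times> 'i \<times> 'a) list \<Rightarrow> complex" where
  "run b [(i, u)] [] = b i u"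
| "run b S [] = 0"
| "run b [] ((j, l, a) # xs) = 0"
| "run b ((i, u) # S) ((j, l, a) # xs) =
    (if j = length S + 2 then if l = i then 0 else run b ((l, [a]) # (i, u) # S) xs
     else if j = length S + 1 then
       (if l = i then run b ((i, u @ [a]) # S) xs else 0) +
       (if S \<noteq> [] \<and> l = fst (hd S) then 0 else b i u * run b ((l, [a]) # S) xs)
     else if S \<noteq> [] \<and> l = fst (hd S) then b i u * run b ((l, snd (hd S) @ [a]) # tl S) xs
     else 0)"

text \<open>Here \<open>h\<close> is the letter preceding the word, which is also the current height
  of the stack.\<close>

fun admissible :: "nat \<Rightarrow> (nat \<times> 'i \<times> 'a) list \<Rightarrow> bool" where
  "admissible h [] \<longleftrightarrow> True"
| "admissible h ((j, l, a) # xs) \<longleftrightarrow> 1 \<le> j \<and> h \<le> j + 1 \<and> j \<le> h + 1 \<and> admissible j xs"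

section \<open>The complement \<open>pp\<close> of \<open>p\<close>, called q in the
  overview\<close>

context ncps
begin

definition pp :: "('a letter list \<Rightarrow> complex) set" where
  "pp = \<one>\<^bsub>T\<^esub> \<ominus>\<^bsub>T\<^esub> p"

lemma pp_closed [simp]: "pp \<in> carrier T"
  by (simp add: pp_def)

lemma pp_p: "pp \<otimes>\<^bsub>T\<^esub> p = \<zero>\<^bsub>T\<^esub>"
  by (simp add: pp_def TR.minus_eq TR.l_distr TR.l_minus p_idem TR.r_neg)

lemma mult_pp_p: "x \<in> carrier T \<Longrightarrow> (x \<otimes>\<^bsub>T\<^esub> pp) \<otimes>\<^bsub>T\<^esub> p = \<zero>\<^bsub>T\<^esub>"
  by (simp add: TR.m_assoc pp_p)

lemma state_zero [simp]: "state \<zero>\<^bsub>T\<^esub> = 0"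
  using state_linear(1)[of "\<zero>\<^bsub>T\<^esub>" "\<zero>\<^bsub>T\<^esub>"] by simp

lemma state_minus:
  assumes "x \<in> carrier T" "y \<in> carrier T"
  shows "state (x \<ominus>\<^bsub>T\<^esub> y) = state x - state y"
proof -
  have "(x \<ominus>\<^bsub>T\<^esub> y) \<oplus>\<^bsub>T\<^esub> y = x" using assms by (simp add: TR.minus_eq TR.a_assoc TR.l_neg)
  then show ?thesis using state_linear(1)[of "x \<ominus>\<^bsub>T\<^esub> y" y] assms by simp
qed

text \<open>With \<open>pp\<close> in place of \<open>p\<close> the factorization becomes a
  covariance. For \<open>y\<close> the unit it vanishes, so a product ending in \<open>pp\<close>
  has state zero.\<close>

lemma state_mult_pp:
  assumes "x \<in> carrier T" "y \<in> carrier T"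
  shows "state (x \<otimes>\<^bsub>T\<^esub> (pp \<otimes>\<^bsub>T\<^esub> y)) = state (x \<otimes>\<^bsub>T\<^esub> y) - state x * state y"
proof -
  have "x \<otimes>\<^bsub>T\<^esub> (pp \<otimes>\<^bsub>T\<^esub> y) = x \<otimes>\<^bsub>T\<^esub> y \<ominus>\<^bsub>T\<^esub> x \<otimes>\<^bsub>T\<^esub> (p \<otimes>\<^bsub>T\<^esub> y)"
    using assms by (simp add: pp_def TR.minus_eq TR.l_distr TR.r_distr TR.l_minus TR.r_minus)
  then show ?thesis using assms by (simp add: state_minus state_mult_p)
qed

text \<open>Folded from the left because a block only ever grows by a position at its right end; an
  appended argument is then one multiplication on the right.\<close>

definition perp_prod :: "'a list \<Rightarrow> ('a letter list \<Rightarrow> complex) set" where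
  "perp_prod u = foldl (\<lambda>t a. t \<otimes>\<^bsub>T\<^esub> pp \<otimes>\<^bsub>T\<^esub> emb a) (emb (hd u)) (tl u)"

lemma perp_prod_single [simp]: "perp_prod [a] = emb a"
  by (simp add: perp_prod_def)

lemma perp_prod_snoc: "u \<noteq> [] \<Longrightarrow> perp_prod (u @ [a]) = perp_prod u \<otimes>\<^bsub>T\<^esub> pp \<otimes>\<^bsub>T\<^esub> emb a"
  by (simp add: perp_prod_def)

lemma perp_prod_closed [simp]: "u \<noteq> [] \<Longrightarrow> set u \<subseteq> carrier A \<Longrightarrow> perp_prod u \<in> carrier T"
  by (induction u rule: rev_nonempty_induct) (auto simp: perp_prod_snoc)

end

section \<open>Tensors encoded by stacks\<close>

context ncps_family
begin

text \<open>Levels are counted from the bottom: an entry with tail \<open>S\<close> sits at level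
  \<open>length S + 1\<close>, so pushing and popping leave the lower sites in place.\<close>

fun look :: "('i \<times> ('a letter list \<Rightarrow> complex) set) list \<Rightarrow> 'i \<times> nat \<Rightarrow> ('a letter list \<Rightarrow> complex) set" where
  "look [] s = \<one>\<^bsub>T (fst s)\<^esub>"
| "look ((i, t) # S) s =
    (if snd s = length S + 1 then if fst s = i then t else \<one>\<^bsub>T (fst s)\<^esub> else look S s)"

definition ent :: "('i \<times> ('a letter list \<Rightarrow> complex) set) list \<Rightarrow> ('i, 'a) entries" where
  "ent S = restrict (look S) sites"

lemma look_beyond: "length S < snd s \<Longrightarrow> look S s = \<one>\<^bsub>T (fst s)\<^esub>"
  by (induction S s rule: look.induct) auto

definition tilde_stack :: "('i \<times> ('a letter list \<Rightarrow> complex) set) list \<Rightarrow> bool" where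
  "tilde_stack S \<longleftrightarrow> (\<forall>(i, t)\<in>set S. t \<in> carrier (T i))"

lemma tilde_stack_simps [simp]:
  "tilde_stack []" "tilde_stack ((i, t) # S) \<longleftrightarrow> t \<in> carrier (T i) \<and> tilde_stack S"
  by (auto simp: tilde_stack_def)

lemma look_closed: "tilde_stack S \<Longrightarrow> look S s \<in> carrier (T (fst s))"
  by (induction S s rule: look.induct) auto

lemma ent_closed:
  assumes "tilde_stack S"
  shows "ent S \<in> tensor_entries A"
proof -
  have "finite {s. look S s \<noteq> \<one>\<^bsub>T (fst s)\<^esub>}"
  proof (induction S)
    case (Cons y S)
    obtain i t where y: "y = (i, t)" by (cases y)
    have "{s. look (y # S) s \<noteq> \<one>\<^bsub>T (fst s)\<^esub>} \<subseteq> insert (i, length S + 1) {s. look S s \<noteq> \<one>\<^bsub>T (fst s)\<^esub>}"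
      by (auto simp: y)
    then show ?case using Cons.IH finite_subset by blast
  qed simp
  then have "finite {s \<in> sites. ent S s \<notin> {\<one>\<^bsub>T (fst s)\<^esub>, tilde_proj (A (fst s))}}"
    by (rule rev_finite_subset) (auto simp: ent_def)
  then show ?thesis using assms look_closed by (subst entries_iff) (auto simp: ent_def)
qed

text \<open>Replicas act by right multiplication, so a combination annihilated by all right factors
  \<open>z\<close> stays annihilated after any letters: the induction absorbs each replica into
  \<open>z\<close>. This is what permits exchanging one tensor for another in the middle of a
  word.\<close>

lemma expand_comb:
  assumes "\<And>z. z \<in> tensor_entries A \<Longrightarrow> (\<Sum>(c, x)\<leftarrow>L. c * tens (x \<otimes>\<^bsub>M\<^esub> z)) = 0"
    and "\<And>c x. (c, x) \<in> set L \<Longrightarrow> x \<in> tensor_entries A" and "valid_letters xs"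
  shows "(\<Sum>(c, x)\<leftarrow>L. c * expand x xs) = 0"
  using assms
proof (induction xs arbitrary: L)
  case Nil
  have "x \<otimes>\<^bsub>M\<^esub> \<one>\<^bsub>M\<^esub> = x" if "x \<in> tensor_entries A" for x
    using that by (simp add: entries_monoid_simps(1))
  then have "(\<Sum>(c, x)\<leftarrow>L. c * expand x []) = (\<Sum>(c, x)\<leftarrow>L. c * tens (x \<otimes>\<^bsub>M\<^esub> \<one>\<^bsub>M\<^esub>))"
    using Nil.prems(2) by (intro arg_cong[where f = sum_list] map_cong) auto
  then show ?case using Nil.prems(1)[OF entries_one] by simp
next
  case (Cons y xs)
  obtain j i a where y: "y = (j, i, a)" by (cases y)
  have a: "a \<in> carrier (A i)" and xs: "valid_letters xs"
    using Cons.prems by (auto simp: y)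
  have e: "rep_entry i j q a \<in> tensor_entries A" for q using a by (rule rep_entry_closed)
  have *: "(\<Sum>(c, x)\<leftarrow>L. c * expand (x \<otimes>\<^bsub>M\<^esub> rep_entry i j q a) xs) = 0" for q
  proof -
    have "(\<Sum>(c, x)\<leftarrow>map (\<lambda>(c, x). (c, x \<otimes>\<^bsub>M\<^esub> rep_entry i j q a)) L. c * expand x xs) = 0"
    proof (rule Cons.IH)
      fix z assume z: "z \<in> tensor_entries A"
      have "(\<Sum>(c, x)\<leftarrow>map (\<lambda>(c, x). (c, x \<otimes>\<^bsub>M\<^esub> rep_entry i j q a)) L. c * tens (x \<otimes>\<^bsub>M\<^esub> z))
        = (\<Sum>(c, x)\<leftarrow>L. c * tens (x \<otimes>\<^bsub>M\<^esub> (rep_entry i j q a \<otimes>\<^bsub>M\<^esub> z)))"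
        unfolding map_map using Cons.prems(2) e z
        by (intro arg_cong[where f = sum_list] map_cong) (auto simp: M.m_assoc entries_monoid_simps(1))
      also have "\<dots> = 0" by (rule Cons.prems(1)) (use e z in \<open>simp add: entries_mult_closed\<close>)
      finally show "(\<Sum>(c, x)\<leftarrow>map (\<lambda>(c, x). (c, x \<otimes>\<^bsub>M\<^esub> rep_entry i j q a)) L. c * tens (x \<otimes>\<^bsub>M\<^esub> z)) = 0" .
    qed (use Cons.prems(2) e xs in \<open>auto simp: entries_mult_closed\<close>)
    then show ?thesis by (simp add: split_def o_def)
  qed
  have "(\<Sum>(c, x)\<leftarrow>L. c * expand x (y # xs)) =
     (\<Sum>(c, x)\<leftarrow>L. c * expand (x \<otimes>\<^bsub>M\<^esub> rep_entry i j j a) xs)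
     - (if j = 1 then 0 else (\<Sum>(c, x)\<leftarrow>L. c * expand (x \<otimes>\<^bsub>M\<^esub> rep_entry i j (j - 1) a) xs))"
    by (auto simp: y split_def right_diff_distrib sum_list_subtractf)
  then show ?case by (simp add: *)
qed

text \<open>Indistinguishability by right factors away from \<open>t\<close>. In this sense
  \<open>p\<close> and the unit agree, by \<open>state_p_mult\<close>.\<close>

definition sim :: "'i \<times> nat \<Rightarrow> ('i, 'a) entries \<Rightarrow> ('i, 'a) entries \<Rightarrow> bool" where
  "sim t x y \<longleftrightarrow> (\<forall>s\<in>sites. s \<noteq> t \<longrightarrow> (\<forall>v\<in>carrier (T (fst s)).
     site_state s (x s \<otimes>\<^bsub>T (fst s)\<^esub> v) = site_state s (y s \<otimes>\<^bsub>T (fst s)\<^esub> v)))"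

section \<open>The effect of one replica on a tensor\<close>

lemma tens_mult_split:
  assumes "x \<in> tensor_entries A" "z \<in> tensor_entries A" "t \<in> sites"
  shows "tens (x \<otimes>\<^bsub>M\<^esub> z) = site_state t (x t \<otimes>\<^bsub>T (fst t)\<^esub> z t) * tens_off t (x \<otimes>\<^bsub>M\<^esub> z)"
  using tens_split[OF entries_mult_closed assms(3)] assms by (simp add: entries_monoid_simps)

lemma tens_off_sim:
  assumes "sim t x y" "z \<in> tensor_entries A"
  shows "tens_off t (x \<otimes>\<^bsub>M\<^esub> z) = tens_off t (y \<otimes>\<^bsub>M\<^esub> z)"
  using assms by (intro tens_off_cong) (simp add: sim_def entries_monoid_simps)

text \<open>Where the projection acts, it separates the old entry from every later factor
  \<open>v\<close>; this is how a block gets closed.\<close>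

lemma rep_site:
  assumes "x \<in> tensor_entries A" "a \<in> carrier (A l)" "s \<in> sites" "v \<in> carrier (T (fst s))"
  shows "site_state s ((x \<otimes>\<^bsub>M\<^esub> rep_entry l j q a) s \<otimes>\<^bsub>T (fst s)\<^esub> v) =
     (if s = (l, j) then site_state s (x s \<otimes>\<^bsub>T (fst s)\<^esub> (tilde_emb (A l) a \<otimes>\<^bsub>T (fst s)\<^esub> v))
      else if fst s \<noteq> l \<and> q \<le> snd s then site_state s (x s) * site_state s v
      else site_state s (x s \<otimes>\<^bsub>T (fst s)\<^esub> v))"
  using assms entry_closed[OF assms(1,3)]
  by (auto simp: entries_monoid_simps rep_entry_def N.TR.m_assoc N.state_mult_p N.emb_closed N.p_closed)

text \<open>The common shape of all moves: one letter turns \<open>x\<close> into a combination of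
  at most two tensors, corresponding to the two summands of 1 = q + p. A move with a single outcome
  takes \<open>d = 0\<close>.\<close>

lemma expand_step:
  assumes "x \<in> tensor_entries A" "y \<in> tensor_entries A" "y' \<in> tensor_entries A"
    and "valid_letters ((j, l, a) # xs)"
    and "\<And>z. z \<in> tensor_entries A \<Longrightarrow> tens (x \<otimes>\<^bsub>M\<^esub> rep_entry l j j a \<otimes>\<^bsub>M\<^esub> z)
      - (if j = 1 then 0 else tens (x \<otimes>\<^bsub>M\<^esub> rep_entry l j (j - 1) a \<otimes>\<^bsub>M\<^esub> z))
      = c * tens (y \<otimes>\<^bsub>M\<^esub> z) + d * tens (y' \<otimes>\<^bsub>M\<^esub> z)"
  shows "expand x ((j, l, a) # xs) = c * expand y xs + d * expand y' xs"
proof -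
  \<comment> \<open>The two terms of the replica and the negated targets form one combination for
    \<open>expand_comb\<close>; the coefficient \<open>0\<close> removes the second term at color
    \<open>1\<close>.\<close>
  define L where "L = [(1, x \<otimes>\<^bsub>M\<^esub> rep_entry l j j a),
    (if j = 1 then 0 else -1, x \<otimes>\<^bsub>M\<^esub> rep_entry l j (j - 1) a), (- c, y), (- d, y')]"
  have "(\<Sum>(c, x)\<leftarrow>L. c * expand x xs) = 0"
  proof (rule expand_comb)
    fix z assume "z \<in> tensor_entries A"
    from assms(5)[OF this] show "(\<Sum>(c, x)\<leftarrow>L. c * tens (x \<otimes>\<^bsub>M\<^esub> z)) = 0"
      by (auto simp: L_def algebra_simps)
  qed (use assms in \<open>auto simp: L_def entries_mult_closed rep_entry_closed\<close>)
  then show ?thesis by (auto simp: L_def algebra_simps)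
qed

lemma tens_kill:
  assumes "x \<in> tensor_entries A" "a \<in> carrier (A l)" "z \<in> tensor_entries A"
    and s: "s \<in> sites" "fst s \<noteq> l" "q \<le> snd s"
    and zero: "x s \<otimes>\<^bsub>T (fst s)\<^esub> tilde_proj (A (fst s)) = \<zero>\<^bsub>T (fst s)\<^esub>"
  shows "tens (x \<otimes>\<^bsub>M\<^esub> rep_entry l j q a \<otimes>\<^bsub>M\<^esub> z) = 0"
proof -
  have "(x \<otimes>\<^bsub>M\<^esub> rep_entry l j q a) s = \<zero>\<^bsub>T (fst s)\<^esub>"
    using s zero by (auto simp: entries_monoid_simps rep_entry_def)
  moreover have "x \<otimes>\<^bsub>M\<^esub> rep_entry l j q a \<in> tensor_entries A"
    using assms by (simp add: entries_mult_closed rep_entry_closed)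
  ultimately show ?thesis
    using assms by (simp add: tens_mult_split[of _ z s] N.state_zero)
qed

text \<open>The last condition records that the entries below the top end in \<open>pp\<close>, in
  the form needed for annihilation. Distinct neighbouring labels ensure that a projection belonging
  to the label of one level does act on the level below.\<close>

definition good_stack :: "('i \<times> ('a letter list \<Rightarrow> complex) set) list \<Rightarrow> bool" where
  "good_stack S \<longleftrightarrow> tilde_stack S \<and> distinct_adj (map fst S) \<and>
     (\<forall>(i, t)\<in>set (tl S). t \<otimes>\<^bsub>T i\<^esub> tilde_proj (A i) = \<zero>\<^bsub>T i\<^esub>)"

text \<open>Among the nontrivial sites the two projections differ only at the top one. The larger
  index spares it; the smaller one puts \<open>p\<close> on it if \<open>l \<noteq> i\<close>, so
  that the difference inserts \<open>pp\<close>. For \<open>l = i\<close> neither touches it and the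
  terms cancel.\<close>

lemma expand_up:
  assumes S: "good_stack ((i, t) # S)" and xs: "valid_letters ((length S + 2, l, a) # xs)"
  shows "expand (ent ((i, t) # S)) ((length S + 2, l, a) # xs) =
    (if l = i then 0 else expand (ent ((l, tilde_emb (A l) a) # (i, t \<otimes>\<^bsub>T i\<^esub> N.pp i) # S)) xs)"
proof -
  let ?x = "ent ((i, t) # S)" and ?y = "ent ((l, tilde_emb (A l) a) # (i, t \<otimes>\<^bsub>T i\<^esub> N.pp i) # S)"
  let ?j = "length S + 2" and ?s = "(i, length S + 1)"
  let ?x1 = "?x \<otimes>\<^bsub>M\<^esub> rep_entry l ?j ?j a" and ?x2 = "?x \<otimes>\<^bsub>M\<^esub> rep_entry l ?j (length S + 1) a"
  have a: "a \<in> carrier (A l)" and t: "t \<in> carrier (T i)" and st: "tilde_stack S"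
    using S xs by (auto simp: good_stack_def)
  have x: "?x \<in> tensor_entries A" and y: "?y \<in> tensor_entries A"
    using S a by (auto simp: good_stack_def N.emb_closed N.pp_closed intro!: ent_closed)
  have s: "?s \<in> sites" by (simp add: sites_def)
  have x12: "?x1 \<in> tensor_entries A" "?x2 \<in> tensor_entries A"
    using x a by (auto intro!: entries_mult_closed rep_entry_closed)
  have sim: "sim ?s ?x1 ?y" "sim ?s ?x2 ?y"
    unfolding sim_def using x a st
    by (auto simp: rep_site ent_def look_beyond look_closed N.emb_closed)
  have val: "site_state ?s (?x1 ?s \<otimes>\<^bsub>T i\<^esub> v) = N.state i (t \<otimes>\<^bsub>T i\<^esub> v)"
     "site_state ?s (?x2 ?s \<otimes>\<^bsub>T i\<^esub> v) = (if l = i then N.state i (t \<otimes>\<^bsub>T i\<^esub> v) else N.state i t * N.state i v)"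
     "site_state ?s (?y ?s \<otimes>\<^bsub>T i\<^esub> v) = N.state i (t \<otimes>\<^bsub>T i\<^esub> v) - N.state i t * N.state i v"
    if "v \<in> carrier (T i)" for v
    using x a s t that rep_site[OF x a s, of v]
    by (auto simp: ent_def N.TR.m_assoc N.pp_closed N.state_mult_pp)
  have "expand ?x ((?j, l, a) # xs) = (if l = i then 0 else 1) * expand ?y xs + 0 * expand ?y xs"
  proof (rule expand_step[OF x y y xs])
    fix z assume z: "z \<in> tensor_entries A"
    have zs: "z ?s \<in> carrier (T i)" using entry_closed[OF z s] by simp
    show "tens (?x \<otimes>\<^bsub>M\<^esub> rep_entry l ?j ?j a \<otimes>\<^bsub>M\<^esub> z) -
         (if ?j = 1 then 0 else tens (?x \<otimes>\<^bsub>M\<^esub> rep_entry l ?j (?j - 1) a \<otimes>\<^bsub>M\<^esub> z)) =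
         (if l = i then 0 else 1) * tens (?y \<otimes>\<^bsub>M\<^esub> z) + 0 * tens (?y \<otimes>\<^bsub>M\<^esub> z)"
    proof -
      define K where "K = tens_off ?s (?y \<otimes>\<^bsub>M\<^esub> z)"
      have "tens (?x1 \<otimes>\<^bsub>M\<^esub> z) = N.state i (t \<otimes>\<^bsub>T i\<^esub> z ?s) * K"
        using tens_mult_split[OF x12(1) z s] tens_off_sim[OF sim(1) z] val(1)[OF zs] by (simp add: K_def)
      moreover have "tens (?x2 \<otimes>\<^bsub>M\<^esub> z)
        = (if l = i then N.state i (t \<otimes>\<^bsub>T i\<^esub> z ?s) else N.state i t * N.state i (z ?s)) * K"
        using tens_mult_split[OF x12(2) z s] tens_off_sim[OF sim(2) z] val(2)[OF zs] by (simp add: K_def)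
      moreover have "tens (?y \<otimes>\<^bsub>M\<^esub> z)
        = (N.state i (t \<otimes>\<^bsub>T i\<^esub> z ?s) - N.state i t * N.state i (z ?s)) * K"
        using tens_mult_split[OF y z s] val(3)[OF zs] by (simp add: K_def)
      ultimately show ?thesis by (simp add: algebra_simps)
    qed
  qed
  then show ?thesis by simp
qed

text \<open>For \<open>l \<noteq> i\<close> the projection closes the top block. For
  \<open>l = i\<close> it spares the top site, where \<open>state_mult_pp\<close> splits the
  undisturbed product into the prolonged block and the closed one. The smaller projection also
  reaches the level below, and this decides about the second term of the replica.\<close>

lemma expand_flat:
  assumes S: "good_stack ((i, t) # S)" and xs: "valid_letters ((length S + 1, l, a) # xs)"
  shows "expand (ent ((i, t) # S)) ((length S + 1, l, a) # xs) =
    (if l = i then expand (ent ((i, t \<otimes>\<^bsub>T i\<^esub> N.pp i \<otimes>\<^bsub>T i\<^esub> tilde_emb (A i) a) # S)) xs else 0) +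
    (if S \<noteq> [] \<and> l = fst (hd S) then 0
     else N.state i t * expand (ent ((l, tilde_emb (A l) a) # S)) xs)"
proof -
  let ?x = "ent ((i, t) # S)" and ?y2 = "ent ((l, tilde_emb (A l) a) # S)"
  let ?j = "length S + 1" and ?s = "(i, length S + 1)"
  let ?x1 = "?x \<otimes>\<^bsub>M\<^esub> rep_entry l ?j ?j a" and ?x2 = "?x \<otimes>\<^bsub>M\<^esub> rep_entry l ?j (length S) a"
  have a: "a \<in> carrier (A l)" and t: "t \<in> carrier (T i)" and st: "tilde_stack S"
    using S xs by (auto simp: good_stack_def)
  have x: "?x \<in> tensor_entries A" and y2: "?y2 \<in> tensor_entries A"
    using S a by (auto simp: good_stack_def N.emb_closed intro!: ent_closed)
  have s: "?s \<in> sites" by (simp add: sites_def)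
  have x12: "?x1 \<in> tensor_entries A" "?x2 \<in> tensor_entries A"
    using x a by (auto intro!: entries_mult_closed rep_entry_closed)
  have sim: "sim ?s ?x1 ?y2"
    unfolding sim_def using x a st
    by (auto simp: rep_site ent_def look_beyond look_closed N.emb_closed)
  show ?thesis
  proof (cases "l = i")
    case True
    let ?y1 = "ent ((i, t \<otimes>\<^bsub>T i\<^esub> N.pp i \<otimes>\<^bsub>T i\<^esub> tilde_emb (A i) a) # S)"
    have y1: "?y1 \<in> tensor_entries A"
      using S a True by (auto simp: good_stack_def N.emb_closed N.pp_closed intro!: ent_closed)
    have sim1: "sim ?s ?x1 ?y1"
      unfolding sim_def using x a st True
      by (auto simp: rep_site ent_def look_beyond look_closed)
    have val: "site_state ?s (?x1 ?s \<otimes>\<^bsub>T i\<^esub> v) = N.state i (t \<otimes>\<^bsub>T i\<^esub> (tilde_emb (A i) a \<otimes>\<^bsub>T i\<^esub> v))"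
     "site_state ?s (?y1 ?s \<otimes>\<^bsub>T i\<^esub> v) = N.state i (t \<otimes>\<^bsub>T i\<^esub> (tilde_emb (A i) a \<otimes>\<^bsub>T i\<^esub> v))
        - N.state i t * N.state i (tilde_emb (A i) a \<otimes>\<^bsub>T i\<^esub> v)"
     "site_state ?s (?y2 ?s \<otimes>\<^bsub>T i\<^esub> v) = N.state i (tilde_emb (A i) a \<otimes>\<^bsub>T i\<^esub> v)"
      if "v \<in> carrier (T i)" for v
      using x a s t that rep_site[OF x a s, of v] True
      by (auto simp: ent_def N.TR.m_assoc N.pp_closed N.state_mult_pp N.emb_closed)
    \<comment> \<open>The label \<open>l = i\<close> differs from the one below, so the smaller
      projection meets an entry ending in \<open>pp\<close>.\<close>
    have kill: "tens (?x2 \<otimes>\<^bsub>M\<^esub> z) = 0" if z: "z \<in> tensor_entries A" and ne: "S \<noteq> []" for z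
    proof -
      obtain i2 t2 S2 where S2: "S = (i2, t2) # S2" using ne by (cases S) auto
      show ?thesis
        by (rule tens_kill[where s = "(i2, length S)"])
          (use x a z S True in \<open>auto simp: S2 sites_def ent_def good_stack_def\<close>)
    qed
    have "expand ?x ((?j, l, a) # xs) = 1 * expand ?y1 xs + N.state i t * expand ?y2 xs"
    proof (rule expand_step[OF x y1 y2 xs])
      fix z assume z: "z \<in> tensor_entries A"
      have zs: "z ?s \<in> carrier (T i)" using entry_closed[OF z s] by simp
      have "(if ?j = 1 then 0 else tens (?x \<otimes>\<^bsub>M\<^esub> rep_entry l ?j (?j - 1) a \<otimes>\<^bsub>M\<^esub> z)) = 0"
        using kill[OF z] by auto
      moreover have "tens (?x1 \<otimes>\<^bsub>M\<^esub> z) = tens (?y1 \<otimes>\<^bsub>M\<^esub> z) + N.state i t * tens (?y2 \<otimes>\<^bsub>M\<^esub> z)"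
        unfolding tens_mult_split[OF x12(1) z s] tens_mult_split[OF y1 z s] tens_mult_split[OF y2 z s]
          tens_off_sim[OF sim z] tens_off_sim[OF sim1 z, symmetric]
        using val[OF zs] by (simp add: left_diff_distrib)
      ultimately show "tens (?x \<otimes>\<^bsub>M\<^esub> rep_entry l ?j ?j a \<otimes>\<^bsub>M\<^esub> z) -
         (if ?j = 1 then 0 else tens (?x \<otimes>\<^bsub>M\<^esub> rep_entry l ?j (?j - 1) a \<otimes>\<^bsub>M\<^esub> z)) =
         1 * tens (?y1 \<otimes>\<^bsub>M\<^esub> z) + N.state i t * tens (?y2 \<otimes>\<^bsub>M\<^esub> z)"
        by simp
    qed
    moreover have "\<not> (S \<noteq> [] \<and> l = fst (hd S))"
      using S True by (cases S) (auto simp: good_stack_def)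
    ultimately show ?thesis using True by auto
  next
    case False
    have val: "site_state ?s (?x1 ?s \<otimes>\<^bsub>T i\<^esub> v) = N.state i t * N.state i v"
     "site_state ?s (?x2 ?s \<otimes>\<^bsub>T i\<^esub> v) = N.state i t * N.state i v"
     "site_state ?s (?y2 ?s \<otimes>\<^bsub>T i\<^esub> v) = N.state i v"
      if "v \<in> carrier (T i)" for v
      using x a s t that rep_site[OF x a s, of v] False
      by (auto simp: ent_def)
    \<comment> \<open>If \<open>l\<close> is the label below, the smaller projection spares that
      level, both terms coincide and they cancel; for any other \<open>l\<close> the second term is
      annihilated there.\<close>
    have x2: "tens (?x2 \<otimes>\<^bsub>M\<^esub> z) = (if l = fst (hd S) then tens (?x1 \<otimes>\<^bsub>M\<^esub> z) else 0)"
      if z: "z \<in> tensor_entries A" and ne: "S \<noteq> []" for z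
    proof -
      obtain i2 t2 S2 where S2: "S = (i2, t2) # S2" using ne by (cases S) auto
      show ?thesis
      proof (cases "l = i2")
        case True
        have "sim ?s ?x2 ?x1"
          unfolding sim_def using x a st True False
          by (auto simp: rep_site ent_def look_beyond look_closed S2)
        then show ?thesis
          using tens_mult_split[OF x12(1) z s] tens_mult_split[OF x12(2) z s] True
            tens_off_sim[OF _ z] val entry_closed[OF z s] by (simp add: S2)
      next
        case l: False
        have "tens (?x2 \<otimes>\<^bsub>M\<^esub> z) = 0"
          by (rule tens_kill[where s = "(i2, length S)"])
            (use x a z S l in \<open>auto simp: S2 sites_def ent_def good_stack_def\<close>)
        then show ?thesis using l by (simp add: S2)
      qed
    qed
    have "expand ?x ((?j, l, a) # xs) =
      (if S \<noteq> [] \<and> l = fst (hd S) then 0 else N.state i t) * expand ?y2 xs + 0 * expand ?y2 xs"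
    proof (rule expand_step[OF x y2 y2 xs])
      fix z assume z: "z \<in> tensor_entries A"
      have zs: "z ?s \<in> carrier (T i)" using entry_closed[OF z s] by simp
      have x1: "tens (?x1 \<otimes>\<^bsub>M\<^esub> z) = N.state i t * tens (?y2 \<otimes>\<^bsub>M\<^esub> z)"
        using tens_mult_split[OF x12(1) z s] tens_mult_split[OF y2 z s] tens_off_sim[OF sim z] val[OF zs]
        by simp
      show "tens (?x \<otimes>\<^bsub>M\<^esub> rep_entry l ?j ?j a \<otimes>\<^bsub>M\<^esub> z) -
         (if ?j = 1 then 0 else tens (?x \<otimes>\<^bsub>M\<^esub> rep_entry l ?j (?j - 1) a \<otimes>\<^bsub>M\<^esub> z)) =
         (if S \<noteq> [] \<and> l = fst (hd S) then 0 else N.state i t) * tens (?y2 \<otimes>\<^bsub>M\<^esub> z) + 0 * tens (?y2 \<otimes>\<^bsub>M\<^esub> z)"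
        using x1 x2[OF z] by (cases "S = []") auto
    qed
    then show ?thesis using False by auto
  qed
qed

text \<open>The entry \<open>t2\<close> ends in \<open>pp\<close>. Unless \<open>l\<close> is its
  label, both projections put \<open>p\<close> there and both terms vanish. If it is, the larger
  index closes the top block, whose label differs, and the second term is annihilated one level
  further down, or is absent at color \<open>1\<close>.\<close>

lemma expand_down:
  assumes S: "good_stack ((i, t) # (i2, t2) # S)" and xs: "valid_letters ((length S + 1, l, a) # xs)"
  shows "expand (ent ((i, t) # (i2, t2) # S)) ((length S + 1, l, a) # xs) =
    (if l = i2 then N.state i t * expand (ent ((i2, t2 \<otimes>\<^bsub>T i2\<^esub> tilde_emb (A i2) a) # S)) xs else 0)"
proof -
  let ?x = "ent ((i, t) # (i2, t2) # S)"
  let ?j = "length S + 1" and ?s = "(i, length S + 2)"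
  let ?x1 = "?x \<otimes>\<^bsub>M\<^esub> rep_entry l ?j ?j a" and ?x2 = "?x \<otimes>\<^bsub>M\<^esub> rep_entry l ?j (length S) a"
  have a: "a \<in> carrier (A l)" and t: "t \<in> carrier (T i)" and st: "tilde_stack S"
    and t2: "t2 \<in> carrier (T i2)"
    using S xs by (auto simp: good_stack_def)
  have x: "?x \<in> tensor_entries A"
    using S a by (auto simp: good_stack_def N.emb_closed intro!: ent_closed)
  have s: "?s \<in> sites" by (simp add: sites_def)
  have x12: "?x1 \<in> tensor_entries A" "?x2 \<in> tensor_entries A"
    using x a by (auto intro!: entries_mult_closed rep_entry_closed)
  show ?thesis
  proof (cases "l = i2")
    case True
    let ?y = "ent ((i2, t2 \<otimes>\<^bsub>T i2\<^esub> tilde_emb (A i2) a) # S)"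
    have i: "i \<noteq> i2" using S by (auto simp: good_stack_def)
    have y: "?y \<in> tensor_entries A"
      using S a True by (auto simp: good_stack_def N.emb_closed intro!: ent_closed)
    have sim: "sim ?s ?x1 ?y"
      unfolding sim_def using x a st t2 True
      by (auto simp: rep_site ent_def look_beyond look_closed N.TR.m_assoc N.emb_closed)
    have val: "site_state ?s (?x1 ?s \<otimes>\<^bsub>T i\<^esub> v) = N.state i t * N.state i v"
     "site_state ?s (?y ?s \<otimes>\<^bsub>T i\<^esub> v) = N.state i v"
      if "v \<in> carrier (T i)" for v
      using x a s t that rep_site[OF x a s, of v] i True
      by (auto simp: ent_def look_beyond)
    have kill: "tens (?x2 \<otimes>\<^bsub>M\<^esub> z) = 0" if z: "z \<in> tensor_entries A" and ne: "S \<noteq> []" for z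
    proof -
      obtain i3 t3 S3 where S3: "S = (i3, t3) # S3" using ne by (cases S) auto
      show ?thesis
        by (rule tens_kill[where s = "(i3, length S)"])
          (use x a z S True in \<open>auto simp: S3 sites_def ent_def good_stack_def\<close>)
    qed
    have "expand ?x ((?j, l, a) # xs) = N.state i t * expand ?y xs + 0 * expand ?y xs"
    proof (rule expand_step[OF x y y xs])
      fix z assume z: "z \<in> tensor_entries A"
      have zs: "z ?s \<in> carrier (T i)" using entry_closed[OF z s] by simp
      have "(if ?j = 1 then 0 else tens (?x \<otimes>\<^bsub>M\<^esub> rep_entry l ?j (?j - 1) a \<otimes>\<^bsub>M\<^esub> z)) = 0"
        using kill[OF z] by auto
      then show "tens (?x \<otimes>\<^bsub>M\<^esub> rep_entry l ?j ?j a \<otimes>\<^bsub>M\<^esub> z) -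
         (if ?j = 1 then 0 else tens (?x \<otimes>\<^bsub>M\<^esub> rep_entry l ?j (?j - 1) a \<otimes>\<^bsub>M\<^esub> z)) =
         N.state i t * tens (?y \<otimes>\<^bsub>M\<^esub> z) + 0 * tens (?y \<otimes>\<^bsub>M\<^esub> z)"
        using tens_mult_split[OF x12(1) z s] tens_mult_split[OF y z s]
          tens_off_sim[OF sim z] val[OF zs]
        by simp
    qed
    then show ?thesis using True by auto
  next
    case False
    have kill: "tens (?x \<otimes>\<^bsub>M\<^esub> rep_entry l ?j q a \<otimes>\<^bsub>M\<^esub> z) = 0"
      if z: "z \<in> tensor_entries A" and q: "q \<le> ?j" for z q
      by (rule tens_kill[where s = "(i2, ?j)"])
        (use x a z S False q in \<open>auto simp: sites_def ent_def good_stack_def\<close>)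
    have "expand ?x ((?j, l, a) # xs) = 0 * expand ?x xs + 0 * expand ?x xs"
      by (rule expand_step[OF x x x xs]) (use kill[of _ ?j] kill[of _ "length S"] in simp)
    then show ?thesis using False by simp
  qed
qed

section \<open>Agreement of the expansion with the stack evaluation\<close>

definition open_stack :: "('i \<times> 'a list) list \<Rightarrow> bool" where
  "open_stack S \<longleftrightarrow> distinct_adj (map fst S) \<and> (\<forall>(i, u)\<in>set S. u \<noteq> [] \<and> set u \<subseteq> carrier (A i))"

text \<open>A block receives its trailing \<open>pp\<close> when the path rises above it, so the top
  block is the only one without it.\<close>

fun lift_stack :: "('i \<times> 'a list) list \<Rightarrow> ('i \<times> ('a letter list \<Rightarrow> complex) set) list" where
  "lift_stack [] = []"
| "lift_stack ((i, u) # S) = (i, N.perp_prod i u) # map (\<lambda>(i, u). (i, N.perp_prod i u \<otimes>\<^bsub>T i\<^esub> N.pp i)) S"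

lemma good_lift_stack:
  assumes "open_stack S"
  shows "good_stack (lift_stack S)"
proof (cases S)
  case (Cons y S')
  obtain i u where y: "y = (i, u)" by (cases y)
  have "map fst (lift_stack S) = map fst S" by (simp add: Cons y case_prod_beta)
  then have "distinct_adj (map fst (lift_stack S))" using assms by (simp add: open_stack_def)
  moreover have "tilde_stack (lift_stack S)"
    using assms by (auto simp: tilde_stack_def open_stack_def Cons y N.pp_closed N.perp_prod_closed)
  moreover have "\<forall>(i, t)\<in>set (tl (lift_stack S)). t \<otimes>\<^bsub>T i\<^esub> tilde_proj (A i) = \<zero>\<^bsub>T i\<^esub>"
    using assms by (auto simp: open_stack_def Cons y N.mult_pp_p N.perp_prod_closed)
  ultimately show ?thesis by (simp add: good_stack_def)
qed (simp add: good_stack_def)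

definition block_weight :: "'i \<Rightarrow> 'a list \<Rightarrow> complex" where
  "block_weight i u = N.state i (N.perp_prod i u)"

lemma expand_run:
  assumes "open_stack S" "S \<noteq> []" "valid_letters xs" "admissible (length S) xs"
  shows "expand (ent (lift_stack S)) xs = run block_weight S xs"
  using assms
proof (induction xs arbitrary: S)
  case Nil
  obtain i u S' where S: "S = (i, u) # S'" using Nil by (cases S) auto
  have good: "good_stack (lift_stack S)" using Nil good_lift_stack by simp
  then have E: "ent (lift_stack S) \<in> tensor_entries A" by (simp add: good_stack_def ent_closed)
  show ?case
  proof (cases S')
    case Nil
    have "tens (ent (lift_stack S)) = N.state i (N.perp_prod i u) * tens_off (i, 1) (ent (lift_stack S))"
      by (subst tens_split[OF E, of "(i, 1)"]) (auto simp: sites_def S Nil ent_def)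
    also have "tens_off (i, 1) (ent (lift_stack S)) = tens_off (i, 1) \<one>\<^bsub>M\<^esub>"
      by (rule tens_off_cong) (auto simp: ent_def S Nil entries_monoid_simps)
    also have "\<dots> = 1"
      by (simp add: tens_off_def entries_monoid_simps)
    finally show ?thesis by (simp add: S Nil block_weight_def)
  next
    case (Cons y S2)
    obtain i2 u2 where y: "y = (i2, u2)" by (cases y)
    have u2: "N.perp_prod i2 u2 \<in> carrier (T i2)"
      using Nil.prems by (auto simp: open_stack_def S Cons y N.perp_prod_closed)
    \<comment> \<open>An entry ending in \<open>pp\<close> has state zero: a word that stops above
      level \<open>1\<close> contributes nothing, which is the default value of
      \<open>run\<close>.\<close>
    have "N.state i2 (N.perp_prod i2 u2 \<otimes>\<^bsub>T i2\<^esub> N.pp i2) = 0"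
      using N.state_mult_pp[OF u2 N.TR.one_closed] u2 by (simp add: N.pp_closed)
    then have "tens (ent (lift_stack S)) = 0"
      by (subst tens_split[OF E, of "(i2, length S2 + 1)"])
        (auto simp: sites_def S Cons y ent_def)
    then show ?thesis by (simp add: S Cons y)
  qed
next
  case (Cons x xs)
  obtain j l a where x: "x = (j, l, a)" by (cases x)
  obtain i u S' where S: "S = (i, u) # S'" using Cons.prems by (cases S) auto
  let ?L = "map (\<lambda>(i, u). (i, N.perp_prod i u \<otimes>\<^bsub>T i\<^esub> N.pp i)) S'"
  have good: "good_stack ((i, N.perp_prod i u) # ?L)"
    using good_lift_stack[OF Cons.prems(1)] by (simp add: S)
  have u: "u \<noteq> []" and a: "a \<in> carrier (A l)" and xs: "valid_letters xs"
    and adm: "admissible j xs" and j: "1 \<le> j" "length S' \<le> j" "j \<le> length S' + 2"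
    using Cons.prems by (auto simp: S x open_stack_def)
  have hdL: "?L \<noteq> [] \<and> l = fst (hd ?L) \<longleftrightarrow> S' \<noteq> [] \<and> l = fst (hd S')"
    by (cases S') auto
  consider "j = length S' + 2" | "j = length S' + 1" | "j = length S'" "S' \<noteq> []"
    using j by (cases S') fastforce+
  then show ?case
  proof cases
    case 1
    have "open_stack ((l, [a]) # S)" if "l \<noteq> i"
      using that Cons.prems(1) a by (auto simp: open_stack_def S)
    then show ?thesis
      using expand_up[OF good, of l a xs] Cons.IH[of "(l, [a]) # S"] Cons.prems(3) adm 1
      by (auto simp: x S xs)
  next
    case 2
    have 1: "open_stack ((i, u @ [a]) # S')" if "l = i"
      using that Cons.prems(1) a by (cases S') (auto simp: open_stack_def S)
    have 2: "open_stack ((l, [a]) # S')" if "\<not> (S' \<noteq> [] \<and> l = fst (hd S'))"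
      using that Cons.prems(1) a by (cases S') (auto simp: open_stack_def S)
    show ?thesis
      using expand_flat[OF good, of l a xs] Cons.IH[OF 1] Cons.IH[OF 2] Cons.prems(3) adm \<open>j = length S' + 1\<close>
      unfolding hdL
      by (auto simp: x S xs u N.perp_prod_snoc block_weight_def)
  next
    case 3
    obtain i2 u2 S2 where S2: "S' = (i2, u2) # S2" using 3 by (cases S') auto
    have u2: "u2 \<noteq> []" using Cons.prems by (auto simp: S S2 open_stack_def)
    have 1: "open_stack ((i2, u2 @ [a]) # S2)" if "l = i2"
      using that Cons.prems(1) a by (cases S2) (auto simp: open_stack_def S S2)
    show ?thesis
      using expand_down[OF good[unfolded S2, simplified], of l a xs] Cons.IH[OF 1] Cons.prems(3) adm 3
      by (auto simp: x S S2 xs u2 N.perp_prod_snoc block_weight_def)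
  qed
qed

text \<open>Color \<open>1\<close> involves one projection only, and it acts at sites holding units,
  where \<open>p\<close> cannot be told from the unit by right factors.\<close>

lemma expand_run_start:
  assumes "valid_letters ((1, i, a) # xs)" "admissible 1 xs"
  shows "expand \<one>\<^bsub>M\<^esub> ((1, i, a) # xs) = run block_weight [(i, [a])] xs"
proof -
  have a: "a \<in> carrier (A i)" using assms by simp
  have st: "open_stack [(i, [a])]" using a by (simp add: open_stack_def)
  have E: "ent (lift_stack [(i, [a])]) \<in> tensor_entries A"
    using good_lift_stack[OF st] by (simp add: good_stack_def ent_closed)
  have r: "rep_entry i 1 1 a \<in> tensor_entries A" using a by (rule rep_entry_closed)
  have s: "(i, 1) \<in> sites" by (simp add: sites_def)
  have "expand \<one>\<^bsub>M\<^esub> ((1, i, a) # xs) = 1 * expand (ent (lift_stack [(i, [a])])) xs + 0 * expand \<one>\<^bsub>M\<^esub> xs"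
  proof (rule expand_step[OF entries_one E entries_one assms(1)])
    fix z assume z: "z \<in> tensor_entries A"
    have sim: "sim (i, 1) (rep_entry i 1 1 a) (ent (lift_stack [(i, [a])]))"
      by (auto simp: sim_def ent_def rep_entry_def N.state_p_mult)
    have "tens (rep_entry i 1 1 a \<otimes>\<^bsub>M\<^esub> z) = tens (ent (lift_stack [(i, [a])]) \<otimes>\<^bsub>M\<^esub> z)"
      using tens_mult_split[OF r z s] tens_mult_split[OF E z s] tens_off_sim[OF sim z] s
      by (simp add: ent_def rep_entry_def)
    then show "tens (\<one>\<^bsub>M\<^esub> \<otimes>\<^bsub>M\<^esub> rep_entry i 1 1 a \<otimes>\<^bsub>M\<^esub> z)
      - (if (1 :: nat) = 1 then 0 else tens (\<one>\<^bsub>M\<^esub> \<otimes>\<^bsub>M\<^esub> rep_entry i 1 (1 - 1) a \<otimes>\<^bsub>M\<^esub> z))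
      = 1 * tens (ent (lift_stack [(i, [a])]) \<otimes>\<^bsub>M\<^esub> z) + 0 * tens (\<one>\<^bsub>M\<^esub> \<otimes>\<^bsub>M\<^esub> z)"
      using r by (simp add: entries_monoid_simps(1))
  qed
  then show ?thesis
    using expand_run[OF st, of xs] assms by simp
qed

end

section \<open>Partitions adapted to an initial segment of a path\<close>

text \<open>Two visits of the path to one level, separated by an excursion strictly above it. The
  excursion is empty for adjacent positions.\<close>

definition link :: "nat list \<Rightarrow> nat \<Rightarrow> nat \<Rightarrow> bool" where
  "link w k l \<longleftrightarrow> k < l \<and> w ! k = w ! l \<and> (\<forall>r. k < r \<and> r < l \<longrightarrow> w ! k < w ! r)"

text \<open>Seen from \<open>r\<close>, the position \<open>k\<close> is the latest one on the next
  lower level. It marks the block directly below that of \<open>r\<close> without any reference to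
  blocks.\<close>

definition nested_in :: "nat list \<Rightarrow> nat \<Rightarrow> nat \<Rightarrow> bool" where
  "nested_in w k r \<longleftrightarrow> k < r \<and> w ! r = Suc (w ! k) \<and> (\<forall>s. k < s \<and> s \<le> r \<longrightarrow> w ! k < w ! s)"

text \<open>
  For a Motzkin word and \<open>n\<close> its length, the following describes the labeled partitions without mentioning
  depth. It also makes sense for proper initial segments, so that partitions can be built letter by letter.
\<close>

definition adapted_upto :: "nat list \<Rightarrow> 'i list \<Rightarrow> nat \<Rightarrow> nat set set \<Rightarrow> bool" where
  "adapted_upto w ls n P \<longleftrightarrow> partition_on {..<n} P \<and>
     (\<forall>V\<in>P. \<forall>k\<in>V. \<forall>l\<in>V. ls ! k = ls ! l \<and> w ! k = w ! l) \<and>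
     (\<forall>V\<in>P. \<forall>k\<in>V. \<forall>l\<in>V. \<forall>r. k < r \<and> r < l \<longrightarrow> w ! k < w ! r \<or> w ! k = w ! r \<and> r \<in> V) \<and>
     (\<forall>k l. link w k l \<and> k + 1 < l \<and> l < n \<longrightarrow> (\<exists>V\<in>P. k \<in> V \<and> l \<in> V)) \<and>
     (\<forall>k r. nested_in w k r \<and> r < n \<longrightarrow> ls ! k \<noteq> ls ! r)"

lemma
  assumes "adapted_upto w ls n P"
  shows adapted_partition: "partition_on {..<n} P"
    and adapted_const: "V \<in> P \<Longrightarrow> k \<in> V \<Longrightarrow> l \<in> V \<Longrightarrow> ls ! k = ls ! l \<and> w ! k = w ! l"
    and adapted_between: "V \<in> P \<Longrightarrow> k \<in> V \<Longrightarrow> l \<in> V \<Longrightarrow> k < r \<Longrightarrow> r < l \<Longrightarrow>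
      w ! k < w ! r \<or> w ! k = w ! r \<and> r \<in> V"
    and adapted_link: "link w k l \<Longrightarrow> k + 1 < l \<Longrightarrow> l < n \<Longrightarrow> \<exists>V\<in>P. k \<in> V \<and> l \<in> V"
    and adapted_nested: "nested_in w k r \<Longrightarrow> r < n \<Longrightarrow> ls ! k \<noteq> ls ! r"
  using assms unfolding adapted_upto_def by blast+

section \<open>Restricting a partition to an initial segment\<close>

lemma partition_same_block:
  "partition_on A P \<Longrightarrow> V \<in> P \<Longrightarrow> W \<in> P \<Longrightarrow> x \<in> V \<Longrightarrow> x \<in> W \<Longrightarrow> V = W"
  by (auto simp: partition_on_def disjoint_def)

lemma partition_lessThan_block:
  assumes "partition_on {..<n :: nat} P" "V \<in> P"
  shows "V \<noteq> {}" "finite V" "V \<subseteq> {..<n}" "Max V \<in> V" "Max V < n"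
proof -
  show ne: "V \<noteq> {}" and sub: "V \<subseteq> {..<n}" using assms by (auto simp: partition_on_def)
  then show fin: "finite V" using finite_subset by blast
  show "Max V \<in> V" using ne fin by simp
  then show "Max V < n" using sub by auto
qed

lemma partition_lessThan_finite:
  assumes "partition_on {..<n :: nat} P"
  shows "finite P"
  using assms by (intro finite_elements[of "{..<n}"]) auto

text \<open>The restrictions of a partition to initial segments are its history, the stages through
  which the stack evaluation passes.\<close>

definition trim :: "nat \<Rightarrow> nat set set \<Rightarrow> nat set set" where
  "trim n P = (\<lambda>V. V \<inter> {..<n}) ` P - {{}}"

lemma trim_iff: "X \<in> trim n P \<longleftrightarrow> X \<noteq> {} \<and> (\<exists>V\<in>P. X = V \<inter> {..<n})"
  by (auto simp: trim_def)

lemma trim_trim: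
  assumes "m \<le> n"
  shows "trim m (trim n P) = trim m P"
proof (rule Set.set_eqI)
  fix X
  have eq: "V \<inter> {..<n} \<inter> {..<m} = V \<inter> {..<m}" for V :: "nat set"
    using assms by auto
  show "X \<in> trim m (trim n P) \<longleftrightarrow> X \<in> trim m P"
  proof
    assume "X \<in> trim m (trim n P)"
    then obtain W where W: "X \<noteq> {}" "W \<in> trim n P" "X = W \<inter> {..<m}"
      using trim_iff[of X] by blast
    then obtain V where "V \<in> P" "W = V \<inter> {..<n}"
      using trim_iff[of W] by blast
    then show "X \<in> trim m P" using W eq trim_iff[of X] by blast
  next
    assume "X \<in> trim m P"
    then obtain V where V: "X \<noteq> {}" "V \<in> P" "X = V \<inter> {..<m}"
      using trim_iff[of X] by blast
    then have "V \<inter> {..<n} \<in> trim n P" using eq[of V] trim_iff[of "V \<inter> {..<n}"] by blast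
    then show "X \<in> trim m (trim n P)" using V eq[of V] trim_iff[of X] by blast
  qed
qed

lemma trim_self:
  assumes "partition_on {..<n} P"
  shows "trim n P = P"
proof -
  have "V \<inter> {..<n} = V" "V \<noteq> {}" if "V \<in> P" for V
    using that assms by (auto simp: partition_on_def)
  then show ?thesis by (intro Set.set_eqI) (metis trim_iff)
qed

lemma trim_insert_new:
  assumes "partition_on {..<n} Q"
  shows "trim n (insert {n} Q) = Q"
  using trim_self[OF assms] by (auto simp: trim_def)

abbreviation extend_block :: "nat \<Rightarrow> nat set set \<Rightarrow> nat set \<Rightarrow> nat set set" where
  "extend_block n Q U \<equiv> insert (insert n U) (Q - {U})"

lemma trim_extend_block:
  assumes Q: "partition_on {..<n} Q" and U: "U \<in> Q"
  shows "trim n (extend_block n Q U) = Q"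
proof -
  have "V \<inter> {..<n} = V" "V \<noteq> {}" if "V \<in> Q" for V
    using partition_lessThan_block[OF Q that] by auto
  then have "(\<lambda>V. V \<inter> {..<n}) ` (Q - {U}) = Q - {U}" "insert n U \<inter> {..<n} = U" "{} \<notin> Q"
    using U by (auto simp: image_iff)
  then show ?thesis using U by (auto simp: trim_def)
qed

lemma trim_Suc:
  assumes P: "partition_on {..<N} P" and n: "n < N" and U: "U \<in> P" "n \<in> U"
  shows "trim (Suc n) P = (if U \<inter> {..<n} = {} then insert {n} (trim n P)
    else extend_block n (trim n P) (U \<inter> {..<n}))"
proof -
  have nU: "W \<inter> {..<Suc n} = W \<inter> {..<n}" "W \<inter> {..<n} \<inter> U = {}" if "W \<in> P - {U}" for W
  proof -
    have "W \<inter> U = {}" using that U P by (auto simp: partition_on_def disjoint_def)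
    then show "W \<inter> {..<Suc n} = W \<inter> {..<n}" "W \<inter> {..<n} \<inter> U = {}" using U by (auto simp: less_Suc_eq)
  qed
  define R where "R = (\<lambda>V. V \<inter> {..<n}) ` (P - {U}) - {{}}"
  have P_eq: "P = insert U (P - {U})" using U by auto
  have Un: "U \<inter> {..<Suc n} = insert n (U \<inter> {..<n})" using U by auto
  have "trim (Suc n) P = insert (U \<inter> {..<Suc n}) ((\<lambda>V. V \<inter> {..<Suc n}) ` (P - {U})) - {{}}"
    unfolding trim_def by (subst P_eq) blast
  also have "(\<lambda>V. V \<inter> {..<Suc n}) ` (P - {U}) = (\<lambda>V. V \<inter> {..<n}) ` (P - {U})"
    using nU by (intro image_cong) auto
  also have "insert (U \<inter> {..<Suc n}) \<dots> - {{}} = insert (insert n (U \<inter> {..<n})) R"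
    unfolding Un R_def by auto
  finally have 1: "trim (Suc n) P = insert (insert n (U \<inter> {..<n})) R" .
  have 2: "trim n P = insert (U \<inter> {..<n}) ((\<lambda>V. V \<inter> {..<n}) ` (P - {U})) - {{}}"
    unfolding trim_def by (subst P_eq) blast
  \<comment> \<open>Since the trace of \<open>U\<close> is not in \<open>R\<close>, deleting it from
    the restricted partition leaves exactly \<open>R\<close>.\<close>
  have 3: "U \<inter> {..<n} \<notin> R"
    using nU by (auto simp: R_def) blast
  show ?thesis
  proof (cases "U \<inter> {..<n} = {}")
    case True
    then have "trim n P = R" unfolding 2 R_def by auto
    then show ?thesis using 1 True by simp
  next
    case False
    then have "trim n P = insert (U \<inter> {..<n}) R" unfolding 2 R_def by auto
    then show ?thesis using 1 3 False by simp
  qed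
qed

text \<open>Of two candidates the later would lie inside the excursion of the earlier without being
  strictly above it.\<close>

lemma link_unique: "link w k n \<Longrightarrow> link w k' n \<Longrightarrow> k = k'"
  unfolding link_def by (metis less_irrefl linorder_neqE_nat)

lemma nested_unique: "nested_in w k n \<Longrightarrow> nested_in w k' n \<Longrightarrow> k = k'"
  unfolding nested_in_def by (metis Suc_inject less_imp_le less_irrefl linorder_neqE_nat)

text \<open>A singleton is excluded only when a nonempty excursion ends at \<open>n\<close>, that is
  on a descent to a level already open. After a level step (\<open>k + 1 = n\<close>) the link is
  optional, hence the gap in the assumption.\<close>

lemma adapted_new_block:
  assumes Q: "adapted_upto w ls n Q"
    and link: "\<And>k. link w k n \<Longrightarrow> \<not> k + 1 < n"
    and nested: "\<And>k. nested_in w k n \<Longrightarrow> ls ! k \<noteq> ls ! n"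
  shows "adapted_upto w ls (Suc n) (insert {n} Q)"
proof -
  have part: "partition_on {..<Suc n} (insert {n} Q)"
  proof -
    have "\<Union>Q = {..<n}" using adapted_partition[OF Q] by (simp add: partition_on_def)
    then have "disjnt {n} (\<Union>Q)" by (simp add: disjnt_def)
    moreover have "{..<Suc n} - {n} = {..<n}" by auto
    ultimately show ?thesis using adapted_partition[OF Q] by (simp add: partition_on_insert)
  qed
  show ?thesis
    unfolding adapted_upto_def
  proof (intro conjI part)
    show "\<forall>k l. link w k l \<and> k + 1 < l \<and> l < Suc n \<longrightarrow> (\<exists>V\<in>insert {n} Q. k \<in> V \<and> l \<in> V)"
      using adapted_link[OF Q] link by (metis insertCI less_Suc_eq)
    show "\<forall>k r. nested_in w k r \<and> r < Suc n \<longrightarrow> ls ! k \<noteq> ls ! r"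
      using adapted_nested[OF Q] nested by (metis less_Suc_eq)
    show "\<forall>V\<in>insert {n} Q. \<forall>k\<in>V. \<forall>l\<in>V. ls ! k = ls ! l \<and> w ! k = w ! l"
    proof (intro ballI)
      fix V k l assume "V \<in> insert {n} Q" and kl: "k \<in> V" "l \<in> V"
      then consider "V \<in> Q" | "k = n" "l = n" by blast
      then show "ls ! k = ls ! l \<and> w ! k = w ! l"
        using adapted_const[OF Q _ kl] by cases auto
    qed
    show "\<forall>V\<in>insert {n} Q. \<forall>k\<in>V. \<forall>l\<in>V. \<forall>r. k < r \<and> r < l \<longrightarrow> w ! k < w ! r \<or> w ! k = w ! r \<and> r \<in> V"
    proof (intro ballI allI impI)
      fix V k l r assume "V \<in> insert {n} Q" and kl: "k \<in> V" "l \<in> V" and r: "k < r \<and> r < l"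
      then consider "V \<in> Q" | "k = n" "l = n" by blast
      then show "w ! k < w ! r \<or> w ! k = w ! r \<and> r \<in> V"
        using adapted_between[OF Q _ kl, of r] r by cases auto
    qed
  qed
qed

text \<open>It suffices to compare \<open>n\<close> with the last position of \<open>U\<close>; the
  earlier positions follow from betweenness and constancy within \<open>U\<close>.\<close>

lemma adapted_extend_block:
  assumes Q: "adapted_upto w ls n Q" and U: "U \<in> Q"
    and link: "link w (Max U) n" and lab: "ls ! Max U = ls ! n"
  shows "adapted_upto w ls (Suc n) (extend_block n Q U)"
proof -
  note part = adapted_partition[OF Q]
  note blk = partition_lessThan_block[OF part U]
  have "partition_on {..<Suc n} (extend_block n Q U)"
  proof -
    have union: "\<Union>Q = {..<n}" using part by (simp add: partition_on_def)
    have Q_eq: "insert U (Q - {U}) = Q" using U by auto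
    have dU: "disjnt U (\<Union>(Q - {U}))"
      using partition_same_block[OF part U] by (auto simp: disjnt_def)
    have "n \<notin> \<Union>(Q - {U})" using union by auto
    then have "disjnt (insert n U) (\<Union>(Q - {U}))" using dU by (auto simp: disjnt_def)
    moreover have "partition_on ({..<n} - U) (Q - {U})"
      using partition_on_insert[OF dU, of "{..<n}"] part unfolding Q_eq by blast
    moreover have "{..<Suc n} - insert n U = {..<n} - U" by auto
    ultimately show ?thesis using blk(3) by (auto simp: partition_on_insert)
  qed
  note part' = this
  have wn: "w ! Max U = w ! n" using link by (simp add: link_def)
  have const: "ls ! k = ls ! n \<and> w ! k = w ! n" if "k \<in> U" for k
    using adapted_const[OF Q U that blk(4)] lab wn by auto
  show ?thesis
    unfolding adapted_upto_def
  proof (intro conjI part')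
    show "\<forall>V\<in>extend_block n Q U. \<forall>k\<in>V. \<forall>l\<in>V. ls ! k = ls ! l \<and> w ! k = w ! l"
    proof (intro ballI)
      fix V k l assume "V \<in> extend_block n Q U" and kl: "k \<in> V" "l \<in> V"
      then consider "V \<in> Q" | "k \<in> insert n U" "l \<in> insert n U" by blast
      then show "ls ! k = ls ! l \<and> w ! k = w ! l"
      proof cases
        case 1
        then show ?thesis using adapted_const[OF Q _ kl] by blast
      next
        case 2
        then show ?thesis using const[of k] const[of l] by auto
      qed
    qed
    have "w ! k < w ! r \<or> w ! k = w ! r \<and> r \<in> insert n U"
      if k: "k \<in> insert n U" and l: "l \<in> insert n U" and r: "k < r" "r < l" for k l r
    proof -
      have kU: "k \<in> U" using k l r blk by auto
      have km: "k \<le> Max U" using kU blk by simp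
      consider "r < Max U" | "r = Max U" | "Max U < r" by linarith
      then show ?thesis
      proof cases
        case 1
        then show ?thesis using adapted_between[OF Q U kU blk(4)] r by auto
      next
        case 2
        then show ?thesis using const[OF kU] wn blk by auto
      next
        case 3
        have "r < n" using r l blk(3) by auto
        then have "w ! Max U < w ! r" using link 3 unfolding link_def by blast
        then show ?thesis using const[OF kU] wn by simp
      qed
    qed
    then show "\<forall>V\<in>extend_block n Q U. \<forall>k\<in>V. \<forall>l\<in>V. \<forall>r. k < r \<and> r < l \<longrightarrow> w ! k < w ! r \<or> w ! k = w ! r \<and> r \<in> V"
      using adapted_between[OF Q] by blast
    show "\<forall>k l. link w k l \<and> k + 1 < l \<and> l < Suc n \<longrightarrow> (\<exists>V\<in>extend_block n Q U. k \<in> V \<and> l \<in> V)"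
    proof (intro allI impI)
      fix k l assume kl: "link w k l \<and> k + 1 < l \<and> l < Suc n"
      show "\<exists>V\<in>extend_block n Q U. k \<in> V \<and> l \<in> V"
      proof (cases "l = n")
        case True
        then have "k = Max U" using kl link link_unique by blast
        then show ?thesis using True blk by auto
      next
        case False
        then obtain V where "V \<in> Q" "k \<in> V" "l \<in> V" using adapted_link[OF Q, of k l] kl by auto
        then show ?thesis by (cases "V = U") auto
      qed
    qed
    show "\<forall>k r. nested_in w k r \<and> r < Suc n \<longrightarrow> ls ! k \<noteq> ls ! r"
    proof (intro allI impI)
      fix k r assume kr: "nested_in w k r \<and> r < Suc n"
      show "ls ! k \<noteq> ls ! r"
      proof (cases "r = n")
        case True
        \<comment> \<open>The excursion from \<open>Max U\<close> to \<open>n\<close> stays above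
          their level, so the position just below \<open>n\<close> precedes \<open>Max U\<close> and
          is also the one just below \<open>Max U\<close>. The label condition is inherited from
          there.\<close>
        have "k < Max U"
        proof (rule ccontr)
          assume "\<not> k < Max U"
          then consider "k = Max U" | "Max U < k" by linarith
          then show False
            using kr True link wn by cases (auto simp: nested_in_def link_def)
        qed
        then have "nested_in w k (Max U)"
          using kr True wn blk(5) by (auto simp: nested_in_def)
        then show ?thesis using adapted_nested[OF Q, of k "Max U"] blk lab True by auto
      next
        case False
        then show ?thesis using adapted_nested[OF Q, of k r] kr by auto
      qed
    qed
  qed
qed

text \<open>Converse to the two extension lemmas. If the block of \<open>n\<close> has earlier
  positions, its last one is linked to \<open>n\<close>: anything between them lies outside the
  block and is therefore strictly higher.\<close>

lemma adapted_trim_Suc: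
  assumes P: "adapted_upto w ls N P" and n: "n < N"
  obtains "trim (Suc n) P = insert {n} (trim n P)" "\<And>k. link w k n \<Longrightarrow> \<not> k + 1 < n"
  | U where "U \<in> trim n P" "trim (Suc n) P = extend_block n (trim n P) U"
      "link w (Max U) n" "ls ! Max U = ls ! n"
proof -
  note part = adapted_partition[OF P]
  obtain U where U: "U \<in> P" "n \<in> U" using part n by (auto simp: partition_on_def)
  show ?thesis
  proof (cases "U \<inter> {..<n} = {}")
    case True
    have "\<not> k + 1 < n" if lk: "link w k n" for k
    proof
      assume "k + 1 < n"
      then obtain V where "V \<in> P" "k \<in> V" "n \<in> V" using adapted_link[OF P lk] n by auto
      then show False using U True partition_same_block[OF part] \<open>k + 1 < n\<close> by fastforce
    qed
    then show ?thesis using that(1) trim_Suc[OF part n U] True by simp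
  next
    case False
    define k where "k = Max (U \<inter> {..<n})"
    have k: "k \<in> U" "k < n" using False Max_in[of "U \<inter> {..<n}"] by (auto simp: k_def)
    have "link w k n"
      unfolding link_def
    proof (intro conjI allI impI k)
      show "w ! k = w ! n" using adapted_const[OF P U(1) k(1) U(2)] by simp
      fix r assume r: "k < r \<and> r < n"
      have "r \<notin> U"
      proof
        assume "r \<in> U"
        then have "r \<le> k" unfolding k_def using r by (intro Max_ge) auto
        then show False using r by simp
      qed
      then show "w ! k < w ! r" using adapted_between[OF P U(1) k(1) U(2)] r by blast
    qed
    moreover have "ls ! k = ls ! n" using adapted_const[OF P U(1) k(1) U(2)] by simp
    moreover have "U \<inter> {..<n} \<in> trim n P" using U False by (auto simp: trim_def)
    ultimately show ?thesis using that(2) trim_Suc[OF part n U] False by (simp add: k_def)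
  qed
qed

section \<open>The stack evaluation as a sum over adapted partitions\<close>

text \<open>Open blocks, innermost first, are described through their last positions, the candidates
  for \<open>link\<close> and \<open>nested_in\<close> with the next letter.\<close>

fun stack_of_blocks :: "nat list \<Rightarrow> nat \<Rightarrow> nat set list \<Rightarrow> bool" where
  "stack_of_blocks w n [] \<longleftrightarrow> True"
| "stack_of_blocks w n (V # Vs) \<longleftrightarrow> w ! Max V = Suc (length Vs) \<and>
     (\<forall>r. Max V < r \<and> r < n \<longrightarrow> Suc (length Vs) < w ! r) \<and> stack_of_blocks w n Vs"

lemma stack_of_blocks_Suc:
  "stack_of_blocks w n Vs \<Longrightarrow> length Vs < w ! n \<Longrightarrow> stack_of_blocks w (Suc n) Vs"
  by (induction Vs) (auto simp: less_Suc_eq)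

lemma stack_of_blocks_level:
  "stack_of_blocks w n Vs \<Longrightarrow> V \<in> set Vs \<Longrightarrow> w ! Max V \<le> length Vs"
  by (induction Vs) auto

definition labeled_block :: "'i list \<Rightarrow> 'a list \<Rightarrow> nat set \<Rightarrow> 'i \<times> 'a list" where
  "labeled_block ls as V = (block_label ls V, nths as V)"

definition labeled_letter :: "nat list \<Rightarrow> 'i list \<Rightarrow> 'a list \<Rightarrow> nat \<Rightarrow> nat \<times> 'i \<times> 'a" where
  "labeled_letter w ls as k = (w ! k, ls ! k, as ! k)"

lemma block_label_eq:
  assumes "k \<in> V" "\<And>l. l \<in> V \<Longrightarrow> ls ! l = ls ! k"
  shows "block_label ls V = ls ! k"
proof -
  have "(!) ls ` V = (\<lambda>l. ls ! k) ` V" by (rule image_cong[OF refl assms(2)])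
  also have "\<dots> = {ls ! k}" by (rule image_constant[OF assms(1)])
  finally have "(!) ls ` V = {ls ! k}" .
  then show ?thesis by (simp add: block_label_def)
qed

text \<open>Matches the growth of a block by its last position with appending to the argument list
  kept on the stack.\<close>

lemma nths_insert_last:
  assumes "V \<subseteq> {..<n}" "n < length as"
  shows "nths as (insert n V) = nths as V @ [as ! n]"
proof -
  have as: "as = take n as @ as ! n # drop (Suc n) as"
    using assms(2) by (rule id_take_nth_drop)
  have empty: "{j. Suc j + length (take n as) \<in> W} = {}" if "W \<subseteq> {..n}" for W
    using that assms(2) by (auto simp: min_def)
  have split: "nths as W = nths (take n as) W @ (if n \<in> W then [as ! n] else [])" if "W \<subseteq> {..n}" for W
    using assms(2) empty[OF that]
    by (subst as) (simp add: nths_append nths_Cons del: length_take, simp)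
  have "nths (take n as) (insert n V) = nths (take n as) V"
    unfolding nths_def using assms(2)
    by (intro arg_cong[where f = "map fst"] filter_cong) (auto dest: set_zip_rightD)
  moreover have "n \<notin> V" "insert n V \<subseteq> {..n}" "V \<subseteq> {..n}" using assms(1) by auto
  ultimately show ?thesis using split[of V] split[of "insert n V"] by simp
qed

section \<open>The sum over completions of a partial partition\<close>

context
  fixes w :: "nat list" and ls :: "'i list" and as :: "'a list" and N :: nat
    and b :: "'i \<Rightarrow> 'a list \<Rightarrow> complex"
  assumes len: "length as = N"
    and w_pos: "\<And>k. k < N \<Longrightarrow> 1 \<le> w ! k"
    and w_step: "\<And>k. Suc k < N \<Longrightarrow> w ! Suc k \<le> w ! k + 1 \<and> w ! k \<le> w ! Suc k + 1"
    and w_last: "w ! (N - 1) = 1"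
begin

abbreviation "weight V \<equiv> b (block_label ls V) (nths as V)"

abbreviation "refining n Q \<equiv> {P. adapted_upto w ls N P \<and> trim n P = Q}"

lemma finite_refining: "finite (refining n Q)"
proof (rule finite_subset)
  show "refining n Q \<subseteq> Pow (Pow {..<N})"
    by (auto simp: adapted_upto_def partition_on_def)
qed simp

lemma refining_Suc_subset:
  "trim n Q' = Q \<Longrightarrow> refining (Suc n) Q' \<subseteq> refining n Q"
  using trim_trim[of n "Suc n"] by auto

text \<open>The invariant has closed blocks \<open>C\<close> and open blocks \<open>V # Vs\<close>;
  the sum is over all final partitions restricting to their union. One more letter splits these
  completions by their next restriction, just as \<open>run\<close> branches.\<close>

lemma run_eq_sum:
  assumes "n \<le> N" "1 \<le> n" "adapted_upto w ls n (C \<union> set (V # Vs))" "finite C" "C \<inter> set (V # Vs) = {}"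
    and "stack_of_blocks w n (V # Vs)" "w ! (n - 1) = Suc (length Vs)"
  shows "(\<Prod>U\<in>C. weight U) * run b (map (labeled_block ls as) (V # Vs)) (map (labeled_letter w ls as) [n..<N])
    = (\<Sum>P\<in>refining n (C \<union> set (V # Vs)). \<Prod>U\<in>P. weight U)"
  using assms
proof (induction "N - n" arbitrary: n C V Vs)
  case 0
  then have n: "n = N" by simp
  \<comment> \<open>The final height is \<open>1\<close>, so exactly one block is still
    open.\<close>
  have Vs: "Vs = []" using 0 w_last n by simp
  define Q where "Q = C \<union> {V}"
  have "adapted_upto w ls N Q" using 0 n by (simp add: Q_def Vs)
  moreover have "trim N P = P" if "adapted_upto w ls N P" for P
    using trim_self[OF adapted_partition[OF that]] .
  ultimately have "P \<in> refining N Q \<longleftrightarrow> P \<in> {Q}" for P by auto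
  then have "refining N Q = {Q}" by blast
  then have "refining n (C \<union> set (V # Vs)) = {C \<union> {V}}" by (simp add: n Vs Q_def)
  then show ?case
    using 0 by (simp add: n Vs labeled_block_def mult.commute)
next
  case (Suc d n C V Vs)
  let ?Q = "C \<union> set (V # Vs)" and ?h = "Suc (length Vs)"
  let ?rest = "map (labeled_letter w ls as) [Suc n..<N]"
  let ?L = "labeled_block ls as"
  have n: "n < N" using Suc by simp
  have Q: "adapted_upto w ls n ?Q" using Suc by simp
  note part = adapted_partition[OF Q]
  note blk = partition_lessThan_block[OF part]
  have V: "V \<in> ?Q" by simp
  have h: "w ! (n - 1) = ?h" using Suc by simp
  have n1: "Suc (n - 1) = n" using Suc by simp
  \<comment> \<open>Letters after \<open>Max V\<close> exceed the level of \<open>V\<close>, whereas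
    the letter at \<open>n - 1\<close> is equal to it.\<close>
  have maxV: "Max V = n - 1"
  proof (rule ccontr)
    assume "Max V \<noteq> n - 1"
    then have "Max V < n - 1" using blk(5)[OF V] by simp
    then show False using Suc.prems(6) h Suc.prems(2) by auto
  qed
  have lab: "block_label ls U = ls ! k" if "U \<in> ?Q" "k \<in> U" for U k
    by (rule block_label_eq) (use adapted_const[OF Q that(1) _ that(2)] that(2) in blast)+
  have labV: "block_label ls V = ls ! (n - 1)" using lab[OF V blk(4)[OF V]] maxV by simp
  have single: "?L {n} = (ls ! n, [as ! n])"
    using nths_insert_last[of "{}" n as] n len by (simp add: labeled_block_def block_label_def)
  have fstL: "fst (?L U) = block_label ls U" for U by (simp add: labeled_block_def)
  have LV: "?L V = (ls ! (n - 1), nths as V)" by (simp add: labeled_block_def labV)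
  have letter: "labeled_letter w ls as n = (w ! n, ls ! n, as ! n)" by (simp add: labeled_letter_def)
  have ext: "?L (insert n U) = (block_label ls U, nths as U @ [as ! n])"
    if "U \<in> ?Q" "ls ! Max U = ls ! n" for U
  proof -
    have "block_label ls (insert n U) = ls ! n"
    proof (rule block_label_eq)
      fix l assume "l \<in> insert n U"
      then show "ls ! l = ls ! n"
        using adapted_const[OF Q that(1) _ blk(4)[OF that(1)]] that(2) by (metis insertE)
    qed simp
    then show ?thesis
      using lab[OF that(1) blk(4)[OF that(1)]] that nths_insert_last[OF blk(3)[OF that(1)], of as] n len
      by (simp add: labeled_block_def)
  qed
  have upt: "[n..<N] = n # [Suc n..<N]" using n by (rule upt_conv_Cons)
  have notV: "V \<notin> set Vs" 
  proof
    assume "V \<in> set Vs"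
    then have "w ! Max V \<le> length Vs"
      using Suc.prems(6) stack_of_blocks_level[of w n Vs V] by simp
    then show False using maxV h by simp
  qed
  have trim_new: "trim n (insert {n} ?Q) = ?Q" by (rule trim_insert_new[OF part])
  have trim_ext: "trim n (extend_block n ?Q U) = ?Q" if "U \<in> ?Q" for U
    by (rule trim_extend_block[OF part that])
  have sub_new: "refining (Suc n) (insert {n} ?Q) \<subseteq> refining n ?Q"
    using trim_new by (rule refining_Suc_subset)
  have nQ: "n \<notin> U" "{n} \<noteq> U" "insert n U \<noteq> {n}" if "U \<in> ?Q" for U
    using blk(1,3)[OF that] by auto
  have steps: "w ! n \<le> ?h + 1" "?h \<le> w ! n + 1" using w_step[of "n - 1"] n n1 h by auto
  have wn: "1 \<le> w ! n" using w_pos n by simp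
  have "d = N - Suc n" "Suc n \<le> N" "1 \<le> Suc n" using Suc.hyps(2) n by auto
  note IH = Suc.hyps(1)[OF this]
  consider (up) "w ! n = length Vs + 2" | (flat) "w ! n = length Vs + 1"
    | (down) "w ! n = length Vs" using steps by linarith
  then show ?case
  proof cases
    \<comment> \<open>A rise forces a new block: nothing is linked to \<open>n\<close>, and the only
      label constraint comes from position \<open>n - 1\<close>.\<close>
    case up
    have nested: "nested_in w k n \<longleftrightarrow> k = n - 1" for k
    proof -
      have "s = n" if "n - 1 < s" "s \<le> n" for s using that by simp
      then have "nested_in w (n - 1) n" using up h Suc.prems(2) unfolding nested_in_def by fastforce
      then show ?thesis using nested_unique by blast
    qed
    have nolink: "\<not> link w k n" for k
    proof
      assume l: "link w k n"
      show False
      proof (cases "k = n - 1")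
        case True then show ?thesis using l up h by (simp add: link_def)
      next
        case False
        then have "w ! k < w ! (n - 1)" using l by (auto simp: link_def)
        then show ?thesis using l up h by (simp add: link_def)
      qed
    qed
    have ref: "refining n ?Q = refining (Suc n) (insert {n} ?Q)"
    proof (intro equalityI sub_new subsetI)
      fix P assume P: "P \<in> refining n ?Q"
      then have PA: "adapted_upto w ls N P" by simp
      show "P \<in> refining (Suc n) (insert {n} ?Q)"
        using PA n by (rule adapted_trim_Suc) (use P nolink in auto)
    qed
    show ?thesis
    proof (cases "ls ! n = ls ! (n - 1)")
      case True
      have empty: "refining n ?Q = {}"
        using adapted_nested[of w ls N _ "n - 1" n] nested n True by auto
      have "run b (map ?L (V # Vs)) (map (labeled_letter w ls as) [n..<N]) = 0"
        unfolding upt by (simp add: labeled_letter_def labeled_block_def labV True up)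
      then show ?thesis unfolding empty by simp
    next
      case False
      have "adapted_upto w ls (Suc n) (insert {n} ?Q)"
        using Q by (rule adapted_new_block) (use nolink nested False in auto)
      moreover have eq: "insert {n} ?Q = C \<union> set ({n} # V # Vs)" by auto
      moreover have "C \<inter> set ({n} # V # Vs) = {}"
        using Suc.prems(5) nQ(1)[of "{n}"] by auto
      moreover have "stack_of_blocks w (Suc n) ({n} # V # Vs)"
        using stack_of_blocks_Suc[OF Suc.prems(6)] up by simp
      ultimately have "(\<Prod>U\<in>C. weight U) * run b (map ?L ({n} # V # Vs)) ?rest
        = (\<Sum>P\<in>refining (Suc n) (insert {n} ?Q). \<Prod>U\<in>P. weight U)"
        unfolding eq by (intro IH Suc.prems(4)) (simp_all add: up)
      then show ?thesis unfolding ref upt using False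
        by (simp add: single) (simp add: labeled_letter_def labeled_block_def labV up)
    qed
  next
    \<comment> \<open>The only link to \<open>n\<close> is the adjacent one, which may be used or
      not. \<open>S1\<close> collects the completions prolonging the top block, \<open>S2\<close>
      those closing it.\<close>
    case flat
    have nolink: "\<not> k + 1 < n" if "link w k n" for k
    proof
      assume "k + 1 < n"
      then have "w ! k < w ! (n - 1)" using that by (auto simp: link_def)
      then show False using that flat h by (simp add: link_def)
    qed
    have linkV: "link w (n - 1) n" using flat h Suc.prems(2) by (auto simp: link_def)
    have stackVs: "stack_of_blocks w (Suc n) Vs"
      using Suc.prems(6) flat by (intro stack_of_blocks_Suc) auto
    have nested: "nested_in w k n \<longleftrightarrow> Vs \<noteq> [] \<and> k = Max (hd Vs)" for k
    proof (cases Vs)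
      case Nil
      have "\<not> nested_in w k n" using flat Nil w_pos[of k] n by (auto simp: nested_in_def)
      then show ?thesis using Nil by simp
    next
      case (Cons V2 Vs2)
      have "nested_in w (Max V2) n"
        using Suc.prems(6) Cons flat blk(5)[of V2] by (auto simp: nested_in_def le_less)
      then show ?thesis using nested_unique Cons by auto
    qed
    have lab2: "block_label ls (hd Vs) = ls ! Max (hd Vs)" if "Vs \<noteq> []"
      using that by (intro lab blk(4)) (auto simp: hd_in_set)
    let ?ext = "extend_block n ?Q V"
    have ext_eq: "?ext = C \<union> set (insert n V # Vs)" using Suc.prems(5) notV by auto
    have ref_sub: "P \<in> refining (Suc n) (insert {n} ?Q) \<or> P \<in> refining (Suc n) ?ext \<and> ls ! (n - 1) = ls ! n"
      if P: "P \<in> refining n ?Q" for P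
    proof -
      have PA: "adapted_upto w ls N P" using P by simp
      show ?thesis using PA n
      proof (rule adapted_trim_Suc)
        assume "trim (Suc n) P = insert {n} (trim n P)"
        then show ?thesis using P by auto
      next
        fix U assume U: "U \<in> trim n P" "trim (Suc n) P = extend_block n (trim n P) U"
          "link w (Max U) n" "ls ! Max U = ls ! n"
        have tP: "trim n P = ?Q" using P by simp
        have UQ: "U \<in> ?Q" using U(1) tP by simp
        have max: "Max U = n - 1" using U(3) linkV link_unique by blast
        have "U = V"
          using partition_same_block[OF part UQ V blk(4)[OF UQ]] blk(4)[OF V] max maxV by simp
        then have "trim (Suc n) P = ?ext" using U(2) tP by simp
        then show ?thesis using PA U(4) max by simp
      qed
    qed
    define S1 where "S1 = (if ls ! n = ls ! (n - 1) then refining (Suc n) ?ext else {})"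
    define S2 where "S2 = (if Vs \<noteq> [] \<and> ls ! n = block_label ls (hd Vs) then {}
      else refining (Suc n) (insert {n} ?Q))"
    have S_sub: "S1 \<subseteq> refining (Suc n) ?ext" "S2 \<subseteq> refining (Suc n) (insert {n} ?Q)"
      unfolding S1_def S2_def by (split if_split, blast)+
    have ref: "refining n ?Q = S1 \<union> S2"
    proof (intro equalityI subsetI)
      fix P assume P: "P \<in> refining n ?Q"
      have "\<not> (Vs \<noteq> [] \<and> ls ! n = block_label ls (hd Vs))"
        using P adapted_nested[of w ls N P _ n] nested n lab2 by auto
      then have S2: "S2 = refining (Suc n) (insert {n} ?Q)" unfolding S2_def by (rule if_not_P)
      show "P \<in> S1 \<union> S2"
      proof (cases "P \<in> refining (Suc n) (insert {n} ?Q)")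
        case False
        then have PE: "P \<in> refining (Suc n) ?ext" and eq: "ls ! (n - 1) = ls ! n"
          using ref_sub[OF P] by blast+
        from eq have "S1 = refining (Suc n) ?ext" unfolding S1_def by (intro if_P) simp
        with PE have "P \<in> S1" by blast
        then show ?thesis ..
      qed (use S2 in blast)
    next
      fix P assume "P \<in> S1 \<union> S2"
      then have "P \<in> refining (Suc n) ?ext \<or> P \<in> refining (Suc n) (insert {n} ?Q)"
        using S_sub by blast
      then show "P \<in> refining n ?Q"
        using sub_new refining_Suc_subset[OF trim_ext[OF V]] by blast
    qed
    \<comment> \<open>The two next restrictions are told apart by whether \<open>{n}\<close> is a
      block.\<close>
    have disj: "S1 \<inter> S2 = {}"
    proof -
      have "{n} \<notin> ?ext" using nQ(1)[of "{n}"] nQ(3)[OF V] by auto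
      then have "?ext \<noteq> insert {n} ?Q" by blast
      then have "refining (Suc n) ?ext \<inter> refining (Suc n) (insert {n} ?Q) = {}" by blast
      then show ?thesis using S_sub by blast
    qed
    have fin: "finite S1" "finite S2"
      using S_sub by (auto intro: finite_subset[OF _ finite_refining])
    have sum: "(\<Sum>P\<in>refining n ?Q. \<Prod>U\<in>P. weight U)
      = (\<Sum>P\<in>S1. \<Prod>U\<in>P. weight U) + (\<Sum>P\<in>S2. \<Prod>U\<in>P. weight U)"
      unfolding ref by (rule sum.union_disjoint[OF fin disj])
    have 1: "(\<Sum>P\<in>S1. \<Prod>U\<in>P. weight U) = (if ls ! n = ls ! (n - 1) then
      (\<Prod>U\<in>C. weight U) * run b (map ?L (insert n V # Vs)) ?rest else 0)"
    proof (cases "ls ! n = ls ! (n - 1)")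
      case True
      have "adapted_upto w ls (Suc n) ?ext"
        using Q V by (rule adapted_extend_block) (use linkV maxV True in auto)
      moreover have "Max (insert n V) = n"
        using blk(2,5)[OF V] blk(1)[OF V] by simp
      moreover have "C \<inter> set (insert n V # Vs) = {}"
        using Suc.prems(5) nQ(1)[of "insert n V"] by auto
      ultimately have "(\<Prod>U\<in>C. weight U) * run b (map ?L (insert n V # Vs)) ?rest
        = (\<Sum>P\<in>refining (Suc n) (C \<union> set (insert n V # Vs)). \<Prod>U\<in>P. weight U)"
        unfolding ext_eq using flat stackVs by (intro IH Suc.prems(4)) simp_all
      then show ?thesis using True unfolding S1_def ext_eq by simp
    qed (simp add: S1_def)
    have 2: "(\<Sum>P\<in>S2. \<Prod>U\<in>P. weight U) = (if Vs \<noteq> [] \<and> ls ! n = block_label ls (hd Vs) then 0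
      else (\<Prod>U\<in>insert V C. weight U) * run b (map ?L ({n} # Vs)) ?rest)"
    proof (cases "Vs \<noteq> [] \<and> ls ! n = block_label ls (hd Vs)")
      case False
      have eq: "insert {n} ?Q = insert V C \<union> set ({n} # Vs)" by auto
      have "adapted_upto w ls (Suc n) (insert {n} ?Q)"
        using Q by (rule adapted_new_block) (use nolink nested False lab2 in auto)
      moreover have "insert V C \<inter> set ({n} # Vs) = {}"
        using Suc.prems(5) nQ(1)[of "{n}"] notV by auto
      ultimately have "(\<Prod>U\<in>insert V C. weight U) * run b (map ?L ({n} # Vs)) ?rest
        = (\<Sum>P\<in>refining (Suc n) (insert V C \<union> set ({n} # Vs)). \<Prod>U\<in>P. weight U)"
        unfolding eq using flat stackVs Suc.prems(4) by (intro IH) simp_all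
      then show ?thesis unfolding S2_def if_not_P[OF False] eq by simp
    qed (simp add: S2_def)
    have prodV: "(\<Prod>U\<in>insert V C. weight U) = weight V * (\<Prod>U\<in>C. weight U)"
      using Suc.prems(4,5) by (intro prod.insert) auto
    have extV: "?L (insert n V) = (block_label ls V, nths as V @ [as ! n])" if "ls ! n = ls ! (n - 1)"
      using ext[OF V] that maxV by simp
    have "run b (map ?L (V # Vs)) (map (labeled_letter w ls as) [n..<N]) =
       (if ls ! n = ls ! (n - 1) then run b (map ?L (insert n V # Vs)) ?rest else 0) +
       (if Vs \<noteq> [] \<and> ls ! n = block_label ls (hd Vs) then 0
        else weight V * run b (map ?L ({n} # Vs)) ?rest)"
      using flat extV by (cases "ls ! n = ls ! (n - 1)"; cases "Vs = []")
        (simp_all add: upt single LV letter fstL hd_map labV)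
    then show ?thesis unfolding sum 1 2 prodV
      by (cases "ls ! n = ls ! (n - 1)"; cases "Vs \<noteq> [] \<and> ls ! n = block_label ls (hd Vs)")
        (simp_all only: if_True if_False, simp_all add: algebra_simps)
  next
    \<comment> \<open>The link from the block below spans a nonempty excursion, so joining that
      block is forced, and without equal labels there is no completion.\<close>
    case down
    then obtain V2 Vs2 where Vs: "Vs = V2 # Vs2" using wn by (cases Vs) auto
    have V2: "V2 \<in> ?Q" by (simp add: Vs)
    have link: "link w (Max V2) n"
      using Suc.prems(6) blk(5)[OF V2] down by (auto simp: link_def Vs)
    have far: "Max V2 + 1 < n"
    proof (rule ccontr)
      assume "\<not> Max V2 + 1 < n"
      then have "Max V2 = n - 1" using blk(5)[OF V2] by simp
      then show False using Suc.prems(6) h Vs by simp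
    qed
    let ?ext = "extend_block n ?Q V2"
    have V2not: "V2 \<noteq> V" "V2 \<notin> set Vs2" "V2 \<notin> C"
    proof -
      show "V2 \<noteq> V" using notV Vs by auto
      show "V2 \<notin> C" using Suc.prems(5) Vs by auto
      show "V2 \<notin> set Vs2"
      proof
        assume "V2 \<in> set Vs2"
        then have "w ! Max V2 \<le> length Vs2"
          using Suc.prems(6) stack_of_blocks_level[of w n Vs2 V2] by (simp add: Vs)
        then show False using Suc.prems(6) Vs by auto
      qed
    qed
    have ext_eq: "?ext = insert V C \<union> set (insert n V2 # Vs2)" using V2not by (auto simp: Vs)
    have ref_sub: "P \<in> refining (Suc n) ?ext \<and> ls ! n = ls ! Max V2"
      if P: "P \<in> refining n ?Q" for P
    proof -
      have PA: "adapted_upto w ls N P" using P by simp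
      show ?thesis using PA n
      proof (rule adapted_trim_Suc)
        assume "\<And>k. link w k n \<Longrightarrow> \<not> k + 1 < n"
        then show ?thesis using link far by blast
      next
        fix U assume U: "U \<in> trim n P" "trim (Suc n) P = extend_block n (trim n P) U"
          "link w (Max U) n" "ls ! Max U = ls ! n"
        have tP: "trim n P = ?Q" using P by simp
        have UQ: "U \<in> ?Q" using U(1) tP by simp
        have max: "Max U = Max V2" using U(3) link link_unique by blast
        have "U = V2"
          using partition_same_block[OF part UQ V2 blk(4)[OF UQ]] blk(4)[OF V2] max by simp
        then have "trim (Suc n) P = ?ext" using U(2) tP by simp
        then show ?thesis using PA U(4) max by simp
      qed
    qed
    have lab2: "block_label ls V2 = ls ! Max V2" using lab[OF V2] blk(4)[OF V2] by simp
    show ?thesis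
    proof (cases "ls ! n = ls ! Max V2")
      case False
      then have empty: "refining n ?Q = {}" using ref_sub by blast
      have "run b (map ?L (V # Vs)) (map (labeled_letter w ls as) [n..<N]) = 0"
        unfolding upt using False by (simp add: Vs labeled_letter_def labeled_block_def lab2 down)
      then show ?thesis unfolding empty by simp
    next
      case True
      have ref: "refining n ?Q = refining (Suc n) ?ext"
        using ref_sub refining_Suc_subset[OF trim_ext[OF V2]] by blast
      have stack2: "stack_of_blocks w (Suc n) Vs2"
        using Suc.prems(6) down Vs by (intro stack_of_blocks_Suc) auto
      have "adapted_upto w ls (Suc n) ?ext"
        using Q V2 by (rule adapted_extend_block) (use link True in auto)
      moreover have "Max (insert n V2) = n"
        using blk(2,5)[OF V2] blk(1)[OF V2] by simp
      moreover have "insert V C \<inter> set (insert n V2 # Vs2) = {}"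
        using Suc.prems(5) nQ(1)[of "insert n V2"] notV by (auto simp: Vs)
      ultimately have "(\<Prod>U\<in>insert V C. weight U) * run b (map ?L (insert n V2 # Vs2)) ?rest
        = (\<Sum>P\<in>refining (Suc n) (insert V C \<union> set (insert n V2 # Vs2)). \<Prod>U\<in>P. weight U)"
        unfolding ext_eq using down Vs stack2 Suc.prems(4) by (intro IH) simp_all
      moreover have "(\<Prod>U\<in>insert V C. weight U) = weight V * (\<Prod>U\<in>C. weight U)"
        using Suc.prems(4,5) by (intro prod.insert) auto
      moreover have "run b (map ?L (V # Vs)) (map (labeled_letter w ls as) [n..<N]) =
         weight V * run b (map ?L (insert n V2 # Vs2)) ?rest"
        unfolding upt using ext[OF V2] True
        by (simp add: Vs) (simp add: labeled_letter_def labeled_block_def lab2 down Vs)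
      ultimately show ?thesis unfolding ref ext_eq by (simp add: mult_ac)
    qed
  qed
qed

lemma run_eq_sum_adapted:
  assumes "1 \<le> N" "w ! 0 = 1"
  shows "run b [(ls ! 0, [as ! 0])] (map (labeled_letter w ls as) [1..<N])
    = (\<Sum>P | adapted_upto w ls N P. \<Prod>U\<in>P. weight U)"
proof -
  have 0: "adapted_upto w ls 0 {}" by (auto simp: adapted_upto_def partition_on_def)
  have "adapted_upto w ls (Suc 0) (insert {0} {})"
    using 0 by (rule adapted_new_block) (auto simp: link_def nested_in_def)
  then have "(\<Prod>U\<in>{}. weight U) * run b (map (labeled_block ls as) [{0}]) (map (labeled_letter w ls as) [1..<N])
    = (\<Sum>P\<in>refining 1 ({} \<union> set [{0}]). \<Prod>U\<in>P. weight U)"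
    using assms by (intro run_eq_sum) auto
  moreover have "labeled_block ls as {0} = (ls ! 0, [as ! 0])"
    using nths_insert_last[of "{}" 0 as] assms len by (simp add: labeled_block_def block_label_def)
  moreover have "refining 1 ({} \<union> set [{0}]) = {P. adapted_upto w ls N P}"
  proof -
    \<comment> \<open>Position \<open>0\<close> can only start a block, so prescribing the
      restriction to length \<open>1\<close> imposes no condition.\<close>
    have "trim 1 P = {{0}}" if P: "adapted_upto w ls N P" for P
    proof -
      have "trim 0 P = {}" by (auto simp: trim_def)
      then show ?thesis
        using P assms(1)
        by (rule_tac adapted_trim_Suc[of w ls N P 0]) auto
    qed
    then show ?thesis by auto
  qed
  ultimately show ?thesis by simp
qed

end

section \<open>Depth in noncrossing partitions\<close>

lemma outer_irrefl: "\<not> outer V V"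
  by (simp add: outer_def)

lemma outer_trans:
  assumes "outer U V" "outer V W"
  shows "outer U W"
proof -
  obtain p q where p: "p \<in> U" "q \<in> U" "\<forall>k\<in>V. p < k \<and> k < q"
    using assms(1) by (auto simp: outer_def)
  obtain p' q' where p': "p' \<in> V" "q' \<in> V" "\<forall>k\<in>W. p' < k \<and> k < q'"
    using assms(2) by (auto simp: outer_def)
  have "p < p'" "q' < q" using p p' by auto
  moreover have "U \<noteq> W" using p p' by fastforce
  ultimately show ?thesis unfolding outer_def using p p' by (meson less_trans)
qed

locale noncrossing =
  fixes n :: nat and P :: "nat set set"
  assumes noncrossing: "noncrossing_partition n P"
begin

lemma part: "partition_on {..<n} P"
  using noncrossing by (simp add: noncrossing_partition_def)

text \<open>A position of \<open>W\<close> beyond \<open>p\<close> or \<open>q\<close> would form a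
  crossing with \<open>p\<close>, \<open>r\<close> and \<open>q\<close>.\<close>

lemma outer_between:
  assumes V: "V \<in> P" and W: "W \<in> P" and ne: "V \<noteq> W"
    and p: "p \<in> V" "q \<in> V" and r: "r \<in> W" "p < r" "r < q"
  shows "outer V W"
proof -
  have nc: "\<not> (a < b \<and> b < c \<and> c < d)"
    if "X \<in> P" "Y \<in> P" "X \<noteq> Y" "a \<in> X" "b \<in> Y" "c \<in> X" "d \<in> Y" for a b c d X Y
  proof -
    have "\<not> (\<exists>a\<in>X. \<exists>b\<in>Y. \<exists>c\<in>X. \<exists>d\<in>Y. a < b \<and> b < c \<and> c < d)"
      by (rule noncrossing[unfolded noncrossing_partition_def, THEN conjunct2, rule_format, OF that(1-3)])
    then show ?thesis using that(4-7) by blast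
  qed
  have "p < k \<and> k < q" if k: "k \<in> W" for k
  proof -
    have "k \<noteq> p" "k \<noteq> q" using partition_same_block[OF part V W] k p ne by auto
    moreover have "\<not> k < p" using nc[OF W V ne[symmetric] k p(1) r(1) p(2)] r by auto
    moreover have "\<not> q < k" using nc[OF V W ne p(1) r(1) p(2) k] r by auto
    ultimately show "p < k \<and> k < q" by auto
  qed
  then show ?thesis unfolding outer_def using ne p by blast
qed

section \<open>Depth as a number of outer blocks\<close>

abbreviation "outers V \<equiv> {U \<in> P. outer U V}"

lemma finite_outers: "finite (outers V)"
  using partition_lessThan_finite[OF part] by simp

text \<open>Both blocks surround a common position, and the one whose left witness comes first also
  surrounds the left witness of the other.\<close>

lemma outer_linear:
  assumes "V \<in> P" "U \<in> outers V" "U' \<in> outers V" "U \<noteq> U'"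
  shows "outer U U' \<or> outer U' U"
proof -
  obtain v where v: "v \<in> V" using partition_lessThan_block(1)[OF part assms(1)] by auto
  obtain p q where p: "p \<in> U" "q \<in> U" "p < v" "v < q" using assms(2) v by (auto simp: outer_def)
  obtain p' q' where p': "p' \<in> U'" "q' \<in> U'" "p' < v" "v < q'" using assms(3) v by (auto simp: outer_def)
  have "p \<noteq> p'" using partition_same_block[OF part, of U U' p] assms p p' by auto
  then consider "p < p'" | "p' < p" by linarith
  then show ?thesis
  proof cases
    case 1
    then show ?thesis using outer_between[of U U' p q p'] assms p p' by auto
  next
    case 2
    then show ?thesis using outer_between[of U' U p' q' p] assms p p' by auto
  qed
qed

lemma nearest_outer_unique:
  assumes V: "V \<in> P" and U: "U \<in> P" "outer U V" "\<And>U'. U' \<in> P \<Longrightarrow> outer U' V \<Longrightarrow> U' = U \<or> outer U' U"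
  shows "nearest_outer P V = U"
  unfolding nearest_outer_def
proof (rule the_equality)
  show "U \<in> P \<and> outer U V \<and> \<not> (\<exists>Ua\<in>P. outer Ua V \<and> outer U Ua)"
    using U outer_irrefl outer_trans by blast
next
  fix W assume W: "W \<in> P \<and> outer W V \<and> \<not> (\<exists>U\<in>P. outer U V \<and> outer W U)"
  then show "W = U" using U by blast
qed

lemma nearest_outer_props:
  assumes V: "V \<in> P" "\<not> covering P V"
  shows "nearest_outer P V \<in> P" "outer (nearest_outer P V) V"
    "outers V = insert (nearest_outer P V) (outers (nearest_outer P V))"
proof -
  have ne: "outers V \<noteq> {}" using V by (auto simp: covering_def)
  \<comment> \<open>The nearest outer block is the one with the largest minimum.\<close>
  obtain U where U: "U \<in> outers V" "\<And>U'. U' \<in> outers V \<Longrightarrow> Min U' \<le> Min U"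
  proof -
    have "Max (Min ` outers V) \<in> Min ` outers V" using ne finite_outers by (intro Max_in) auto
    then obtain U where "U \<in> outers V" "Min U = Max (Min ` outers V)" by auto
    then show ?thesis using finite_outers by (intro that[of U]) auto
  qed
  have *: "U' = U \<or> outer U' U" if "U' \<in> P" "outer U' V" for U'
  proof (rule ccontr)
    assume c: "\<not> (U' = U \<or> outer U' U)"
    then have "outer U U'" using outer_linear[OF V(1), of U U'] U that by auto
    then obtain p where p: "p \<in> U" "\<forall>k\<in>U'. p < k" by (auto simp: outer_def)
    have "Min U \<le> p" using p partition_lessThan_block[OF part, of U] U by simp
    moreover have "p < Min U'" using p partition_lessThan_block[OF part that(1)] by simp
    ultimately show False using U(2)[of U'] that by auto
  qed
  have eq: "nearest_outer P V = U"
    using U * by (intro nearest_outer_unique[OF V(1)]) auto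
  show "nearest_outer P V \<in> P" "outer (nearest_outer P V) V" using U eq by auto
  show "outers V = insert (nearest_outer P V) (outers (nearest_outer P V))"
    unfolding eq using U * outer_trans by blast
qed

text \<open>The outer blocks of \<open>V\<close> are the nearest one together with its own outer
  blocks, so each nesting step raises the cardinality by one.\<close>

lemma has_depth_outers: "V \<in> P \<Longrightarrow> has_depth P V (card (outers V) + 1)"
proof (induction "card (outers V)" arbitrary: V rule: less_induct)
  case less
  show ?case
  proof (cases "covering P V")
    case True
    then have "outers V = {}" by (auto simp: covering_def)
    then have "card (outers V) + 1 = 1" by (simp only: card.empty)
    then show ?thesis using less.prems True by (simp only: has_depth.covering)
  next
    case False
    define U where "U = nearest_outer P V"
    note props = nearest_outer_props[OF less.prems False, folded U_def]
    have card: "card (outers V) = card (outers U) + 1"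
      unfolding props(3) using finite_outers outer_irrefl by (subst card_insert_disjoint) auto
    have "has_depth P U (card (outers U) + 1)"
      using props(1) card by (intro less.hyps) auto
    then show ?thesis unfolding card U_def by (rule has_depth.nested[OF less.prems False])
  qed
qed

lemma has_depth_unique: "has_depth P V d \<Longrightarrow> has_depth P V d' \<Longrightarrow> d = d'"
proof (induction arbitrary: d' rule: has_depth.induct)
  case (covering V)
  from covering(3) show ?case by cases (use covering in auto)
next
  case (nested V d)
  from nested.prems show ?case
  proof cases
    case covering
    then show ?thesis using nested.hyps(2) by blast
  next
    case (nested d2)
    then show ?thesis using \<open>\<And>d'. has_depth P (nearest_outer P V) d' \<Longrightarrow> d = d'\<close> by blast
  qed
qed

lemma depth_eq:
  assumes "V \<in> P"
  shows "depth P V = card (outers V) + 1"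
  unfolding depth_def by (rule the_equality) (use has_depth_outers[OF assms] has_depth_unique in auto)

lemma depth_less:
  assumes "U \<in> P" "V \<in> P" "outer U V"
  shows "depth P U < depth P V"
proof -
  have "outers U \<subset> outers V" using assms outer_trans outer_irrefl by blast
  then have "card (outers U) < card (outers V)" using finite_outers by (intro psubset_card_mono)
  then show ?thesis using depth_eq assms by simp
qed

lemma depth_nearest_outer:
  assumes "V \<in> P" "\<not> covering P V"
  shows "depth P V = depth P (nearest_outer P V) + 1"
proof -
  have "card (outers V) = card (outers (nearest_outer P V)) + 1"
    unfolding nearest_outer_props(3)[OF assms] using finite_outers outer_irrefl
    by (subst card_insert_disjoint) auto
  then show ?thesis using depth_eq assms nearest_outer_props(1) by simp
qed

lemma covering_iff_depth: "V \<in> P \<Longrightarrow> covering P V \<longleftrightarrow> depth P V = 1"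
  using finite_outers depth_eq by (auto simp: covering_def)

end

section \<open>The labeled partitions of a Motzkin word\<close>

lemma monotone_chain_pair:
  "monotone_chain w P [U, W] \<longleftrightarrow> U \<in> P \<and> W \<in> P \<and> \<not> covering P W \<and> U = nearest_outer P W \<and>
     (\<forall>r\<in>U. \<forall>s\<in>W. w ! r < w ! s)"
  by (auto simp: monotone_chain_def less_Suc_eq)

context
  fixes w :: "nat list" and ls :: "'i list" and n :: nat
  assumes n: "1 \<le> n" and w: "w \<in> motzkin_words n"
begin

lemma motzkin_length: "length w = n"
  using w by (simp add: motzkin_words_def)

lemma motzkin_pos:
  assumes "k < n"
  shows "1 \<le> w ! k"
proof -
  have "w ! k \<in> set w" using assms by (simp add: motzkin_length)
  moreover have "set w \<subseteq> {1..}" using w by (simp add: motzkin_words_def)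
  ultimately show ?thesis by (meson atLeast_iff subsetD)
qed

lemma motzkin_step:
  assumes "Suc k < n"
  shows "w ! Suc k \<le> w ! k + 1 \<and> w ! k \<le> w ! Suc k + 1"
proof -
  have "\<bar>int (w ! Suc k) - int (w ! k)\<bar> \<in> {0, 1}" using w assms by (simp add: motzkin_words_def)
  then show ?thesis by auto
qed

lemma motzkin_first: "w ! 0 = 1"
  using w by (auto simp: motzkin_words_def hd_conv_nth)

lemma motzkin_last: "w ! (n - 1) = 1"
  using w by (auto simp: motzkin_words_def last_conv_nth)

text \<open>A position above level \<open>1\<close> lies under a parent block one level lower
  (\<open>parent\<close>). Between two positions of a block no letter is as low as its depth except
  at its own positions (\<open>same\<close>). Together they place the \<open>k\<close> of
  \<open>nested_in\<close> in the parent block (\<open>nested_block\<close>).\<close>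

lemma labeled_imp_adapted:
  assumes P: "P \<in> labeled_partitions w ls"
  shows "adapted_upto w ls n P"
proof -
  have nc: "noncrossing_partition n P" and dep: "\<And>V r. V \<in> P \<Longrightarrow> r \<in> V \<Longrightarrow> w ! r = depth P V"
    and labs: "\<And>V k l. V \<in> P \<Longrightarrow> k \<in> V \<Longrightarrow> l \<in> V \<Longrightarrow> ls ! k = ls ! l"
    and chain: "\<And>U W. monotone_chain w P [U, W] \<Longrightarrow> block_label ls U \<noteq> block_label ls W"
  proof -
    show "block_label ls U \<noteq> block_label ls W" if "monotone_chain w P [U, W]" for U W
    proof -
      have "\<forall>k. Suc k < length [U, W] \<longrightarrow> block_label ls ([U, W] ! k) \<noteq> block_label ls ([U, W] ! Suc k)"
        using P that unfolding labeled_partitions_def by blast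
      then show ?thesis by auto
    qed
    show "w ! r = depth P V" if "V \<in> P" "r \<in> V" for V r
      using P that by (auto simp: labeled_partitions_def adapted_partitions_def)
    show "ls ! k = ls ! l" if "V \<in> P" "k \<in> V" "l \<in> V" for V k l
      using P that unfolding labeled_partitions_def by blast
  qed (use P in \<open>auto simp: labeled_partitions_def adapted_partitions_def motzkin_length\<close>)
  interpret noncrossing n P by unfold_locales (rule nc)
  have block: "\<exists>V\<in>P. k \<in> V" if "k < n" for k using that part by (auto simp: partition_on_def)
  have lt: "k < n" if "V \<in> P" "k \<in> V" for V k using that partition_lessThan_block(3)[OF part] by auto
  have parent: "\<exists>U W p q. U \<in> P \<and> W \<in> P \<and> r \<in> W \<and> \<not> covering P W \<and> U = nearest_outer P W \<and> outer U W \<and> depth P U = m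
      \<and> p \<in> U \<and> q \<in> U \<and> p < r \<and> r < q"
    if r: "r < n" "w ! r = Suc m" "1 \<le> m" for r m
  proof -
    obtain W where W: "W \<in> P" "r \<in> W" using block r by auto
    have dW: "depth P W = Suc m" using dep W r by simp
    then have ncov: "\<not> covering P W" using covering_iff_depth[OF W(1)] r by simp
    note props = nearest_outer_props[OF W(1) ncov]
    have "depth P (nearest_outer P W) = m" using depth_nearest_outer[OF W(1) ncov] dW by simp
    moreover obtain p q where "p \<in> nearest_outer P W" "q \<in> nearest_outer P W" "p < r" "r < q"
      using props(2) W(2) by (auto simp: outer_def)
    ultimately show ?thesis using W ncov props by blast
  qed
  have same: "x \<in> U" if U: "U \<in> P" "p \<in> U" "q \<in> U" "p < x" "x < q" and x: "w ! x \<le> depth P U" for U p q x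
  proof (rule ccontr)
    assume "x \<notin> U"
    have "x < n" using lt[OF U(1,3)] U by simp
    then obtain X where X: "X \<in> P" "x \<in> X" using block by auto
    then have "U \<noteq> X" using \<open>x \<notin> U\<close> by auto
    then have "outer U X" using outer_between[of U X p q x] U X by auto
    then show False using depth_less[OF U(1) X(1)] dep[OF X] x by simp
  qed
  have nested_block: "k \<in> U" if "U \<in> P" "p \<in> U" "q \<in> U" "p < r" "r < q" "depth P U = w ! k" "nested_in w k r" for U p q k r
  proof -
    have wp: "w ! p = w ! k" using dep that by simp
    have "p \<le> k" using that wp by (metis less_irrefl less_or_eq_imp_le linorder_not_less nested_in_def)
    then consider "p = k" | "p < k" by linarith
    then show ?thesis
    proof cases
      case 2
      then show ?thesis using same[of U p q k] that by (auto simp: nested_in_def)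
    qed (use that in simp)
  qed
  show ?thesis
    unfolding adapted_upto_def
  proof (intro conjI part)
    show "\<forall>V\<in>P. \<forall>k\<in>V. \<forall>l\<in>V. ls ! k = ls ! l \<and> w ! k = w ! l"
      using dep labs by metis
    show "\<forall>V\<in>P. \<forall>k\<in>V. \<forall>l\<in>V. \<forall>r. k < r \<and> r < l \<longrightarrow> w ! k < w ! r \<or> w ! k = w ! r \<and> r \<in> V"
    proof (intro ballI allI impI)
      fix V k l r assume V: "V \<in> P" "k \<in> V" "l \<in> V" "k < r \<and> r < l"
      show "w ! k < w ! r \<or> w ! k = w ! r \<and> r \<in> V"
        using same[of V k l r] V dep[of V k] dep[of V r] by fastforce
    qed
    show "\<forall>k l. link w k l \<and> k + 1 < l \<and> l < n \<longrightarrow> (\<exists>V\<in>P. k \<in> V \<and> l \<in> V)"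
    proof (intro allI impI)
      fix k l assume kl: "link w k l \<and> k + 1 < l \<and> l < n"
      have "w ! k < w ! (k + 1)" using kl by (auto simp: link_def)
      then have w1: "w ! (k + 1) = Suc (w ! k)" using motzkin_step[of k] kl by auto
      \<comment> \<open>The first position of the excursion is nested in \<open>k\<close>, so its
        parent block contains \<open>k\<close>. The right end \<open>q\<close> of that block is on
        the level of \<open>k\<close> and cannot occur before \<open>l\<close>.\<close>
      have nst: "nested_in w k (k + 1)" using w1 by (auto simp: nested_in_def le_Suc_eq)
      obtain U p q where U: "U \<in> P" "depth P U = w ! k" "p \<in> U" "q \<in> U" "p < k + 1" "k + 1 < q"
        using parent[of "k + 1" "w ! k"] w1 kl motzkin_pos[of k] by auto
      have k: "k \<in> U" using nested_block[of U p q "k + 1" k] U nst by auto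
      have "w ! q = w ! k" using dep U by simp
      then have "l \<le> q" using kl U unfolding link_def
        by (metis Suc_eq_plus1 Suc_lessD less_irrefl linorder_not_less)
      then consider "l = q" | "l < q" by linarith
      then have "l \<in> U"
      proof cases
        case 2
        then show ?thesis using same[of U k q l] U k kl by (auto simp: link_def)
      qed (use U in simp)
      then show "\<exists>V\<in>P. k \<in> V \<and> l \<in> V" using U k by blast
    qed
    show "\<forall>k r. nested_in w k r \<and> r < n \<longrightarrow> ls ! k \<noteq> ls ! r"
    proof (intro allI impI)
      fix k r assume kr: "nested_in w k r \<and> r < n"
      then have wr: "w ! r = Suc (w ! k)" "k < r" by (auto simp: nested_in_def)
      obtain U W p q where U: "U \<in> P" "W \<in> P" "r \<in> W" "\<not> covering P W" "U = nearest_outer P W"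
        "outer U W" "depth P U = w ! k" "p \<in> U" "q \<in> U" "p < r" "r < q"
        using parent[of r "w ! k"] wr kr motzkin_pos[of k] by auto
      have k: "k \<in> U" using nested_block[of U p q r k] U kr by auto
      have "w ! x < w ! y" if "x \<in> U" "y \<in> W" for x y
        using depth_less[OF U(1,2,6)] dep[OF U(1) that(1)] dep[OF U(2) that(2)] by simp
      then have "block_label ls U \<noteq> block_label ls W"
        using U by (intro chain) (simp add: monotone_chain_pair)
      moreover have "block_label ls U = ls ! k"
        by (rule block_label_eq[OF k]) (use labs U(1) k in blast)
      moreover have "block_label ls W = ls ! r"
        by (rule block_label_eq[OF U(3)]) (use labs U(2,3) in blast)
      ultimately show "ls ! k \<noteq> ls ! r" by simp
    qed
  qed
qed

text \<open>A crossing a < b < c < d would make the letters strictly increase from a through b to c,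
  although a and c share a block.\<close>

lemma adapted_noncrossing:
  assumes P: "adapted_upto w ls n P"
  shows "noncrossing_partition n P"
  unfolding noncrossing_partition_def
proof (intro conjI adapted_partition[OF P] ballI impI notI)
  fix V W assume V: "V \<in> P" and W: "W \<in> P" and ne: "V \<noteq> W"
  assume "\<exists>a\<in>V. \<exists>b\<in>W. \<exists>c\<in>V. \<exists>d\<in>W. a < b \<and> b < c \<and> c < d"
  then obtain a b c d where abcd: "a \<in> V" "b \<in> W" "c \<in> V" "d \<in> W" "a < b" "b < c" "c < d" by blast
  have "b \<notin> V" "c \<notin> W"
    using partition_same_block[OF adapted_partition[OF P] V W] abcd ne by auto
  then have "w ! a < w ! b" "w ! b < w ! c"
    using adapted_between[OF P V abcd(1,3)] adapted_between[OF P W abcd(2,4)] abcd by auto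
  then show False using adapted_const[OF P V abcd(1,3)] by simp
qed

text \<open>The parent is read off the path: \<open>k\<close> is the last position before
  \<open>V\<close> and \<open>l\<close> the first one after \<open>V\<close> with letter at most
  \<open>m\<close>. They exist since the word starts and ends with 1, and their letters equal
  \<open>m\<close> since steps have size at most one. Being linked across \<open>V\<close>, they lie
  in one block.\<close>

lemma adapted_parent:
  assumes P: "adapted_upto w ls n P" and V: "V \<in> P" and m: "w ! Min V = Suc m" "1 \<le> m"
  obtains k U where "U \<in> P" "k \<in> U" "nested_in w k (Min V)" "w ! k = m" "outer U V"
    "\<And>U'. U' \<in> P \<Longrightarrow> outer U' V \<Longrightarrow> U' = U \<or> outer U' U"
proof -
  interpret noncrossing n P
    by unfold_locales (rule adapted_noncrossing[OF P])
  note blk = partition_lessThan_block[OF part V]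
  have min: "Min V \<in> V" "Min V < n" using blk by (auto intro: Min_in)
  have wV: "w ! r = Suc m" if "r \<in> V" for r using adapted_const[OF P V that min(1)] m by simp
  have inside: "m < w ! s" if s: "Min V \<le> s" "s \<le> Max V" for s
  proof -
    consider "s = Min V" | "s = Max V" | "Min V < s" "s < Max V" using s by linarith
    then show ?thesis
    proof cases
      case 3
      then show ?thesis using adapted_between[OF P V min(1) blk(4), of s] m by auto
    qed (use wV min blk in auto)
  qed
  define k where "k = (GREATEST k. k < Min V \<and> w ! k \<le> m)"
  have ex: "0 < Min V \<and> w ! 0 \<le> m" using motzkin_first m by (cases "Min V = 0") auto
  have k: "k < Min V \<and> w ! k \<le> m"
    unfolding k_def by (rule GreatestI_nat[where P = "\<lambda>k. k < Min V \<and> w ! k \<le> m" and k = 0 and b = "Min V", OF ex]) auto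
  have k_max: "s \<le> k" if "s < Min V \<and> w ! s \<le> m" for s
    unfolding k_def by (rule Greatest_le_nat[where P = "\<lambda>k. k < Min V \<and> w ! k \<le> m" and k = s and b = "Min V", OF that]) auto
  have "w ! Suc k > m"
  proof (cases "Suc k = Min V")
    case False
    then show ?thesis using k_max[of "Suc k"] k by (meson Suc_lessI not_less_eq_eq not_less order_refl)
  qed (use m in simp)
  moreover have "Suc k < n" using k min by simp
  ultimately have wk: "w ! k = m" using motzkin_step[of k] k by auto
  have above_k: "m < w ! s" if "k < s" "s \<le> Max V" for s
  proof (cases "s < Min V")
    case True
    then show ?thesis using k_max[of s] that by (meson leD not_less)
  qed (use that inside in auto)
  have nst: "nested_in w k (Min V)"
    unfolding nested_in_def using k wk m above_k blk by auto
  define l where "l = (LEAST l. Max V < l \<and> w ! l \<le> m)"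
  have "Max V \<noteq> n - 1" using wV[OF blk(4)] motzkin_last m by auto
  then have ex: "Max V < n - 1 \<and> w ! (n - 1) \<le> m" using blk(5) motzkin_last m by auto
  have l: "Max V < l \<and> w ! l \<le> m" unfolding l_def by (rule LeastI[where P = "\<lambda>l. Max V < l \<and> w ! l \<le> m", OF ex])
  have l_min: "l \<le> s" if "Max V < s \<and> w ! s \<le> m" for s unfolding l_def by (rule Least_le[where P = "\<lambda>l. Max V < l \<and> w ! l \<le> m", OF that])
  have ln: "l < n" using l_min[OF ex] n by simp
  obtain l' where l': "l = Suc l'" using l by (cases l) auto
  have "w ! l' > m"
  proof (cases "l' = Max V")
    case False
    then have "Max V < l'" using l l' by linarith
    then show ?thesis using l_min[of l'] l' by (meson Suc_n_not_le_n not_less)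
  qed (use wV blk in auto)
  then have wl: "w ! l = m" using motzkin_step[of l'] l l' ln by auto
  have lnk: "link w k l"
    unfolding link_def
  proof (intro conjI allI impI)
    show "k < l" using k l Min_le[OF blk(2,4)] by linarith
    show "w ! k = w ! l" using wk wl by simp
    fix r assume r: "k < r \<and> r < l"
    show "w ! k < w ! r"
    proof (cases "r \<le> Max V")
      case False
      then show ?thesis using l_min[of r] r wk by (meson leD not_less)
    qed (use above_k r wk in auto)
  qed
  have kV: "k < x" "x < l" if "x \<in> V" for x
    using k l Min_le[OF blk(2) that] Max_ge[OF blk(2) that] by linarith+
  have "k + 1 < l" using kV[OF min(1)] by simp
  then obtain U where U: "U \<in> P" "k \<in> U" "l \<in> U" using adapted_link[OF P lnk] ln by blast
  have UV: "U \<noteq> V" using U kV by blast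
  then have out: "outer U V" unfolding outer_def using U kV by blast
  \<comment> \<open>Any other outer block has its witnesses \<open>p\<close>, \<open>q\<close> at
    letters at most \<open>m\<close>. Hence \<open>p\<close> precedes \<open>k\<close>, and
    noncrossing puts the whole block around \<open>U\<close>.\<close>
  have "U' = U \<or> outer U' U" if U': "U' \<in> P" "outer U' V" for U'
  proof (cases "U' = U")
    case False
    obtain p q where p: "p \<in> U'" "q \<in> U'" "\<forall>x\<in>V. p < x \<and> x < q" and ne: "U' \<noteq> V"
      using U'(2) by (auto simp: outer_def)
    have pV: "p < Min V" "Min V < q" "Max V < q" using p(3) min blk by auto
    have "Min V \<notin> U'" using partition_same_block[OF part U'(1) V] min ne by auto
    then have "w ! p < w ! Min V" using adapted_between[OF P U'(1) p(1,2) pV(1,2)] by simp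
    then have wp: "w ! p \<le> m" "w ! q \<le> m" using m adapted_const[OF P U'(1) p(1,2)] by auto
    have "p \<le> k" using k_max pV wp by simp
    moreover have "p \<noteq> k" using partition_same_block[OF part U'(1) U(1)] p U False by auto
    moreover have "k < q" using pV k by simp
    ultimately have "outer U' U" using outer_between[of U' U p q k] U U' p False by auto
    then show ?thesis ..
  qed simp
  then show ?thesis using that U out nst wk by blast
qed

text \<open>Induction on the letter: a block of letter \<open>1\<close> leaves no smaller letter for
  an outer block, and otherwise the parent has a letter smaller by one.\<close>

lemma adapted_depth:
  assumes P: "adapted_upto w ls n P"
  shows "V \<in> P \<Longrightarrow> depth P V = w ! Min V"
proof (induction "w ! Min V" arbitrary: V)
  case 0
  have "Min V < n" "V \<noteq> {}" using partition_lessThan_block[OF adapted_partition[OF P] 0(2)] Min_in by blast+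
  then show ?case using motzkin_pos[of "Min V"] 0 by simp
next
  case (Suc m V)
  interpret noncrossing n P
    by unfold_locales (rule adapted_noncrossing[OF P])
  have V: "V \<in> P" by (rule Suc.prems)
  note blk = partition_lessThan_block[OF part V]
  have min: "Min V \<in> V" using blk by (auto intro: Min_in)
  show ?case
  proof (cases "m = 0")
    case True
    have "\<not> outer U V" if U: "U \<in> P" for U
    proof
      assume "outer U V"
      then obtain p q where p: "p \<in> U" "q \<in> U" "p < Min V" "Min V < q" and ne: "U \<noteq> V"
        using min by (auto simp: outer_def)
      have "Min V \<notin> U" using partition_same_block[OF part U V] min ne by auto
      then have "w ! p < w ! Min V" using adapted_between[OF P U p] by simp
      moreover have "1 \<le> w ! p" using motzkin_pos partition_lessThan_block(3)[OF part U] p by auto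
      ultimately show False using Suc(2) True by simp
    qed
    then have "outers V = {}" by auto
    then show ?thesis using depth_eq[OF V] Suc(2) True by (simp only: card.empty)
  next
    case False
    obtain k U where U: "U \<in> P" "k \<in> U" "w ! k = m" "outer U V"
      "\<And>U'. U' \<in> P \<Longrightarrow> outer U' V \<Longrightarrow> U' = U \<or> outer U' U"
      using adapted_parent[OF P V Suc(2)[symmetric]] False by (metis One_nat_def Suc_leI not_gr_zero)
    have near: "nearest_outer P V = U"
      using U by (intro nearest_outer_unique[OF V]) auto
    have "Min U \<in> U" using partition_lessThan_block[OF part U(1)] by (auto intro: Min_in)
    then have "w ! Min U = m" using adapted_const[OF P U(1), of "Min U" k] U by simp
    then have "depth P U = m" using Suc.hyps(1)[of U] U by simp
    moreover have "\<not> covering P V" using U by (auto simp: covering_def)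
    ultimately show ?thesis using depth_nearest_outer[OF V] near Suc(2) by simp
  qed
qed

text \<open>The chain condition concerns only pairs of a block and its nearest outer block, and
  their labels are those of a pair of positions in the relation \<open>nested_in\<close>.\<close>

lemma adapted_imp_labeled:
  assumes P: "adapted_upto w ls n P"
  shows "P \<in> labeled_partitions w ls"
proof -
  interpret noncrossing n P
    by unfold_locales (rule adapted_noncrossing[OF P])
  have min: "Min V \<in> V" if "V \<in> P" for V
    using partition_lessThan_block[OF part that] by (auto intro: Min_in)
  have dep: "w ! r = depth P V" if "V \<in> P" "r \<in> V" for V r
    using adapted_depth[OF P that(1)] adapted_const[OF P that(1) that(2) min[OF that(1)]] by simp
  have "block_label ls (nearest_outer P W) \<noteq> block_label ls W"
    if W: "W \<in> P" "\<not> covering P W" for W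
  proof -
    have "depth P W \<noteq> 1" using W covering_iff_depth by simp
    moreover have "1 \<le> depth P W" using depth_eq[OF W(1)] by simp
    moreover have "w ! Min W = depth P W" using dep[OF W(1) min[OF W(1)]] .
    ultimately obtain m where m: "w ! Min W = Suc m" "1 \<le> m" by (cases "depth P W") auto
    obtain k U where U: "U \<in> P" "k \<in> U" "nested_in w k (Min W)" "outer U W"
      "\<And>U'. U' \<in> P \<Longrightarrow> outer U' W \<Longrightarrow> U' = U \<or> outer U' U"
      using adapted_parent[OF P W(1) m] by metis
    have near: "nearest_outer P W = U"
      using U by (intro nearest_outer_unique[OF W(1)]) auto
    have "ls ! k \<noteq> ls ! Min W"
      using adapted_nested[OF P U(3)] partition_lessThan_block(3)[OF part W(1)] min[OF W(1)] by auto
    moreover have "block_label ls U = ls ! k"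
      by (rule block_label_eq[OF U(2)]) (use adapted_const[OF P U(1)] U(2) in blast)
    moreover have "block_label ls W = ls ! Min W"
      by (rule block_label_eq[OF min[OF W(1)]]) (use adapted_const[OF P W(1)] min[OF W(1)] in blast)
    ultimately show ?thesis by (simp add: near)
  qed
  note lab = this
  have "block_label ls (Vs ! k) \<noteq> block_label ls (Vs ! Suc k)"
    if Vs: "monotone_chain w P Vs" "Suc k < length Vs" for Vs k
  proof -
    have "Vs ! Suc k \<in> P" "\<not> covering P (Vs ! Suc k)" "Vs ! k = nearest_outer P (Vs ! Suc k)"
      using Vs nth_mem[of "Suc k" Vs] unfolding monotone_chain_def by blast+
    then show ?thesis using lab by metis
  qed
  moreover have "P \<in> adapted_partitions w"
    unfolding adapted_partitions_def motzkin_length using noncrossing dep by blast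
  moreover have "\<forall>V\<in>P. \<forall>k\<in>V. \<forall>l\<in>V. ls ! k = ls ! l"
    using adapted_const[OF P] by blast
  ultimately show ?thesis unfolding labeled_partitions_def by blast
qed

lemma labeled_partitions_eq: "labeled_partitions w ls = {P. adapted_upto w ls n P}"
  using labeled_imp_adapted adapted_imp_labeled by blast

end

section \<open>Boolean cumulants\<close>

text \<open>On a constant word links join adjacent positions only and nothing is nested; betweenness
  then says that blocks are intervals.\<close>

lemma interval_partitions_adapted:
  "{P. adapted_upto (replicate n 1) (replicate n ()) n P} = interval_partitions n"
proof -
  have "adapted_upto (replicate n 1) (replicate n ()) n P \<longleftrightarrow> P \<in> interval_partitions n" for P
  proof
    assume P: "adapted_upto (replicate n 1) (replicate n ()) n P"
    have "{x..y} \<subseteq> V" if V: "V \<in> P" "x \<in> V" "y \<in> V" for V x y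
    proof
      fix r assume r: "r \<in> {x..y}"
      have "x < n" "y < n" using V partition_lessThan_block(3)[OF adapted_partition[OF P]] by blast+
      consider "r = x" | "r = y" | "x < r" "r < y" using r by fastforce
      then show "r \<in> V"
      proof cases
        case 3
        then show ?thesis using adapted_between[OF P V] \<open>x < n\<close> \<open>y < n\<close> by auto
      qed (use V in auto)
    qed
    then show "P \<in> interval_partitions n"
      using adapted_partition[OF P] by (simp add: interval_partitions_def)
  next
    assume P: "P \<in> interval_partitions n"
    have part: "partition_on {..<n} P" and int: "\<And>V x y. V \<in> P \<Longrightarrow> x \<in> V \<Longrightarrow> y \<in> V \<Longrightarrow> {x..y} \<subseteq> V"
      using P unfolding interval_partitions_def by blast+
    have lt: "k < n" if "V \<in> P" "k \<in> V" for V k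
      using that partition_lessThan_block(3)[OF part] by blast
    show "adapted_upto (replicate n 1) (replicate n ()) n P"
      unfolding adapted_upto_def
    proof (intro conjI part)
      show "\<forall>V\<in>P. \<forall>k\<in>V. \<forall>l\<in>V. replicate n () ! k = replicate n () ! l \<and>
          replicate n (1 :: nat) ! k = replicate n 1 ! l"
        using lt by simp
      show "\<forall>V\<in>P. \<forall>k\<in>V. \<forall>l\<in>V. \<forall>r. k < r \<and> r < l \<longrightarrow> replicate n (1 :: nat) ! k < replicate n 1 ! r \<or>
          replicate n (1 :: nat) ! k = replicate n 1 ! r \<and> r \<in> V"
      proof (intro ballI allI impI)
        fix V k l r assume V: "V \<in> P" "k \<in> V" "l \<in> V" and r: "k < r \<and> r < l"
        then have "r \<in> V" using int[OF V] by auto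
        then show "replicate n (1 :: nat) ! k < replicate n 1 ! r \<or>
          replicate n (1 :: nat) ! k = replicate n 1 ! r \<and> r \<in> V"
          using lt[OF V(1)] V by simp
      qed
      show "\<forall>k l. link (replicate n 1) k l \<and> k + 1 < l \<and> l < n \<longrightarrow> (\<exists>V\<in>P. k \<in> V \<and> l \<in> V)"
      proof (intro allI impI)
        fix k l assume kl: "link (replicate n 1) k l \<and> k + 1 < l \<and> l < n"
        then have "replicate n (1 :: nat) ! k < replicate n 1 ! (k + 1)" by (auto simp: link_def)
        then show "\<exists>V\<in>P. k \<in> V \<and> l \<in> V" using kl by simp
      qed
      show "\<forall>k r. nested_in (replicate n 1) k r \<and> r < n \<longrightarrow> replicate n () ! k \<noteq> replicate n () ! r"
        by (auto simp: nested_in_def)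
    qed
  qed
  then show ?thesis by blast
qed

section \<open>Moments expressed through products with \<open>pp\<close>\<close>

context ncps
begin

lemma ordered_prod_closed: "set as \<subseteq> carrier A \<Longrightarrow> ordered_prod A as \<in> carrier A"
  by (induction as) auto

text \<open>With one label both branches of a level step are present, and their sum undoes the
  insertion of \<open>pp\<close>.\<close>

lemma run_one_level:
  assumes "u \<noteq> []" "set u \<subseteq> carrier A" "set as \<subseteq> carrier A"
  shows "run (\<lambda>_ u. state (perp_prod u)) [((), u)] (map (\<lambda>a. (1, (), a)) as)
    = state (perp_prod u \<otimes>\<^bsub>T\<^esub> emb (ordered_prod A as))"
  using assms
proof (induction as arbitrary: u)
  case Nil
  then show ?case by (simp add: emb_one)
next
  case (Cons a as)
  have a: "a \<in> carrier A" and as: "set as \<subseteq> carrier A" using Cons.prems by auto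
  define y where "y = emb (ordered_prod A as)"
  have y: "y \<in> carrier T" and u: "perp_prod u \<in> carrier T" and ea: "emb a \<in> carrier T"
    using as a Cons.prems by (auto simp: y_def ordered_prod_closed)
  have "run (\<lambda>_ u. state (perp_prod u)) [((), u)] (map (\<lambda>a. (1, (), a)) (a # as))
    = state (perp_prod (u @ [a]) \<otimes>\<^bsub>T\<^esub> y) + state (perp_prod u) * state (emb a \<otimes>\<^bsub>T\<^esub> y)"
    using Cons.IH[of "u @ [a]"] Cons.IH[of "[a]"] Cons.prems by (simp add: y_def)
  also have "\<dots> = state (perp_prod u \<otimes>\<^bsub>T\<^esub> (emb a \<otimes>\<^bsub>T\<^esub> y))"
    using Cons.prems(1) y u ea by (simp add: perp_prod_snoc TR.m_assoc state_mult_pp)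
  also have "emb a \<otimes>\<^bsub>T\<^esub> y = emb (ordered_prod A (a # as))"
    using a as by (simp add: y_def emb_mult ordered_prod_closed)
  finally show ?case .
qed

lemma moment_perp_prod:
  assumes "as \<noteq> []" "set as \<subseteq> carrier A"
  shows "\<phi> (ordered_prod A as) =
    (\<Sum>P\<in>interval_partitions (length as). \<Prod>V\<in>P. state (perp_prod (nths as V)))"
proof -
  define N where "N = length as"
  define w where "w = replicate N (1 :: nat)"
  define ls where "ls = replicate N ()"
  obtain a as' where as: "as = a # as'" using assms by (cases as) auto
  have N: "1 \<le> N" by (simp add: N_def as)
  have a: "a \<in> carrier A" and as': "set as' \<subseteq> carrier A" using assms by (auto simp: as)
  have "map (labeled_letter w ls as) [1..<N] = map (\<lambda>a. (1, (), a)) as'"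
    by (rule nth_equalityI) (simp_all add: labeled_letter_def w_def N_def as del: upt_Suc replicate_Suc)
  then have run: "run (\<lambda>_ u. state (perp_prod u)) [(ls ! 0, [as ! 0])] (map (labeled_letter w ls as) [1..<N])
    = state (emb a \<otimes>\<^bsub>T\<^esub> emb (ordered_prod A as'))"
    using run_one_level[of "[a]" as'] a as' by (simp add: as)
  have "\<phi> (ordered_prod A as) = state (emb a \<otimes>\<^bsub>T\<^esub> emb (ordered_prod A as'))"
    using a as' by (simp add: emb_mult ordered_prod_closed as)
  also note run[symmetric]
  also have "run (\<lambda>_ u. state (perp_prod u)) [(ls ! 0, [as ! 0])] (map (labeled_letter w ls as) [1..<N])
    = (\<Sum>P | adapted_upto w ls N P. \<Prod>V\<in>P. state (perp_prod (nths as V)))"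
    by (rule run_eq_sum_adapted) (use N in \<open>auto simp: w_def simp flip: N_def\<close>)
  finally show ?thesis
    unfolding w_def ls_def N_def interval_partitions_adapted .
qed

text \<open>Both sides are the one-block term of the same moment formula, and the remaining terms
  involve shorter tuples only.\<close>

lemma state_perp_prod:
  "as \<noteq> [] \<Longrightarrow> set as \<subseteq> carrier A \<Longrightarrow> state (perp_prod as) = boolean_cumulant A \<phi> as"
proof (induction "length as" arbitrary: as rule: less_induct)
  case less
  let ?I = "interval_partitions (length as)" and ?one = "{{..<length as}}"
  have "?one \<in> ?I"
    using less.prems by (auto simp: interval_partitions_def partition_on_def disjoint_def)
  then have "\<phi> (ordered_prod A as) = (\<Prod>V\<in>?one. state (perp_prod (nths as V))) +
      (\<Sum>P\<in>?I - {?one}. \<Prod>V\<in>P. state (perp_prod (nths as V)))"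
    unfolding moment_perp_prod[OF less.prems] by (intro sum.remove) auto
  also have "(\<Prod>V\<in>?one. state (perp_prod (nths as V))) = state (perp_prod as)"
    by simp
  also have "(\<Sum>P\<in>?I - {?one}. \<Prod>V\<in>P. state (perp_prod (nths as V))) =
    (\<Sum>P\<in>?I - {?one}. \<Prod>V\<in>P. boolean_cumulant A \<phi> (nths as V))"
  proof (intro sum.cong prod.cong refl)
    fix P V assume P: "P \<in> ?I - {?one}" and V: "V \<in> P"
    have part: "partition_on {..<length as} P" using P by (simp add: interval_partitions_def)
    obtain k where "k \<in> V" "k < length as" using partition_lessThan_block[OF part V] by blast
    then have "as ! k \<in> set (nths as V)" by (auto simp: set_nths)
    then have "nths as V \<noteq> []" by auto
    moreover have "set (nths as V) \<subseteq> carrier A" using less.prems set_nths_subset by fastforce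
    ultimately show "state (perp_prod (nths as V)) = boolean_cumulant A \<phi> (nths as V)"
      using length_nths_proper_block[OF P V] by (intro less.hyps)
  qed
  finally show ?case using boolean_cumulant.simps[of A \<phi> as] by simp
qed

end

theorem theorem8p1:
  fixes A :: "'i \<Rightarrow> (complex, 'a) module"
    and \<phi> :: "'i \<Rightarrow> 'a \<Rightarrow> complex"
    and n :: nat
    and w :: "nat list" and ls :: "'i list" and as :: "'a list"
  assumes "\<And>i. nc_prob_space (A i) (\<phi> i)"
    and "1 \<le> n"
    and "w \<in> motzkin_words n"
    and "length ls = n" and "length as = n"
    and "\<And>k. k < n \<Longrightarrow> as ! k \<in> carrier (A (ls ! k))"
  shows "motzkin_functional A \<phi> w ls as =
           (\<Sum>P\<in>labeled_partitions w ls. partition_cumulant A \<phi> ls P as)"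
proof -
  interpret ncps_family A \<phi> by unfold_locales (rule assms(1))
  note motzkin = motzkin_length[OF assms(2,3)] motzkin_pos[OF assms(2,3)] motzkin_step[OF assms(2,3)]
    motzkin_first[OF assms(2,3)] motzkin_last[OF assms(2,3)]
  let ?letter = "labeled_letter w ls as"
  have valid: "valid_letters (map ?letter [0..<n])"
    using motzkin(2) assms(6) by (auto simp: valid_letters_def labeled_letter_def)
  \<comment> \<open>The height before position \<open>m\<close> is the letter at
    \<open>m - 1\<close>; position \<open>0\<close> is left to
    \<open>expand_run_start\<close>.\<close>
  have adm: "admissible (w ! (m - 1)) (map ?letter [m..<n])" if "1 \<le> m" for m
    using that
  proof (induction "n - m" arbitrary: m)
    case (Suc d)
    then have "m < n" "Suc (m - 1) = m" by auto
    then show ?case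
      using Suc.hyps(1)[of "Suc m"] Suc.hyps(2) motzkin(2)[of m] motzkin(3)[of "m - 1"]
      by (simp add: upt_conv_Cons labeled_letter_def)
  qed simp
  have upt: "map ?letter [0..<n] = (1, ls ! 0, as ! 0) # map ?letter [1..<n]"
    using assms(2) motzkin(4) by (simp add: upt_conv_Cons labeled_letter_def)
  have "motzkin_functional A \<phi> w ls as
    = rep_functional A \<phi> (ordered_prod X (map (\<lambda>(j, i, a). replica A i j a) (map ?letter [0..<n])))"
    by (simp add: motzkin_functional_def motzkin(1) labeled_letter_def o_def)
  also have "\<dots> = expand \<one>\<^bsub>M\<^esub> (map ?letter [0..<n])"
    by (rule rep_functional_prod[OF valid])
  also have "\<dots> = run block_weight [(ls ! 0, [as ! 0])] (map ?letter [1..<n])"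
    unfolding upt using valid adm[of 1] motzkin(4)
    by (intro expand_run_start) (simp_all add: upt)
  also have "\<dots> = (\<Sum>P | adapted_upto w ls n P. \<Prod>V\<in>P. block_weight (block_label ls V) (nths as V))"
    using assms(2,5) motzkin by (intro run_eq_sum_adapted) auto
  also have "\<dots> = (\<Sum>P | adapted_upto w ls n P. partition_cumulant A \<phi> ls P as)"
    unfolding partition_cumulant_def
  proof (intro sum.cong prod.cong refl)
    fix P V assume "P \<in> {P. adapted_upto w ls n P}" and V: "V \<in> P"
    then have P: "adapted_upto w ls n P" by simp
    note blk = partition_lessThan_block[OF adapted_partition[OF P] V]
    have lab: "block_label ls V = ls ! k" if "k \<in> V" for k
      by (rule block_label_eq[OF that]) (use adapted_const[OF P V] that in blast)
    have "set (nths as V) \<subseteq> carrier (A (block_label ls V))"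
      using assms(5,6) lab by (auto simp: set_nths)
    moreover have "as ! Max V \<in> set (nths as V)"
      unfolding set_nths using blk(4,5) assms(5) by blast
    then have "nths as V \<noteq> []" by auto
    ultimately show "block_weight (block_label ls V) (nths as V) =
        boolean_cumulant (A (block_label ls V)) (\<phi> (block_label ls V)) (nths as V)"
      unfolding block_weight_def by (intro N.state_perp_prod)
  qed
  finally show ?thesis unfolding labeled_partitions_eq[OF assms(2,3)] .
qed

end
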